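(* A finite group $G$ is a $CD1$-group with $N=G'$ if and only if one of the following statements holds: (a) $G$ is an extra-special $2$-group of order $2^{2m+1}$. The degree pattern of $G$ is $(1^{(2^{2m})},2^m)$. (b) $G$ is a doubly transitive Frobenius group of order $(p^n-1)p^n$ ($p$ a prime, $n$ a positive integer) with a cyclic complement. The degree pattern of $G$ is $(1^{(p^n-1)},p^n-1)$.
   Context: All groups are finite. Let $\mathrm{Irr}(G)=\{\chi_1,\dots,\chi_k\}$ be the set of complex irreducible characters of $G$, with $\chi_1=1_G$ and $\chi_1(1)=1\le\chi_2(1)\le\dots\le\chi_k(1)$. A group $G$ is a $CD1$-group if $|G|>2$ and two columns of its character table differ by exactly one entry, i.e. there are non-conjugate $a,b\in G$ and an index $j$ with $\chi_j(a)\ne\chi_j(b)$ and $\chi_i(a)=\chi_i(b)$ for all $i\ne j$. For a $CD1$-group put $N=\bigcap_{i=1}^{k-1}\ker\chi_i$ (it is known that the columns differ exactly in the row of $\chi_k$, and that $\chi_k(1)>\chi_{k-1}(1)$). $G'$ is the commutator subgroup of $G$. A Frobenius group $G$ with Frobenius kernel $F$ and Frobenius complement $H$ is called doubly transitive if $|H|=|F|-1$. The degree pattern of $G$ is the list of degrees of its irreducible characters, where $d^{(m)}$ means that degree $d$ occurs $m$ times: $(1^{(c)},d)$ means exactly $c$ linear characters and exactly one further irreducible character, of degree $d$. *)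

theory Defs
  imports
    "HOL-Algebra.Elementary_Groups"
    "HOL-Algebra.Generated_Groups"
    "HOL-Library.Multiset"
    "HOL-Computational_Algebra.Primes"
    "Jordan_Normal_Form.VS_Connect"
    Complex_Main
begin

section \<open>Complex irreducible characters\<close>

definition GL :: "nat \<Rightarrow> complex mat monoid" where
  "GL n = units_of (ring_mat TYPE(complex) n ())"

definition representation :: "('a, 'b) monoid_scheme \<Rightarrow> nat \<Rightarrow> ('a \<Rightarrow> complex mat) \<Rightarrow> bool" where
  "representation G n \<rho> \<longleftrightarrow> \<rho> \<in> hom G (GL n)"

definition irreducible_representation ::
    "('a, 'b) monoid_scheme \<Rightarrow> nat \<Rightarrow> ('a \<Rightarrow> complex mat) \<Rightarrow> bool" where
  "irreducible_representation G n \<rho> \<longleftrightarrow>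
     representation G n \<rho> \<and> n > 0 \<and>
     (\<forall>W. VectorSpace.subspace class_ring W (module_vec TYPE(complex) n) \<and>
          (\<forall>g\<in>carrier G. \<forall>w\<in>W. \<rho> g *\<^sub>v w \<in> W) \<longrightarrow>
          W = {0\<^sub>v n} \<or> W = carrier_vec n)"

definition mat_trace :: "complex mat \<Rightarrow> complex" where
  "mat_trace A = (\<Sum>i<dim_row A. A $$ (i, i))"

text \<open>Characters are restricted to the carrier, so that equality of two characters as HOL
  functions means equality on the group, and \<open>Irr G\<close> has one element per row of the
  character table.\<close>

definition Irr :: "('a, 'b) monoid_scheme \<Rightarrow> ('a \<Rightarrow> complex) set" where
  "Irr G = {\<chi>. \<exists>n \<rho>. irreducible_representation G n \<rho> \<and>
                    \<chi> = (\<lambda>g\<in>carrier G. mat_trace (\<rho> g))}"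

definition char_kernel :: "('a, 'b) monoid_scheme \<Rightarrow> ('a \<Rightarrow> complex) \<Rightarrow> 'a set" where
  "char_kernel G \<chi> = {g \<in> carrier G. \<chi> g = \<chi> \<one>\<^bsub>G\<^esub>}"

definition degree_pattern :: "('a, 'b) monoid_scheme \<Rightarrow> complex multiset" where
  "degree_pattern G = image_mset (\<lambda>\<chi>. \<chi> \<one>\<^bsub>G\<^esub>) (mset_set (Irr G))"


section \<open>CD1-groups\<close>

definition conjugate_in :: "('a, 'b) monoid_scheme \<Rightarrow> 'a \<Rightarrow> 'a \<Rightarrow> bool" where
  "conjugate_in G a b \<longleftrightarrow> (\<exists>x\<in>carrier G. b = x \<otimes>\<^bsub>G\<^esub> a \<otimes>\<^bsub>G\<^esub> inv\<^bsub>G\<^esub> x)"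

definition CD1_group :: "('a, 'b) monoid_scheme \<Rightarrow> bool" where
  "CD1_group G \<longleftrightarrow>
     Coset.order G > 2 \<and>
     (\<exists>a\<in>carrier G. \<exists>b\<in>carrier G. \<not> conjugate_in G a b \<and>
        (\<exists>\<chi>\<in>Irr G. \<chi> a \<noteq> \<chi> b \<and> (\<forall>\<psi>\<in>Irr G - {\<chi>}. \<psi> a = \<psi> b)))"

text \<open>The irreducible character \<open>\<chi>\<^sub>k\<close> that comes last in the ordering by degree. Degrees are
  positive integers, so the real part of \<open>\<chi> \<one>\<close> is the degree itself. In a CD1-group the
  character of largest degree is unique, so no choice is involved there.\<close>

definition last_character :: "('a, 'b) monoid_scheme \<Rightarrow> 'a \<Rightarrow> complex" where
  "last_character G = arg_max (\<lambda>\<chi>. Re (\<chi> \<one>\<^bsub>G\<^esub>)) (\<lambda>\<chi>. \<chi> \<in> Irr G)"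

text \<open>\<open>N = \<Inter>\<^sub>i\<^sub><\<^sub>k ker \<chi>\<^sub>i\<close>; an empty intersection is the whole group.\<close>

definition CD1_kernel :: "('a, 'b) monoid_scheme \<Rightarrow> 'a set" where
  "CD1_kernel G = carrier G \<inter> (\<Inter>\<chi>\<in>Irr G - {last_character G}. char_kernel G \<chi>)"


section \<open>Extra-special and Frobenius groups\<close>

definition center :: "('a, 'b) monoid_scheme \<Rightarrow> 'a set" where
  "center G = {z \<in> carrier G. \<forall>x\<in>carrier G. z \<otimes>\<^bsub>G\<^esub> x = x \<otimes>\<^bsub>G\<^esub> z}"

definition elementary_abelian :: "nat \<Rightarrow> ('a, 'b) monoid_scheme \<Rightarrow> bool" where
  "elementary_abelian p G \<longleftrightarrow> comm_group G \<and> (\<forall>x\<in>carrier G. x [^]\<^bsub>G\<^esub> p = \<one>\<^bsub>G\<^esub>)"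

definition extraspecial :: "nat \<Rightarrow> ('a, 'b) monoid_scheme \<Rightarrow> bool" where
  "extraspecial p G \<longleftrightarrow>
     group G \<and> Factorial_Ring.prime p \<and> (\<exists>k. Coset.order G = p ^ k) \<and>
     card (center G) = p \<and>
     elementary_abelian p (G Mod center G) \<and> Coset.order (G Mod center G) > 1"

definition conjugate_subgroup :: "('a, 'b) monoid_scheme \<Rightarrow> 'a \<Rightarrow> 'a set \<Rightarrow> 'a set" where
  "conjugate_subgroup G x H = (\<lambda>h. x \<otimes>\<^bsub>G\<^esub> h \<otimes>\<^bsub>G\<^esub> inv\<^bsub>G\<^esub> x) ` H"

definition frobenius_complement :: "('a, 'b) monoid_scheme \<Rightarrow> 'a set \<Rightarrow> bool" where
  "frobenius_complement G H \<longleftrightarrow>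
     subgroup H G \<and> H \<noteq> {\<one>\<^bsub>G\<^esub>} \<and> H \<noteq> carrier G \<and>
     (\<forall>x\<in>carrier G - H. H \<inter> conjugate_subgroup G x H = {\<one>\<^bsub>G\<^esub>})"

definition frobenius_kernel :: "('a, 'b) monoid_scheme \<Rightarrow> 'a set \<Rightarrow> 'a set" where
  "frobenius_kernel G H =
     (carrier G - (\<Union>x\<in>carrier G. conjugate_subgroup G x H)) \<union> {\<one>\<^bsub>G\<^esub>}"

definition doubly_transitive_frobenius :: "('a, 'b) monoid_scheme \<Rightarrow> 'a set \<Rightarrow> bool" where
  "doubly_transitive_frobenius G H \<longleftrightarrow>
     frobenius_complement G H \<and> card H = card (frobenius_kernel G H) - 1"

end

theory Submission
  imports Defs "Jordan_Normal_Form.Char_Poly" "HOL-Computational_Algebra.Fundamental_Theorem_Algebra"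
    "HOL-Algebra.Multiplicative_Group" "HOL-Algebra.Sylow"
begin

text \<open>Let \<open>G'\<close> be the commutator subgroup, \<open>c\<close> its index and \<open>q\<close> its order. An irreducible character is
  linear if and only if its kernel contains \<open>G'\<close>. In a nonabelian group the character of largest degree
  is not linear, so \<open>N = G'\<close> says that all the other irreducible characters are linear. A CD1-group is
  never abelian: if all characters are linear and all but one of them have the value 1 at some \<open>x \<noteq> 1\<close>,
  then their sum \<open>0\<close> at \<open>x\<close> is \<open>\<bar>G\<bar> - 1\<close> plus a number of absolute value 1. So the condition of the theorem is
  that \<open>G\<close> has exactly one nonlinear irreducible character (\<open>CD1_kernel_eq_derived_iff\<close>).

  This condition is one about conjugacy classes. For a normal subgroup \<open>M\<close>, the sum of \<open>\<chi>(1) \<chi>\<close> over the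
  irreducible \<open>\<chi>\<close> with \<open>M\<close> in their kernel is \<open>\<bar>G : M\<bar>\<close> on \<open>M\<close> and zero elsewhere (\<open>sum_Irr_over_normal\<close>).
  Subtracting the case \<open>M = G'\<close> from the case \<open>M = 1\<close> shows that a single nonlinear character is constant on
  \<open>G' - 1\<close> and zero outside \<open>G'\<close>, and that its degree \<open>d\<close> satisfies \<open>d\<^sup>2 = c (q - 1)\<close>. As characters separate
  classes, \<open>G' - 1\<close> and all the cosets of \<open>G'\<close> other than \<open>G'\<close> are then conjugacy classes. Conversely, if they
  are, then every nonlinear character, having sum zero over each coset of \<open>G'\<close>, is a multiple of one
  fixed function, and by orthogonality there is only one (\<open>classes_iff_unique_nonlinear\<close>).

  It remains to find the groups with these classes. All nontrivial elements of \<open>G'\<close> are conjugate, hence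
  of the same prime order \<open>p\<close>; so \<open>G'\<close> is a \<open>p\<close>-group, and it is abelian because its center is nontrivial.
  If \<open>q = 2\<close>, then \<open>G'\<close> is the center, it contains all squares, and \<open>c = d\<^sup>2\<close> is a power of 4: \<open>G\<close> is
  extraspecial. If \<open>q > 2\<close>, then the center is trivial, and some \<open>x\<close> outside \<open>G'\<close> does not centralize \<open>G'\<close>. The
  centralizer of \<open>x\<close> in \<open>G'\<close> is normal in \<open>G\<close>, hence trivial; so the centralizer \<open>H\<close> of \<open>x\<close>, which has order
  \<open>c\<close>, is a complement of \<open>G'\<close>. It is abelian and acts regularly on \<open>G' - 1\<close>, which makes \<open>G\<close> a
  doubly transitive Frobenius group. The action turns \<open>G'\<close> into a field with multiplicative group \<open>H\<close>, so
  \<open>H\<close> is cyclic. In the opposite direction, counting elements and centralizers shows that the groups of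
  both families have the classes required.

  The character theory rests on Schur's lemma and on the fact that a function on \<open>G\<close> that is sent to zero by
  all irreducible representations is zero (\<open>irreducibles_separate_functions\<close>).\<close>

section \<open>Subspaces as images of injective matrices\<close>

abbreviation complex_subspace :: "nat \<Rightarrow> complex vec set \<Rightarrow> bool" where
  "complex_subspace n W \<equiv> VectorSpace.subspace class_ring W (module_vec TYPE(complex) n)"

text \<open>Subspaces are handled through the injective matrices that have them as image: the columns of the
  matrix are a basis, and multiplication by it replaces the passage to coordinates.\<close>

definition injective_mat :: "nat \<Rightarrow> nat \<Rightarrow> complex mat \<Rightarrow> bool" where
  "injective_mat n m T \<longleftrightarrow> T \<in> carrier_mat n m \<and>
     (\<forall>v\<in>carrier_vec m. T *\<^sub>v v = 0\<^sub>v n \<longrightarrow> v = 0\<^sub>v m)"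

lemma subspace_iff:
  "complex_subspace n W \<longleftrightarrow>
     W \<subseteq> carrier_vec n \<and> 0\<^sub>v n \<in> W \<and> (\<forall>v\<in>W. \<forall>w\<in>W. v + w \<in> W) \<and> (\<forall>c. \<forall>v\<in>W. c \<cdot>\<^sub>v v \<in> W)"
    (is "?L \<longleftrightarrow> ?R")
proof
  assume ?L
  then interpret subspace class_ring W "module_vec TYPE(complex) n" .
  interpret submodule class_ring W "module_vec TYPE(complex) n" by (rule submod)
  show ?R
    using subset m_closed zero_closed smult_closed
    by (auto simp: module_vec_simps class_ring_simps)
next
  assume ?R
  then show ?L
    unfolding VectorSpace.subspace_def submodule_def
    using vec_vs[of n, where ?'a = complex]
    by (auto simp: module_vec_simps class_ring_simps vectorspace_def)
qed

lemma det_eq_0_if_zero_row: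
  fixes A :: "complex mat"
  assumes A: "A \<in> carrier_mat n n" and i: "i < n" and z: "\<And>j. j < n \<Longrightarrow> A $$ (i, j) = 0"
  shows "det A = 0"
proof -
  have "transpose_mat A *\<^sub>v unit_vec n i = 0\<^sub>v n"
    using A i z by (intro eq_vecI) auto
  moreover have "unit_vec n i \<noteq> (0\<^sub>v n :: complex vec)"
    using i by (metis index_unit_vec(1) index_zero_vec(1) one_neq_zero)
  ultimately have "det (transpose_mat A) = 0"
    using A by (subst det_0_iff_vec_prod_zero) (auto intro!: exI[of _ "unit_vec n i"])
  then show ?thesis using det_transpose[OF A] by simp
qed

lemma kernel_nontrivial:
  fixes T :: "complex mat"
  assumes T: "T \<in> carrier_mat n m" and nm: "n < m"
  shows "\<exists>v\<in>carrier_vec m. v \<noteq> 0\<^sub>v m \<and> T *\<^sub>v v = 0\<^sub>v n"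
proof -
  \<comment> \<open>Padding by zero rows gives a square matrix of determinant 0.\<close>
  define A where "A = mat m m (\<lambda>(i,j). if i < n then T $$ (i,j) else 0)"
  have A: "A \<in> carrier_mat m m" by (simp add: A_def)
  have "det A = 0"
    by (rule det_eq_0_if_zero_row[OF A, of "m - 1"]) (use nm in \<open>auto simp: A_def\<close>)
  then obtain v where v: "v \<in> carrier_vec m" "v \<noteq> 0\<^sub>v m" "A *\<^sub>v v = 0\<^sub>v m"
    using det_0_iff_vec_prod_zero[OF A] by auto
  have "T *\<^sub>v v = 0\<^sub>v n"
  proof (rule eq_vecI)
    fix i assume "i < dim_vec (0\<^sub>v n :: complex vec)"
    then have i: "i < n" by simp
    have "row A i = row T i" using i nm T by (intro eq_vecI) (auto simp: A_def)
    moreover have "(A *\<^sub>v v) $ i = 0" using v i nm by simp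
    ultimately show "(T *\<^sub>v v) $ i = 0\<^sub>v n $ i" using i T A nm by simp
  qed (use T in auto)
  then show ?thesis using v by auto
qed

lemma injective_mat_dim: "injective_mat n m T \<Longrightarrow> m \<le> n"
  using kernel_nontrivial[of T n m] by (force simp: injective_mat_def not_le[symmetric])

lemma injective_square_surj:
  assumes "injective_mat n n T" "w \<in> carrier_vec n"
  shows "\<exists>v\<in>carrier_vec n. T *\<^sub>v v = w"
proof -
  have T: "T \<in> carrier_mat n n" using assms by (simp add: injective_mat_def)
  have "det T \<noteq> 0" using assms(1) det_0_iff_vec_prod_zero[OF T] by (auto simp: injective_mat_def)
  from det_non_zero_imp_unit[OF T this, of undefined]
  obtain B where B: "B \<in> carrier_mat n n" "T * B = 1\<^sub>m n"
    by (auto simp: Units_def ring_mat_simps)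
  have "T *\<^sub>v (B *\<^sub>v w) = w"
    using assms(2) T B by (simp flip: assoc_mult_mat_vec)
  then show ?thesis using B assms(2) by (intro bexI[of _ "B *\<^sub>v w"]) auto
qed

text \<open>Take an injective matrix with image in the subspace and as many columns as possible: a vector of the
  subspace outside the image could be appended as a further column.\<close>

lemma subspace_is_image:
  assumes "complex_subspace n W"
  shows "\<exists>m T. injective_mat n m T \<and> W = (\<lambda>v. T *\<^sub>v v) ` carrier_vec m"
proof -
  note W = assms[unfolded subspace_iff]
  define P where "P m \<longleftrightarrow> (\<exists>T. injective_mat n m T \<and> (\<lambda>v. T *\<^sub>v v) ` carrier_vec m \<subseteq> W)" for m
  have "P 0" unfolding P_def
  proof (intro exI[of _ "0\<^sub>m n 0"] conjI subsetI)
    show "injective_mat n 0 (0\<^sub>m n 0)" by (auto simp: injective_mat_def)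
    fix x :: "complex vec" assume "x \<in> (*\<^sub>v) (0\<^sub>m n 0) ` carrier_vec 0"
    then have "x = 0\<^sub>v n" by (auto intro!: eq_vecI simp: scalar_prod_def)
    then show "x \<in> W" using W by simp
  qed
  moreover have "\<And>m. P m \<Longrightarrow> m \<le> n" by (auto simp: P_def injective_mat_dim)
  ultimately obtain m where m: "P m" and max: "\<And>k. P k \<Longrightarrow> k \<le> m"
    using GreatestI_nat[of P 0 n] Greatest_le_nat[of P _ n] by metis
  from m obtain T where T: "injective_mat n m T" and im: "(\<lambda>v. T *\<^sub>v v) ` carrier_vec m \<subseteq> W"
    by (auto simp: P_def)
  have Tc: "T \<in> carrier_mat n m" using T by (simp add: injective_mat_def)
  have "w \<in> (\<lambda>v. T *\<^sub>v v) ` carrier_vec m" if w: "w \<in> W" for w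
  proof (rule ccontr)
    assume nw: "w \<notin> (\<lambda>v. T *\<^sub>v v) ` carrier_vec m"
    have wc: "w \<in> carrier_vec n" using w W by auto
    define T' where "T' = mat n (Suc m) (\<lambda>(i,j). if j < m then T $$ (i,j) else w $ i)"
    have dec: "T' *\<^sub>v v = T *\<^sub>v vec m (\<lambda>j. v $ j) + v $ m \<cdot>\<^sub>v w" if "v \<in> carrier_vec (Suc m)" for v
      using that Tc wc by (intro eq_vecI) (auto simp: T'_def scalar_prod_def mult.commute)
    have "injective_mat n (Suc m) T'" unfolding injective_mat_def
    proof (intro conjI ballI impI)
      show "T' \<in> carrier_mat n (Suc m)" by (simp add: T'_def)
      fix v assume v: "v \<in> carrier_vec (Suc m)" and z: "T' *\<^sub>v v = 0\<^sub>v n"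
      let ?u = "vec m (\<lambda>j. v $ j)" let ?c = "v $ m"
      have eq: "T *\<^sub>v ?u + ?c \<cdot>\<^sub>v w = 0\<^sub>v n" using dec[OF v] z by simp
      have c0: "?c = 0"
      proof (rule ccontr)
        assume c: "?c \<noteq> 0"
        have "T *\<^sub>v ((- 1 / ?c) \<cdot>\<^sub>v ?u) = w"
        proof (rule eq_vecI)
          fix i assume "i < dim_vec w"
          then have i: "i < n" using wc by simp
          have "(T *\<^sub>v ?u) $ i + ?c * w $ i = 0"
            using arg_cong[OF eq, of "\<lambda>x. x $ i"] i Tc wc by simp
          moreover have "(T *\<^sub>v ((- 1 / ?c) \<cdot>\<^sub>v ?u)) $ i = (- 1 / ?c) * (T *\<^sub>v ?u) $ i"
            using i Tc by (subst mult_mat_vec[OF Tc]) auto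
          ultimately show "(T *\<^sub>v ((- 1 / ?c) \<cdot>\<^sub>v ?u)) $ i = w $ i"
            using c by (simp add: field_simps add_eq_0_iff)
        qed (use Tc wc in auto)
        then show False using nw by (metis imageI smult_carrier_vec vec_carrier)
      qed
      then have "T *\<^sub>v ?u = 0\<^sub>v n"
        using eq c0 wc mult_mat_vec_carrier[OF Tc, of ?u] by (auto simp: smult_vec_def zero_vec_def[symmetric])
      then have u0: "?u = 0\<^sub>v m" using T by (auto simp: injective_mat_def)
      show "v = 0\<^sub>v (Suc m)"
      proof (rule eq_vecI)
        fix i assume "i < dim_vec (0\<^sub>v (Suc m) :: complex vec)"
        then show "v $ i = 0\<^sub>v (Suc m) $ i"
          using c0 arg_cong[OF u0, of "\<lambda>x. x $ i"] by (cases "i = m") auto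
      qed (use v in auto)
    qed
    moreover have "T' *\<^sub>v v \<in> W" if "v \<in> carrier_vec (Suc m)" for v
      unfolding dec[OF that] using W w im by (auto simp: image_subset_iff)
    ultimately have "P (Suc m)" unfolding P_def by blast
    then show False using max by fastforce
  qed
  then show ?thesis using T im by blast
qed

text \<open>A matrix whose image is the subspace has fewer columns than rows, so the kernel of its transpose is
  nontrivial.\<close>

lemma subspace_annihilator_nontrivial:
  assumes W: "complex_subspace n W"
    and proper: "W \<noteq> carrier_vec n"
  shows "\<exists>u\<in>carrier_vec n. u \<noteq> 0\<^sub>v n \<and> (\<forall>w\<in>W. w \<bullet> u = 0)"
proof -
  obtain m T where T: "injective_mat n m T" and im: "W = (\<lambda>v. T *\<^sub>v v) ` carrier_vec m"
    using subspace_is_image[OF W] by blast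
  have Tc: "T \<in> carrier_mat n m" using T by (simp add: injective_mat_def)
  have "m \<noteq> n"
  proof
    assume "m = n"
    then have "carrier_vec n \<subseteq> W" using injective_square_surj T im by blast
    then show False using proper W by (auto simp: subspace_iff)
  qed
  then have "m < n" using injective_mat_dim[OF T] by simp
  then obtain u where u: "u \<in> carrier_vec n" "u \<noteq> 0\<^sub>v n" "transpose_mat T *\<^sub>v u = 0\<^sub>v m"
    using kernel_nontrivial[of "transpose_mat T" m n] Tc by auto
  have "(T *\<^sub>v v) \<bullet> u = 0" if "v \<in> carrier_vec m" for v
  proof -
    have "(T *\<^sub>v v) \<bullet> u = v \<bullet> (transpose_mat T *\<^sub>v u)"
      using transpose_vec_mult_scalar[OF Tc that u(1)] Tc that u(1)
      by (metis comm_scalar_prod mult_mat_vec_carrier transpose_carrier_mat)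
    then show ?thesis using u that by simp
  qed
  then show ?thesis using u im by auto
qed

lemma mat_factor_through:
  fixes T :: "complex mat"
  assumes T: "T \<in> carrier_mat n m" and B: "B \<in> carrier_mat n k"
    and c: "\<And>j. j < k \<Longrightarrow> col B j \<in> (\<lambda>v. T *\<^sub>v v) ` carrier_vec m"
  shows "\<exists>S\<in>carrier_mat m k. B = T * S"
proof -
  have "\<forall>j. \<exists>s. j < k \<longrightarrow> s \<in> carrier_vec m \<and> col B j = T *\<^sub>v s"
    using c by blast
  then obtain s where s: "\<And>j. j < k \<Longrightarrow> s j \<in> carrier_vec m \<and> col B j = T *\<^sub>v s j" by metis
  define S where "S = mat m k (\<lambda>(i,j). s j $ i)"
  have Sc: "S \<in> carrier_mat m k" by (simp add: S_def)
  have colS: "col S j = s j" if "j < k" for j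
    using s[OF that] that by (intro eq_vecI) (auto simp: S_def)
  have "B = T * S"
  proof (rule mat_col_eqI)
    fix j assume "j < dim_col (T * S)"
    then have j: "j < k" by (simp add: S_def)
    show "col B j = col (T * S) j"
      using s[OF j] colS[OF j] col_mult2[OF T Sc j] by simp
  qed (use B T in \<open>auto simp: S_def\<close>)
  then show ?thesis using Sc by blast
qed

text \<open>Uniqueness of the factor in the lemma above: it makes the matrices of a representation in a basis of
  an invariant subspace multiplicative.\<close>

lemma injective_mat_cancel:
  assumes T: "injective_mat n m T" and A: "A \<in> carrier_mat m k" and B: "B \<in> carrier_mat m k"
    and eq: "T * A = T * B"
  shows "A = B"
proof (rule mat_col_eqI)
  fix j assume "j < dim_col B"
  then have j: "j < k" using B by simp
  have Tc: "T \<in> carrier_mat n m" using T by (simp add: injective_mat_def)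
  have cc: "col A j \<in> carrier_vec m" "col B j \<in> carrier_vec m" using A B j by auto
  have "T *\<^sub>v col A j = T *\<^sub>v col B j"
    using eq col_mult2[OF Tc A j] col_mult2[OF Tc B j] by simp
  then have "T *\<^sub>v (col A j - col B j) = 0\<^sub>v n"
    using mult_minus_distrib_mat_vec[OF Tc cc] Tc cc by auto
  then have z: "col A j - col B j = 0\<^sub>v m"
    using T cc by (auto simp: injective_mat_def)
  show "col A j = col B j"
  proof (rule eq_vecI)
    fix i assume "i < dim_vec (col B j)"
    then show "col A j $ i = col B j $ i"
      using arg_cong[OF z, of "\<lambda>x. x $ i"] cc A B by auto
  qed (use cc A B in auto)
qed (use A B in auto)

lemma mat_trace_mult_commute:
  assumes "A \<in> carrier_mat n m" "B \<in> carrier_mat m n"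
  shows "mat_trace (A * B) = mat_trace (B * A)"
proof -
  have "mat_trace (A * B) = (\<Sum>i<n. \<Sum>j<m. A $$ (i,j) * B $$ (j,i))"
    using assms by (auto simp: mat_trace_def scalar_prod_def atLeast0LessThan intro!: sum.cong)
  also have "\<dots> = (\<Sum>j<m. \<Sum>i<n. A $$ (i,j) * B $$ (j,i))" by (rule sum.swap)
  also have "\<dots> = mat_trace (B * A)"
    using assms by (auto simp: mat_trace_def scalar_prod_def atLeast0LessThan mult.commute intro!: sum.cong)
  finally show ?thesis .
qed

lemma mat_trace_smult_one [simp]: "mat_trace (c \<cdot>\<^sub>m 1\<^sub>m n) = c * of_nat n"
  by (simp add: mat_trace_def mult.commute)

lemma mat_trace_one [simp]: "mat_trace (1\<^sub>m n) = of_nat n"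
  by (simp add: mat_trace_def)

lemma ex_eigenvector:
  fixes A :: "complex mat"
  assumes A: "A \<in> carrier_mat n n" and n: "n > 0"
  shows "\<exists>c v. v \<in> carrier_vec n \<and> v \<noteq> 0\<^sub>v n \<and> A *\<^sub>v v = c \<cdot>\<^sub>v v"
proof -
  have "\<not> constant (poly (char_poly A))"
    using degree_monic_char_poly[OF A] n by (simp add: constant_degree)
  then obtain c where "poly (char_poly A) c = 0"
    using fundamental_theorem_of_algebra by blast
  then have "eigenvalue A c" using eigenvalue_root_char_poly[OF A] by simp
  then show ?thesis using A by (auto simp: eigenvalue_def eigenvector_def)
qed

section \<open>Representations\<close>

lemma representation_simps:
  assumes G: "group G" and \<rho>: "representation G n \<rho>"
  shows "g \<in> carrier G \<Longrightarrow> \<rho> g \<in> carrier_mat n n"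
    and "g \<in> carrier G \<Longrightarrow> h \<in> carrier G \<Longrightarrow> \<rho> (g \<otimes>\<^bsub>G\<^esub> h) = \<rho> g * \<rho> h"
    and "\<rho> \<one>\<^bsub>G\<^esub> = 1\<^sub>m n"
proof -
  have h: "\<rho> \<in> hom G (GL n)" using \<rho> by (simp add: representation_def)
  have "Group.monoid (ring_mat TYPE(complex) n ())" by (metis ring_mat ring.is_monoid)
  then have GL: "group (GL n)" by (simp add: GL_def monoid.units_group)
  show "\<rho> g \<in> carrier_mat n n" if "g \<in> carrier G"
    using hom_in_carrier[OF h that]
    by (auto simp: GL_def units_of_def Units_def ring_mat_simps)
  show "\<rho> (g \<otimes>\<^bsub>G\<^esub> h) = \<rho> g * \<rho> h" if "g \<in> carrier G" "h \<in> carrier G"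
    using hom_mult[OF h that] by (simp add: GL_def units_of_def ring_mat_simps)
  show "\<rho> \<one>\<^bsub>G\<^esub> = 1\<^sub>m n"
    using hom_one[OF h G GL] by (simp add: GL_def units_of_def ring_mat_simps)
qed

lemma representationI:
  assumes G: "group G"
    and c: "\<And>g. g \<in> carrier G \<Longrightarrow> \<rho> g \<in> carrier_mat n n"
    and m: "\<And>g h. g \<in> carrier G \<Longrightarrow> h \<in> carrier G \<Longrightarrow> \<rho> (g \<otimes>\<^bsub>G\<^esub> h) = \<rho> g * \<rho> h"
    and o: "\<rho> \<one>\<^bsub>G\<^esub> = 1\<^sub>m n"
  shows "representation G n \<rho>"
proof -
  interpret group G by (rule G)
  have "\<rho> g \<in> Units (ring_mat TYPE(complex) n ())" if g: "g \<in> carrier G" for g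
  proof -
    have "\<rho> g * \<rho> (inv\<^bsub>G\<^esub> g) = 1\<^sub>m n" "\<rho> (inv\<^bsub>G\<^esub> g) * \<rho> g = 1\<^sub>m n"
      using g m o by (metis inv_closed r_inv, metis inv_closed l_inv)
    then show ?thesis using c[OF g] c[of "inv\<^bsub>G\<^esub> g"] g
      by (auto simp: Units_def ring_mat_simps)
  qed
  then show ?thesis using m
    by (auto simp: representation_def hom_def GL_def units_of_def ring_mat_simps)
qed

lemma irreducibleD:
  assumes "irreducible_representation G n \<rho>"
    and "complex_subspace n W"
    and "\<And>g w. g \<in> carrier G \<Longrightarrow> w \<in> W \<Longrightarrow> \<rho> g *\<^sub>v w \<in> W"
  shows "W = {0\<^sub>v n} \<or> W = carrier_vec n"
  using assms by (auto simp: irreducible_representation_def)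

lemma mult_mat_zero_vec:
  fixes T :: "complex mat"
  shows "T \<in> carrier_mat m n \<Longrightarrow> T *\<^sub>v 0\<^sub>v n = 0\<^sub>v m"
  by (intro eq_vecI) auto

lemma subspace_kernel:
  assumes T: "T \<in> carrier_mat m n"
  shows "complex_subspace n {v \<in> carrier_vec n. T *\<^sub>v v = 0\<^sub>v m}"
  unfolding subspace_iff
  using T by (auto simp: mult_add_distrib_mat_vec[OF T] mult_mat_vec[OF T] mult_mat_zero_vec[OF T])

lemma subspace_image:
  assumes T: "T \<in> carrier_mat m n"
  shows "complex_subspace m ((\<lambda>v. T *\<^sub>v v) ` carrier_vec n)"
  unfolding subspace_iff
proof (intro conjI ballI allI)
  show "0\<^sub>v m \<in> (\<lambda>v. T *\<^sub>v v) ` carrier_vec n" 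
    by (intro image_eqI[of _ _ "0\<^sub>v n"]) (auto simp: mult_mat_zero_vec[OF T])
  show "v + w \<in> (\<lambda>v. T *\<^sub>v v) ` carrier_vec n"
    if vw: "v \<in> (\<lambda>v. T *\<^sub>v v) ` carrier_vec n" "w \<in> (\<lambda>v. T *\<^sub>v v) ` carrier_vec n" for v w
  proof -
    obtain a b where "a \<in> carrier_vec n" "b \<in> carrier_vec n" "v = T *\<^sub>v a" "w = T *\<^sub>v b"
      using vw by auto
    then show ?thesis
      by (intro image_eqI[of _ _ "a + b"]) (auto simp: mult_add_distrib_mat_vec[OF T])
  qed
  show "c \<cdot>\<^sub>v v \<in> (\<lambda>v. T *\<^sub>v v) ` carrier_vec n"
    if v: "v \<in> (\<lambda>v. T *\<^sub>v v) ` carrier_vec n" for c v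
  proof -
    obtain a where "a \<in> carrier_vec n" "v = T *\<^sub>v a" using v by auto
    then show ?thesis
      by (intro image_eqI[of _ _ "c \<cdot>\<^sub>v a"]) (auto simp: mult_mat_vec[OF T])
  qed
qed (use T in auto)

lemma mat_eq_by_mult_vec:
  fixes A B :: "complex mat"
  assumes A: "A \<in> carrier_mat m n" and B: "B \<in> carrier_mat m n"
    and eq: "\<And>v. v \<in> carrier_vec n \<Longrightarrow> A *\<^sub>v v = B *\<^sub>v v"
  shows "A = B"
proof (rule mat_col_eqI)
  fix j assume "j < dim_col B"
  then have j: "j < n" using B by simp
  have "A *\<^sub>v unit_vec n j = B *\<^sub>v unit_vec n j" by (rule eq) simp
  then show "col A j = col B j"
    using A B j by (auto simp: vec_eq_iff)
qed (use A B in auto)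

text \<open>Schur's lemma: kernel and image of an intertwiner are invariant subspaces.\<close>

lemma schur_iso:
  assumes G: "group G"
    and \<rho>: "irreducible_representation G n \<rho>" and \<sigma>: "irreducible_representation G m \<sigma>"
    and T: "T \<in> carrier_mat m n" and c: "\<And>g. g \<in> carrier G \<Longrightarrow> T * \<rho> g = \<sigma> g * T"
    and nz: "T \<noteq> 0\<^sub>m m n"
  shows "\<exists>S\<in>carrier_mat n m. T * S = 1\<^sub>m m \<and> S * T = 1\<^sub>m n"
proof -
  have r\<rho>: "representation G n \<rho>" and r\<sigma>: "representation G m \<sigma>"
    using \<rho> \<sigma> by (auto simp: irreducible_representation_def)
  note \<rho>s = representation_simps[OF G r\<rho>]
  note \<sigma>s = representation_simps[OF G r\<sigma>]
  have ca: "T *\<^sub>v (\<rho> g *\<^sub>v v) = \<sigma> g *\<^sub>v (T *\<^sub>v v)" if "g \<in> carrier G" "v \<in> carrier_vec n" for g v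
    using c[OF that(1)] T \<rho>s(1)[OF that(1)] \<sigma>s(1)[OF that(1)] that(2)
    by (metis assoc_mult_mat_vec)
  let ?K = "{v \<in> carrier_vec n. T *\<^sub>v v = 0\<^sub>v m}"
  let ?I = "(\<lambda>v. T *\<^sub>v v) ` carrier_vec n"
  have "?K = {0\<^sub>v n} \<or> ?K = carrier_vec n"
    using mult_mat_vec_carrier[OF \<rho>s(1)] mult_mat_zero_vec[OF \<sigma>s(1)]
    by (intro irreducibleD[OF \<rho>] subspace_kernel[OF T]) (auto simp: ca)
  moreover have "?K \<noteq> carrier_vec n"
  proof
    assume K: "?K = carrier_vec n"
    have "T = 0\<^sub>m m n"
    proof (rule mat_eq_by_mult_vec[OF T])
      fix v :: "complex vec" assume v: "v \<in> carrier_vec n"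
      then have "v \<in> ?K" unfolding K .
      then show "T *\<^sub>v v = 0\<^sub>m m n *\<^sub>v v" using v by (intro eq_vecI) auto
    qed simp
    with nz show False ..
  qed
  ultimately have K: "?K = {0\<^sub>v n}" by blast
  then have inj: "injective_mat m n T" using T by (auto simp: injective_mat_def)
  have "?I = {0\<^sub>v m} \<or> ?I = carrier_vec m"
    using mult_mat_vec_carrier[OF \<rho>s(1)] by (intro irreducibleD[OF \<sigma>] subspace_image[OF T]) (auto simp flip: ca)
  moreover have "?I \<noteq> {0\<^sub>v m}"
  proof
    assume "?I = {0\<^sub>v m}"
    then have "carrier_vec n \<subseteq> ?K" by auto
    with \<open>?K \<noteq> carrier_vec n\<close> show False by auto
  qed
  ultimately have I: "?I = carrier_vec m" by blast
  obtain S where S: "S \<in> carrier_mat n m" "1\<^sub>m m = T * S"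
    using mat_factor_through[OF T, of "1\<^sub>m m" m] I by auto
  have "T * (S * T) = T * 1\<^sub>m n"
  proof -
    have "T * (S * T) = (T * S) * T" using T S by (simp add: assoc_mult_mat[OF T S(1) T])
    then show ?thesis using T unfolding S(2)[symmetric] by simp
  qed
  then have "S * T = 1\<^sub>m n"
    using injective_mat_cancel[OF inj, of "S * T" n "1\<^sub>m n"] S T by auto
  then show ?thesis using S by metis
qed

text \<open>Subtracting an eigenvalue leaves a singular intertwiner, which is therefore zero.\<close>

lemma schur_scalar:
  assumes G: "group G" and \<rho>: "irreducible_representation G n \<rho>"
    and T: "T \<in> carrier_mat n n" and c: "\<And>g. g \<in> carrier G \<Longrightarrow> T * \<rho> g = \<rho> g * T"
  shows "\<exists>a. T = a \<cdot>\<^sub>m 1\<^sub>m n"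
proof -
  have n: "n > 0" and r: "representation G n \<rho>"
    using \<rho> by (auto simp: irreducible_representation_def)
  obtain a v where v: "v \<in> carrier_vec n" "v \<noteq> 0\<^sub>v n" "T *\<^sub>v v = a \<cdot>\<^sub>v v"
    using ex_eigenvector[OF T n] by blast
  define S where "S = T - a \<cdot>\<^sub>m 1\<^sub>m n"
  have S: "S \<in> carrier_mat n n" using T by (auto simp: S_def)
  have "S = 0\<^sub>m n n"
  proof (rule ccontr)
    assume nz: "S \<noteq> 0\<^sub>m n n"
    have "S * \<rho> g = \<rho> g * S" if g: "g \<in> carrier G" for g
    proof -
      note R = representation_simps(1)[OF G r g]
      have "S * \<rho> g = T * \<rho> g - (a \<cdot>\<^sub>m 1\<^sub>m n) * \<rho> g"
        unfolding S_def by (rule minus_mult_distrib_mat[OF T _ R]) simp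
      also have "\<dots> = \<rho> g * T - \<rho> g * (a \<cdot>\<^sub>m 1\<^sub>m n)"
        using c[OF g] R by (simp add: mult_smult_distrib[OF R, of "1\<^sub>m n" n] mult_smult_assoc_mat[OF _ R, of "1\<^sub>m n" n])
      also have "\<dots> = \<rho> g * S"
        unfolding S_def by (rule mult_minus_distrib_mat[OF R T, symmetric]) simp
      finally show ?thesis .
    qed
    from schur_iso[OF G \<rho> \<rho> S this nz] obtain B where B: "B \<in> carrier_mat n n" "B * S = 1\<^sub>m n"
      by blast
    have "S *\<^sub>v v = 0\<^sub>v n"
    proof -
      have "S *\<^sub>v v = T *\<^sub>v v - (a \<cdot>\<^sub>m 1\<^sub>m n) *\<^sub>v v"
        unfolding S_def by (rule minus_mult_distrib_mat_vec[OF T _ v(1)]) simp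
      also have "(a \<cdot>\<^sub>m 1\<^sub>m n) *\<^sub>v v = a \<cdot>\<^sub>v v"
        using v(1) by (intro eq_vecI) (auto simp: scalar_prod_def if_distrib if_distribR sum.delta cong: if_cong)
      finally show ?thesis using v by auto
    qed
    then have "(B * S) *\<^sub>v v = 0\<^sub>v n"
      by (simp add: assoc_mult_mat_vec[OF B(1) S v(1)] mult_mat_zero_vec[OF B(1)])
    then show False using B v by simp
  qed
  then have "T = a \<cdot>\<^sub>m 1\<^sub>m n"
  proof -
    have "T $$ (i,j) = (a \<cdot>\<^sub>m 1\<^sub>m n) $$ (i,j)" if "i < n" "j < n" for i j
      using arg_cong[OF \<open>S = 0\<^sub>m n n\<close>, of "\<lambda>M. M $$ (i,j)"] that T by (simp add: S_def)
    then show ?thesis using T by (intro eq_matI) auto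
  qed
  then show ?thesis ..
qed

section \<open>Irreducible representations separate functions on the group\<close>

locale finite_group = group G for G (structure) +
  assumes finite_carrier [simp]: "finite (carrier G)"
begin

lemma sum_translate_left:
  "x \<in> carrier G \<Longrightarrow> (\<Sum>g\<in>carrier G. f (x \<otimes> g)) = (\<Sum>g\<in>carrier G. f g)"
  by (rule sum.reindex_bij_witness[of _ "\<lambda>g. inv x \<otimes> g" "\<lambda>g. x \<otimes> g"])
     (auto simp: m_assoc[symmetric])

lemma sum_translate_right:
  "x \<in> carrier G \<Longrightarrow> (\<Sum>g\<in>carrier G. f (g \<otimes> x)) = (\<Sum>g\<in>carrier G. f g)"
  by (rule sum.reindex_bij_witness[of _ "\<lambda>g. g \<otimes> inv x" "\<lambda>g. g \<otimes> x"])
     (auto simp: m_assoc)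

end

text \<open>The representation on an invariant subspace, written in a basis of it.\<close>

lemma subrepresentation:
  assumes G: "group G" and \<rho>: "representation G n \<rho>"
    and W: "complex_subspace n W"
    and inv: "\<And>g w. g \<in> carrier G \<Longrightarrow> w \<in> W \<Longrightarrow> \<rho> g *\<^sub>v w \<in> W"
    and nz: "W \<noteq> {0\<^sub>v n}"
  shows "\<exists>m T \<sigma>. m > 0 \<and> injective_mat n m T \<and> W = (\<lambda>v. T *\<^sub>v v) ` carrier_vec m \<and>
           representation G m \<sigma> \<and> (\<forall>g\<in>carrier G. \<rho> g * T = T * \<sigma> g)"
proof -
  interpret group G by (rule G)
  obtain m T where T: "injective_mat n m T" and im: "W = (\<lambda>v. T *\<^sub>v v) ` carrier_vec m"
    using subspace_is_image[OF W] by blast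
  have Tc: "T \<in> carrier_mat n m" using T by (simp add: injective_mat_def)
  note R = representation_simps[OF G \<rho>]
  have "m > 0"
  proof (rule ccontr)
    assume "\<not> m > 0"
    then have "W \<subseteq> {0\<^sub>v n}" using im Tc by (auto intro!: eq_vecI simp: scalar_prod_def)
    then show False using nz W by (auto simp: subspace_iff)
  qed
  moreover have "\<exists>S\<in>carrier_mat m m. \<rho> g * T = T * S" if g: "g \<in> carrier G" for g
  proof (rule mat_factor_through[OF Tc])
    show "\<rho> g * T \<in> carrier_mat n m" using R(1)[OF g] Tc by simp
    fix j assume j: "j < m"
    have "col T j = T *\<^sub>v unit_vec m j" using Tc j by (auto simp: vec_eq_iff)
    then have "col T j \<in> W" using im by auto
    then have "\<rho> g *\<^sub>v col T j \<in> W" by (rule inv[OF g])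
    then show "col (\<rho> g * T) j \<in> (\<lambda>v. T *\<^sub>v v) ` carrier_vec m"
      using col_mult2[OF R(1)[OF g] Tc j] im by simp
  qed
  then obtain \<sigma> where \<sigma>: "\<And>g. g \<in> carrier G \<Longrightarrow> \<sigma> g \<in> carrier_mat m m"
      "\<And>g. g \<in> carrier G \<Longrightarrow> \<rho> g * T = T * \<sigma> g" by metis
  have "representation G m \<sigma>"
  proof (rule representationI[OF G \<sigma>(1)])
    fix g h assume g: "g \<in> carrier G" and h: "h \<in> carrier G"
    have "T * \<sigma> (g \<otimes>\<^bsub>G\<^esub> h) = \<rho> g * (\<rho> h * T)"
      using R(1)[OF g] R(1)[OF h] R(2)[OF g h] Tc \<sigma>(2)[of "g \<otimes>\<^bsub>G\<^esub> h"] g h by simp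
    also have "\<dots> = (\<rho> g * T) * \<sigma> h"
      using R(1)[OF g] Tc \<sigma>[OF h] by simp
    also have "\<dots> = T * (\<sigma> g * \<sigma> h)"
      using \<sigma>[OF g] \<sigma>(1)[OF h] Tc by simp
    finally have eq: "T * \<sigma> (g \<otimes>\<^bsub>G\<^esub> h) = T * (\<sigma> g * \<sigma> h)" .
    show "\<sigma> (g \<otimes>\<^bsub>G\<^esub> h) = \<sigma> g * \<sigma> h"
      using mult_carrier_mat[OF \<sigma>(1)[OF g] \<sigma>(1)[OF h]] g h
      by (intro injective_mat_cancel[OF T \<sigma>(1) _ eq]) auto
  next
    have "T * \<sigma> \<one>\<^bsub>G\<^esub> = T * 1\<^sub>m m"
      using \<sigma>(2)[OF one_closed] R(3) Tc by simp
    then show "\<sigma> \<one>\<^bsub>G\<^esub> = 1\<^sub>m m"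
      by (rule injective_mat_cancel[OF T, of _ m, rotated 2]) (use \<sigma> in auto)
  qed
  ultimately show ?thesis using T im \<sigma> by blast
qed

lemma injective_mat_mult:
  assumes T: "injective_mat n m T" and S: "injective_mat m k S"
  shows "injective_mat n k (T * S)"
  unfolding injective_mat_def
proof (intro conjI ballI impI)
  have c: "T \<in> carrier_mat n m" "S \<in> carrier_mat m k" using T S by (auto simp: injective_mat_def)
  show "T * S \<in> carrier_mat n k" using c by simp
  fix v :: "complex vec" assume v: "v \<in> carrier_vec k" and z: "T * S *\<^sub>v v = 0\<^sub>v n"
  have "T *\<^sub>v (S *\<^sub>v v) = 0\<^sub>v n" using z by (simp add: assoc_mult_mat_vec[OF c v])
  then have "S *\<^sub>v v = 0\<^sub>v m" using T c(2) v by (simp add: injective_mat_def)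
  then show "v = 0\<^sub>v k" using S v by (simp add: injective_mat_def)
qed

lemma ex_irreducible_subrepresentation:
  assumes G: "group G" and \<rho>: "representation G n \<rho>" and n: "n > 0"
  shows "\<exists>m T \<sigma>. injective_mat n m T \<and> irreducible_representation G m \<sigma> \<and>
           (\<forall>g\<in>carrier G. \<rho> g * T = T * \<sigma> g)"
  using \<rho> n
proof (induction n arbitrary: \<rho> rule: less_induct)
  case (less n)
  note R = representation_simps[OF G less.prems(1)]
  show ?case
  proof (cases "irreducible_representation G n \<rho>")
    case True
    have "injective_mat n n (1\<^sub>m n)" by (auto simp: injective_mat_def)
    then show ?thesis using True left_mult_one_mat[OF R(1)] right_mult_one_mat[OF R(1)]
      by (intro exI[of _ n] exI[of _ "1\<^sub>m n"] exI[of _ \<rho>]) auto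
  next
    case False
    then obtain W where W: "complex_subspace n W"
      and inv: "\<And>g w. g \<in> carrier G \<Longrightarrow> w \<in> W \<Longrightarrow> \<rho> g *\<^sub>v w \<in> W"
      and nz: "W \<noteq> {0\<^sub>v n}" and proper: "W \<noteq> carrier_vec n"
      using less.prems by (auto simp: irreducible_representation_def)
    obtain m T \<sigma> where m: "m > 0" and T: "injective_mat n m T"
      and im: "W = (\<lambda>v. T *\<^sub>v v) ` carrier_vec m"
      and \<sigma>: "representation G m \<sigma>" and c: "\<And>g. g \<in> carrier G \<Longrightarrow> \<rho> g * T = T * \<sigma> g"
      using subrepresentation[OF G less.prems(1) W inv nz] by metis
    have "m \<noteq> n"
    proof
      assume "m = n"
      then have "carrier_vec n \<subseteq> W" using injective_square_surj T im by blast
      then show False using proper W by (auto simp: subspace_iff)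
    qed
    then have "m < n" using injective_mat_dim[OF T] by simp
    from less.IH[OF this \<sigma> m] obtain k S \<tau> where S: "injective_mat m k S"
      and \<tau>: "irreducible_representation G k \<tau>" and d: "\<And>g. g \<in> carrier G \<Longrightarrow> \<sigma> g * S = S * \<tau> g"
      by metis
    have Tc: "T \<in> carrier_mat n m" and Sc: "S \<in> carrier_mat m k"
      using T S by (auto simp: injective_mat_def)
    have "\<rho> g * (T * S) = (T * S) * \<tau> g" if g: "g \<in> carrier G" for g
    proof -
      have cs: "\<rho> g \<in> carrier_mat n n" "\<sigma> g \<in> carrier_mat m m" "\<tau> g \<in> carrier_mat k k"
        using R(1)[OF g] representation_simps(1)[OF G \<sigma> g] 
          representation_simps(1)[OF G _ g, of k \<tau>] \<tau> by (auto simp: irreducible_representation_def)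
      have "\<rho> g * (T * S) = (T * \<sigma> g) * S"
        unfolding c[OF g, symmetric] by (rule assoc_mult_mat[OF cs(1) Tc Sc, symmetric])
      also have "\<dots> = T * (S * \<tau> g)"
        unfolding d[OF g, symmetric] by (rule assoc_mult_mat[OF Tc cs(2) Sc])
      also have "\<dots> = (T * S) * \<tau> g"
        by (rule assoc_mult_mat[OF Tc Sc cs(3), symmetric])
      finally show ?thesis .
    qed
    then show ?thesis using injective_mat_mult[OF T S] \<tau> by blast
  qed
qed

text \<open>The conjugate of the dual representation. The annihilator of one of its invariant subspaces, with
  respect to the standard Hermitian form, is invariant under the original representation.\<close>

lemma irreducible_dual:
  assumes G: "group G" and \<sigma>: "irreducible_representation G n \<sigma>"
  shows "irreducible_representation G n (\<lambda>g. mat n n (\<lambda>(i,j). cnj (\<sigma> (inv\<^bsub>G\<^esub> g) $$ (j,i))))"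
    (is "irreducible_representation G n ?\<tau>")
proof -
  interpret group G by (rule G)
  have r: "representation G n \<sigma>" and n: "n > 0"
    using \<sigma> by (auto simp: irreducible_representation_def)
  note R = representation_simps[OF G r]
  have rep: "representation G n ?\<tau>"
  proof (rule representationI[OF G])
    fix g h assume g: "g \<in> carrier G" and h: "h \<in> carrier G"
    have c: "\<sigma> (inv\<^bsub>G\<^esub> g) \<in> carrier_mat n n" "\<sigma> (inv\<^bsub>G\<^esub> h) \<in> carrier_mat n n"
      using R(1) g h by auto
    show "?\<tau> (g \<otimes>\<^bsub>G\<^esub> h) = ?\<tau> g * ?\<tau> h"
      using c g h R(2)[of "inv\<^bsub>G\<^esub> h" "inv\<^bsub>G\<^esub> g"]
      by (intro eq_matI) (auto simp: scalar_prod_def inv_mult_group mult.commute)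
  next
    show "?\<tau> \<one>\<^bsub>G\<^esub> = 1\<^sub>m n" using R(3) by (intro eq_matI) auto
  qed auto
  have "W = {0\<^sub>v n}" if W: "complex_subspace n W"
    and inv: "\<And>g w. g \<in> carrier G \<Longrightarrow> w \<in> W \<Longrightarrow> ?\<tau> g *\<^sub>v w \<in> W"
    and proper: "W \<noteq> carrier_vec n" for W
  proof -
    have Wc: "W \<subseteq> carrier_vec n" using W by (simp add: subspace_iff)
    define U where "U = {u \<in> carrier_vec n. \<forall>w\<in>W. (\<Sum>i<n. cnj (w $ i) * u $ i) = 0}"
    have U: "complex_subspace n U"
      unfolding subspace_iff U_def
      by (auto simp: distrib_left sum.distrib mult.left_commute sum_distrib_left[symmetric])
    have "\<sigma> g *\<^sub>v u \<in> U" if g: "g \<in> carrier G" and u: "u \<in> U" for g u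
    proof -
      have uc: "u \<in> carrier_vec n" using u by (simp add: U_def)
      have "(\<Sum>i<n. cnj (w $ i) * (\<sigma> g *\<^sub>v u) $ i) = 0" if w: "w \<in> W" for w
      proof -
        have wc: "w \<in> carrier_vec n" using w Wc by auto
        have "(\<Sum>i<n. cnj (w $ i) * (\<sigma> g *\<^sub>v u) $ i)
            = (\<Sum>i<n. \<Sum>j<n. cnj (w $ i) * (\<sigma> g $$ (i,j) * u $ j))"
          using R(1)[OF g] uc by (auto simp: scalar_prod_def atLeast0LessThan sum_distrib_left intro!: sum.cong)
        also have "\<dots> = (\<Sum>j<n. \<Sum>i<n. cnj (w $ i) * (\<sigma> g $$ (i,j) * u $ j))"
          by (rule sum.swap)
        also have "\<dots> = (\<Sum>j<n. cnj ((?\<tau> (inv\<^bsub>G\<^esub> g) *\<^sub>v w) $ j) * u $ j)"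
          using wc g by (auto simp: scalar_prod_def atLeast0LessThan sum_distrib_right sum_distrib_left mult_ac intro!: sum.cong)
        also have "\<dots> = 0" using inv[OF inv_closed[OF g] w] u unfolding U_def by blast
        finally show ?thesis .
      qed
      then show ?thesis using R(1)[OF g] uc by (auto simp: U_def)
    qed
    from irreducibleD[OF \<sigma> U this] have "U = {0\<^sub>v n} \<or> U = carrier_vec n" .
    moreover have "U \<noteq> {0\<^sub>v n}"
    proof -
      obtain u where u: "u \<in> carrier_vec n" "u \<noteq> 0\<^sub>v n" "\<And>w. w \<in> W \<Longrightarrow> w \<bullet> u = 0"
        using subspace_annihilator_nontrivial[OF W proper] by blast
      have "vec n (\<lambda>i. cnj (u $ i)) \<in> U"
      proof -
        have "(\<Sum>i<n. cnj (w $ i) * cnj (u $ i)) = cnj (w \<bullet> u)" for w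
          using u(1) by (simp add: scalar_prod_def atLeast0LessThan)
        then show ?thesis using u by (simp add: U_def)
      qed
      moreover have "vec n (\<lambda>i. cnj (u $ i)) \<noteq> 0\<^sub>v n"
        using u(1,2) by (auto simp: vec_eq_iff)
      ultimately show ?thesis by auto
    qed
    ultimately have all: "U = carrier_vec n" by blast
    have "w = 0\<^sub>v n" if w: "w \<in> W" for w
    proof (rule eq_vecI)
      fix i assume "i < dim_vec (0\<^sub>v n :: complex vec)"
      then have i: "i < n" by simp
      have "unit_vec n i \<in> U" using all by simp
      then have "(\<Sum>j<n. cnj (w $ j) * unit_vec n i $ j) = 0" using w by (simp add: U_def)
      then show "w $ i = 0\<^sub>v n $ i" using i by (simp add: if_distrib sum.If_cases cong: if_cong)
    qed (use w Wc in auto)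
    then show ?thesis using W by (auto simp: subspace_iff)
  qed
  then show ?thesis using rep n unfolding irreducible_representation_def by blast
qed

text \<open>The linear extension of a representation to the group algebra: the matrix
  \<open>\<Sum>g. f g \<cdot> \<rho> g\<close>.\<close>
definition extend_rep :: "('a, 'b) monoid_scheme \<Rightarrow> nat \<Rightarrow> ('a \<Rightarrow> complex mat) \<Rightarrow> ('a \<Rightarrow> complex) \<Rightarrow> complex mat"
  where "extend_rep G n \<rho> f = mat n n (\<lambda>(i,j). \<Sum>g\<in>carrier G. f g * \<rho> g $$ (i,j))"

lemma extend_rep_carrier [simp]: "extend_rep G n \<rho> f \<in> carrier_mat n n"
  by (simp add: extend_rep_def)

lemma extend_rep_index: "i < n \<Longrightarrow> j < n \<Longrightarrow> extend_rep G n \<rho> f $$ (i,j) = (\<Sum>g\<in>carrier G. f g * \<rho> g $$ (i,j))"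
  by (simp add: extend_rep_def)

lemma extend_rep_cong: "(\<And>g. g \<in> carrier G \<Longrightarrow> f g = f' g) \<Longrightarrow> extend_rep G n \<rho> f = extend_rep G n \<rho> f'"
  by (simp add: extend_rep_def)

context finite_group
begin

lemma extend_rep_translate_left:
  assumes \<rho>: "representation G n \<rho>" and x: "x \<in> carrier G"
  shows "\<rho> x * extend_rep G n \<rho> f = extend_rep G n \<rho> (\<lambda>g. f (inv x \<otimes> g))"
proof (rule eq_matI)
  fix i j assume "i < dim_row (extend_rep G n \<rho> (\<lambda>g. f (inv x \<otimes> g)))" "j < dim_col (extend_rep G n \<rho> (\<lambda>g. f (inv x \<otimes> g)))"
  then have i: "i < n" and j: "j < n" by (auto simp: extend_rep_def)
  note R = representation_simps[OF is_group \<rho>]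
  have "(\<rho> x * extend_rep G n \<rho> f) $$ (i,j) = (\<Sum>k<n. \<Sum>g\<in>carrier G. \<rho> x $$ (i,k) * (f g * \<rho> g $$ (k,j)))"
    using R(1)[OF x] i j by (auto simp: scalar_prod_def extend_rep_def atLeast0LessThan sum_distrib_left)
  also have "\<dots> = (\<Sum>g\<in>carrier G. \<Sum>k<n. \<rho> x $$ (i,k) * (f g * \<rho> g $$ (k,j)))"
    by (rule sum.swap)
  also have "\<dots> = (\<Sum>g\<in>carrier G. f g * \<rho> (x \<otimes> g) $$ (i,j))"
  proof (rule sum.cong)
    fix g assume g: "g \<in> carrier G"
    show "(\<Sum>k<n. \<rho> x $$ (i,k) * (f g * \<rho> g $$ (k,j))) = f g * \<rho> (x \<otimes> g) $$ (i,j)"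
      using R(1)[OF x] R(1)[OF g] R(2)[OF x g] i j
      by (auto simp: scalar_prod_def atLeast0LessThan sum_distrib_left mult_ac intro!: sum.cong)
  qed simp
  also have "\<dots> = (\<Sum>g\<in>carrier G. f (inv x \<otimes> (x \<otimes> g)) * \<rho> (x \<otimes> g) $$ (i,j))"
    using x by (intro sum.cong) (auto simp: m_assoc[symmetric])
  also have "\<dots> = (\<Sum>g\<in>carrier G. f (inv x \<otimes> g) * \<rho> g $$ (i,j))"
    by (rule sum_translate_left[OF x, of "\<lambda>g. f (inv x \<otimes> g) * \<rho> g $$ (i,j)"])
  finally show "(\<rho> x * extend_rep G n \<rho> f) $$ (i,j) = extend_rep G n \<rho> (\<lambda>g. f (inv x \<otimes> g)) $$ (i,j)"
    using i j by (simp add: extend_rep_def)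
qed (use representation_simps(1)[OF is_group \<rho> x] in \<open>auto simp: extend_rep_def\<close>)

lemma extend_rep_translate_right:
  assumes \<rho>: "representation G n \<rho>" and x: "x \<in> carrier G"
  shows "extend_rep G n \<rho> f * \<rho> x = extend_rep G n \<rho> (\<lambda>g. f (g \<otimes> inv x))"
proof (rule eq_matI)
  fix i j assume "i < dim_row (extend_rep G n \<rho> (\<lambda>g. f (g \<otimes> inv x)))" "j < dim_col (extend_rep G n \<rho> (\<lambda>g. f (g \<otimes> inv x)))"
  then have i: "i < n" and j: "j < n" by (auto simp: extend_rep_def)
  note R = representation_simps[OF is_group \<rho>]
  have "(extend_rep G n \<rho> f * \<rho> x) $$ (i,j) = (\<Sum>k<n. \<Sum>g\<in>carrier G. f g * \<rho> g $$ (i,k) * \<rho> x $$ (k,j))"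
    using R(1)[OF x] i j by (auto simp: scalar_prod_def extend_rep_def atLeast0LessThan sum_distrib_right)
  also have "\<dots> = (\<Sum>g\<in>carrier G. \<Sum>k<n. f g * \<rho> g $$ (i,k) * \<rho> x $$ (k,j))"
    by (rule sum.swap)
  also have "\<dots> = (\<Sum>g\<in>carrier G. f g * \<rho> (g \<otimes> x) $$ (i,j))"
  proof (rule sum.cong)
    fix g assume g: "g \<in> carrier G"
    show "(\<Sum>k<n. f g * \<rho> g $$ (i,k) * \<rho> x $$ (k,j)) = f g * \<rho> (g \<otimes> x) $$ (i,j)"
      using R(1)[OF x] R(1)[OF g] R(2)[OF g x] i j
      by (auto simp: scalar_prod_def atLeast0LessThan sum_distrib_left mult_ac intro!: sum.cong)
  qed simp
  also have "\<dots> = (\<Sum>g\<in>carrier G. f ((g \<otimes> x) \<otimes> inv x) * \<rho> (g \<otimes> x) $$ (i,j))"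
    using x by (intro sum.cong) (auto simp: m_assoc)
  also have "\<dots> = (\<Sum>g\<in>carrier G. f (g \<otimes> inv x) * \<rho> g $$ (i,j))"
    by (rule sum_translate_right[OF x, of "\<lambda>g. f (g \<otimes> inv x) * \<rho> g $$ (i,j)"])
  finally show "(extend_rep G n \<rho> f * \<rho> x) $$ (i,j) = extend_rep G n \<rho> (\<lambda>g. f (g \<otimes> inv x)) $$ (i,j)"
    using i j by (simp add: extend_rep_def)
qed (use representation_simps(1)[OF is_group \<rho> x] in \<open>auto simp: extend_rep_def\<close>)

text \<open>The functions sent to zero by all irreducible representations form an invariant subspace \<open>V\<close> of the
  regular representation. If \<open>V\<close> is not zero, then it contains an irreducible representation \<open>\<sigma>\<close>. Evaluating the
  intertwining relation at the identity shows that the functions in it are matrix coefficients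
  \<open>g \<mapsto> \<Sum>k. a k \<cdot> \<sigma> (inv g) (k, 0)\<close>, whose conjugates are coefficients of the conjugate dual \<open>\<tau>\<close> of \<open>\<sigma>\<close>. As elements of
  \<open>V\<close> they have sum zero against all coefficients of irreducible representations, so against their own
  conjugates.\<close>

lemma irreducibles_separate_functions:
  assumes zero: "\<And>n \<rho>. irreducible_representation G n \<rho> \<Longrightarrow> extend_rep G n \<rho> f = 0\<^sub>m n n"
    and x: "x \<in> carrier G"
  shows "f x = 0"
proof (rule ccontr)
  assume fx: "f x \<noteq> 0"
  define N where "N = card (carrier G)"
  obtain e where e: "bij_betw e {..<N} (carrier G)"
    using ex_bij_betw_nat_finite[OF finite_carrier] by (auto simp: N_def atLeast0LessThan)
  define idx where "idx = inv_into {..<N} e"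
  have idx: "idx y < N" "e (idx y) = y" if "y \<in> carrier G" for y
    using e that by (auto simp: idx_def bij_betw_def f_inv_into_f inv_into_into)
      (metis inv_into_into lessThan_iff)
  have ei: "e i \<in> carrier G" "idx (e i) = i" if "i < N" for i
    using e that by (auto simp: idx_def bij_betw_def)
  \<comment> \<open>The left regular representation: translation of functions, coded as vectors along \<open>e\<close>.\<close>
  define L where "L g = mat N N (\<lambda>(i,j). if j = idx (inv g \<otimes> e i) then 1 else 0 :: complex)" for g
  have Lc: "L g \<in> carrier_mat N N" for g by (simp add: L_def)
  have Lv: "(L g *\<^sub>v v) $ i = v $ idx (inv g \<otimes> e i)"
    if "g \<in> carrier G" "v \<in> carrier_vec N" "i < N" for g v i
    using that idx(1)[of "inv g \<otimes> e i"] ei(1)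
    by (simp add: L_def scalar_prod_def if_distrib[of "\<lambda>c. c * _"] sum.delta cong: if_cong)
  have L: "representation G N L"
  proof (rule representationI[OF is_group Lc])
    fix g h assume g: "g \<in> carrier G" and h: "h \<in> carrier G"
    show "L (g \<otimes> h) = L g * L h"
    proof (rule mat_eq_by_mult_vec[OF Lc])
      fix v :: "complex vec" assume v: "v \<in> carrier_vec N"
      have "L (g \<otimes> h) *\<^sub>v v = L g *\<^sub>v (L h *\<^sub>v v)"
      proof (rule eq_vecI)
        fix i assume "i < dim_vec (L g *\<^sub>v (L h *\<^sub>v v))"
        then have i: "i < N" using Lc by (metis carrier_matD(1) dim_mult_mat_vec)
        have "inv g \<otimes> e i \<in> carrier G" using g ei(1)[OF i] by simp
        then show "(L (g \<otimes> h) *\<^sub>v v) $ i = (L g *\<^sub>v (L h *\<^sub>v v)) $ i"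
          using g h v i Lc ei(1)[OF i] idx
          by (simp add: Lv inv_mult_group m_assoc mult_mat_vec_carrier[OF Lc v])
      qed (use carrier_matD(1)[OF Lc] in auto)
      then show "L (g \<otimes> h) *\<^sub>v v = L g * L h *\<^sub>v v"
        by (simp add: assoc_mult_mat_vec[OF Lc Lc v])
    qed (rule mult_carrier_mat[OF Lc Lc])
  next
    show "L \<one> = 1\<^sub>m N"
      using ei by (intro eq_matI) (auto simp: L_def)
  qed
  define V where "V = {v \<in> carrier_vec N. \<forall>n \<rho>. irreducible_representation G n \<rho> \<longrightarrow>
      extend_rep G n \<rho> (\<lambda>y. v $ idx y) = 0\<^sub>m n n}"
  have V: "complex_subspace N V"
    unfolding subspace_iff
  proof (intro conjI ballI allI)
    show "0\<^sub>v N \<in> V" using idx(1) by (auto simp: V_def extend_rep_def intro!: eq_matI)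
    fix v assume v: "v \<in> V"
    have vz: "(\<Sum>g\<in>carrier G. v $ idx g * \<rho> g $$ (i,j)) = 0"
      if "irreducible_representation G n \<rho>" "i < n" "j < n" for n \<rho> i j
      using v that extend_rep_index[of i n j G \<rho> "\<lambda>y. v $ idx y"] by (auto simp: V_def)
    show "c \<cdot>\<^sub>v v \<in> V" for c
      using v vz idx(1)
      by (auto simp: V_def extend_rep_def mult.assoc sum_distrib_left[symmetric] intro!: eq_matI)
    fix w assume w: "w \<in> V"
    have wz: "(\<Sum>g\<in>carrier G. w $ idx g * \<rho> g $$ (i,j)) = 0"
      if "irreducible_representation G n \<rho>" "i < n" "j < n" for n \<rho> i j
      using w that extend_rep_index[of i n j G \<rho> "\<lambda>y. w $ idx y"] by (auto simp: V_def)
    have vw: "v \<in> carrier_vec N" "w \<in> carrier_vec N" using v w by (auto simp: V_def)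
    have "extend_rep G n \<rho> (\<lambda>y. (v + w) $ idx y) = 0\<^sub>m n n" if \<rho>: "irreducible_representation G n \<rho>" for n \<rho>
    proof (rule eq_matI)
      fix i j assume "i < dim_row (0\<^sub>m n n :: complex mat)" "j < dim_col (0\<^sub>m n n :: complex mat)"
      then have ij: "i < n" "j < n" by auto
      have "extend_rep G n \<rho> (\<lambda>y. (v + w) $ idx y) $$ (i,j) =
          (\<Sum>g\<in>carrier G. v $ idx g * \<rho> g $$ (i,j) + w $ idx g * \<rho> g $$ (i,j))"
        unfolding extend_rep_index[OF ij] using vw idx(1) by (intro sum.cong) (auto simp: distrib_right)
      also have "\<dots> = 0" using vz[OF \<rho> ij] wz[OF \<rho> ij] by (simp add: sum.distrib)
      finally show "extend_rep G n \<rho> (\<lambda>y. (v + w) $ idx y) $$ (i,j) = 0\<^sub>m n n $$ (i,j)" using ij by simp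
    qed (auto simp: extend_rep_def)
    then show "v + w \<in> V" using vw by (simp add: V_def)
  qed (auto simp: V_def)
  have Vinv: "L g *\<^sub>v v \<in> V" if g: "g \<in> carrier G" and v: "v \<in> V" for g v
  proof -
    have vc: "v \<in> carrier_vec N" using v by (simp add: V_def)
    have "extend_rep G n \<rho> (\<lambda>y. (L g *\<^sub>v v) $ idx y) = 0\<^sub>m n n" if \<rho>: "irreducible_representation G n \<rho>" for n \<rho>
    proof -
      have r: "representation G n \<rho>" using \<rho> by (simp add: irreducible_representation_def)
      have "extend_rep G n \<rho> (\<lambda>y. (L g *\<^sub>v v) $ idx y) = extend_rep G n \<rho> (\<lambda>y. v $ idx (inv g \<otimes> y))"
        using Lv[OF g vc] idx by (intro extend_rep_cong) auto
      also have "\<dots> = \<rho> g * extend_rep G n \<rho> (\<lambda>y. v $ idx y)"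
        by (rule extend_rep_translate_left[OF r g, symmetric])
      also have "\<dots> = 0\<^sub>m n n"
        using v \<rho> representation_simps(1)[OF is_group r g] by (simp add: V_def)
      finally show ?thesis .
    qed
    then show ?thesis using mult_mat_vec_carrier[OF Lc vc] by (simp add: V_def)
  qed
  have "vec N (\<lambda>i. f (e i)) \<in> V"
    using zero idx by (auto simp: V_def cong: extend_rep_cong)
  moreover have "vec N (\<lambda>i. f (e i)) \<noteq> 0\<^sub>v N"
  proof
    assume "vec N (\<lambda>i. f (e i)) = 0\<^sub>v N"
    from arg_cong[OF this, of "\<lambda>v. v $ idx x"] show False using fx idx[OF x] by simp
  qed
  ultimately have "V \<noteq> {0\<^sub>v N}" by blast
  then obtain m0 T0 \<sigma>0 where m0: "m0 > 0" "injective_mat N m0 T0" "V = (\<lambda>v. T0 *\<^sub>v v) ` carrier_vec m0"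
      "representation G m0 \<sigma>0" "\<And>g. g \<in> carrier G \<Longrightarrow> L g * T0 = T0 * \<sigma>0 g"
    using subrepresentation[OF is_group L V Vinv] by metis
  obtain m T1 \<sigma> where m: "injective_mat m0 m T1" "irreducible_representation G m \<sigma>"
      "\<And>g. g \<in> carrier G \<Longrightarrow> \<sigma>0 g * T1 = T1 * \<sigma> g"
    using ex_irreducible_subrepresentation[OF is_group m0(4,1)] by metis
  have r\<sigma>: "representation G m \<sigma>" and mpos: "m > 0"
    using m(2) by (auto simp: irreducible_representation_def)
  have T0c: "T0 \<in> carrier_mat N m0" and T1c: "T1 \<in> carrier_mat m0 m"
    using m0(2) m(1) by (auto simp: injective_mat_def)
  define T where "T = T0 * T1"
  have T: "injective_mat N m T" unfolding T_def by (rule injective_mat_mult[OF m0(2) m(1)])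
  have Tc: "T \<in> carrier_mat N m" using T by (simp add: injective_mat_def)
  have LT: "L g * T = T * \<sigma> g" if g: "g \<in> carrier G" for g
  proof -
    have "L g * T = (T0 * \<sigma>0 g) * T1"
      unfolding T_def m0(5)[OF g, symmetric] by (rule assoc_mult_mat[OF Lc T0c T1c, symmetric])
    also have "\<dots> = T0 * (T1 * \<sigma> g)" unfolding m(3)[OF g, symmetric]
      by (rule assoc_mult_mat[OF T0c representation_simps(1)[OF is_group m0(4) g] T1c])
    also have "\<dots> = T * \<sigma> g" unfolding T_def
      by (rule assoc_mult_mat[OF T0c T1c representation_simps(1)[OF is_group r\<sigma> g], symmetric])
    finally show ?thesis .
  qed
  \<comment> \<open>The columns of \<open>T\<close>, read as functions on the group.\<close>
  define t where "t k y = T $$ (idx y, k)" for k y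
  have colV: "col T 0 \<in> V"
  proof -
    have "col T 0 = T0 *\<^sub>v col T1 0" unfolding T_def by (rule col_mult2[OF T0c T1c mpos])
    then show ?thesis using m0(3) T1c mpos by (auto intro!: imageI)
  qed
  have coeff: "t 0 (inv g) = (\<Sum>k<m. t k \<one> * \<sigma> g $$ (k,0))" if g: "g \<in> carrier G" for g
  proof -
    have i: "idx \<one> < N" using idx by simp
    have "(L g * T) $$ (idx \<one>, 0) = (L g *\<^sub>v col T 0) $ idx \<one>"
      using Lc Tc i mpos by (auto simp: L_def)
    also have "\<dots> = t 0 (inv g)"
      using g i idx Tc mpos by (subst Lv) (auto simp: t_def)
    finally show ?thesis
      using LT[OF g] representation_simps(1)[OF is_group r\<sigma> g] Tc i mpos
      by (auto simp: t_def scalar_prod_def atLeast0LessThan)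
  qed
  define \<tau> where "\<tau> = (\<lambda>g. mat m m (\<lambda>(i,j). cnj (\<sigma> (inv g) $$ (j,i))))"
  have "irreducible_representation G m \<tau>" unfolding \<tau>_def by (rule irreducible_dual[OF is_group m(2)])
  then have "extend_rep G m \<tau> (\<lambda>y. col T 0 $ idx y) = 0\<^sub>m m m"
    using colV by (simp add: V_def)
  then have ortho: "(\<Sum>g\<in>carrier G. t 0 g * \<tau> g $$ (0,k)) = 0" if "k < m" for k
    using that mpos extend_rep_index[of 0 m k G \<tau> "\<lambda>y. col T 0 $ idx y"] Tc idx(1)
    by (simp add: t_def)
  have "(\<Sum>g\<in>carrier G. t 0 g * cnj (t 0 g)) = (\<Sum>g\<in>carrier G. \<Sum>k<m. cnj (t k \<one>) * (t 0 g * \<tau> g $$ (0,k)))"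
  proof (rule sum.cong)
    fix g assume g: "g \<in> carrier G"
    then have "cnj (t 0 g) = (\<Sum>k<m. cnj (t k \<one>) * \<tau> g $$ (0,k))"
      using coeff[of "inv g"] mpos by (simp add: \<tau>_def)
    then show "t 0 g * cnj (t 0 g) = (\<Sum>k<m. cnj (t k \<one>) * (t 0 g * \<tau> g $$ (0,k)))"
      by (simp add: sum_distrib_left mult_ac)
  qed simp
  also have "\<dots> = (\<Sum>k<m. cnj (t k \<one>) * (\<Sum>g\<in>carrier G. t 0 g * \<tau> g $$ (0,k)))"
    by (subst sum.swap) (simp add: sum_distrib_left)
  also have "\<dots> = 0" using ortho by simp
  finally have "(\<Sum>g\<in>carrier G. complex_of_real ((cmod (t 0 g))\<^sup>2)) = 0"
    by (simp only: complex_norm_square)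
  then have "(\<Sum>g\<in>carrier G. (cmod (t 0 g))\<^sup>2) = 0"
    by (metis of_real_eq_0_iff of_real_sum)
  then have t0: "t 0 g = 0" if "g \<in> carrier G" for g
    using that by (simp add: sum_nonneg_eq_0_iff)
  have "T *\<^sub>v unit_vec m 0 = 0\<^sub>v N"
    using Tc mpos t0 ei by (intro eq_vecI) (auto simp: t_def, metis)
  then have "unit_vec m 0 = (0\<^sub>v m :: complex vec)" using T by (simp add: injective_mat_def)
  then show False using mpos by (metis unit_vec_nonzero)
qed

end

section \<open>Conjugation and centralizers\<close>

context finite_group
begin

definition centralizer :: "'a \<Rightarrow> 'a set" where
  "centralizer a = {g \<in> carrier G. g \<otimes> a = a \<otimes> g}"

definition conj_class :: "'a \<Rightarrow> 'a set" where
  "conj_class a = (\<lambda>x. x \<otimes> a \<otimes> inv x) ` carrier G"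

lemma conj_eq_iff:
  "x \<in> carrier G \<Longrightarrow> a \<in> carrier G \<Longrightarrow> b \<in> carrier G \<Longrightarrow> x \<otimes> a \<otimes> inv x = b \<longleftrightarrow> x \<otimes> a = b \<otimes> x"
  by (metis inv_closed inv_solve_right m_closed)

lemma conj_mult:
  "x \<in> carrier G \<Longrightarrow> a \<in> carrier G \<Longrightarrow> b \<in> carrier G \<Longrightarrow>
     x \<otimes> (a \<otimes> b) \<otimes> inv x = (x \<otimes> a \<otimes> inv x) \<otimes> (x \<otimes> b \<otimes> inv x)"
proof -
  assume x: "x \<in> carrier G" and a: "a \<in> carrier G" and b: "b \<in> carrier G"
  have "(x \<otimes> a \<otimes> inv x) \<otimes> (x \<otimes> b \<otimes> inv x) = x \<otimes> a \<otimes> (inv x \<otimes> x) \<otimes> b \<otimes> inv x"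
    using x a b by (simp only: m_assoc m_closed inv_closed)
  also have "\<dots> = x \<otimes> (a \<otimes> b) \<otimes> inv x" using x a b by (simp add: m_assoc)
  finally show ?thesis by simp
qed

lemma conj_conj:
  "x \<in> carrier G \<Longrightarrow> y \<in> carrier G \<Longrightarrow> a \<in> carrier G \<Longrightarrow>
     x \<otimes> (y \<otimes> a \<otimes> inv y) \<otimes> inv x = (x \<otimes> y) \<otimes> a \<otimes> inv (x \<otimes> y)"
  by (simp add: inv_mult_group m_assoc)

lemma conj_pow:
  assumes x: "x \<in> carrier G" and a: "a \<in> carrier G"
  shows "(x \<otimes> a \<otimes> inv x) [^] (n::nat) = x \<otimes> a [^] n \<otimes> inv x"
  using assms by (induction n) (simp_all add: conj_mult)

lemma conj_eq_one_iff:
  "x \<in> carrier G \<Longrightarrow> a \<in> carrier G \<Longrightarrow> x \<otimes> a \<otimes> inv x = \<one> \<longleftrightarrow> a = \<one>"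
  by (simp add: conj_eq_iff)

lemma commutator_eq_one:
  assumes a: "a \<in> carrier G" and b: "b \<in> carrier G" and c: "a \<otimes> b \<otimes> inv a \<otimes> inv b = \<one>"
  shows "a \<otimes> b = b \<otimes> a"
proof -
  have "a \<otimes> b \<otimes> inv a = (a \<otimes> b \<otimes> inv a \<otimes> inv b) \<otimes> b" using a b by (simp add: m_assoc)
  also have "\<dots> = b" unfolding c using b by simp
  finally show ?thesis using a b by (simp add: conj_eq_iff)
qed

lemma conj_class_subset: "a \<in> carrier G \<Longrightarrow> conj_class a \<subseteq> carrier G"
  by (auto simp: conj_class_def)

lemma conj_class_self: "a \<in> carrier G \<Longrightarrow> a \<in> conj_class a"
  unfolding conj_class_def by (rule image_eqI[of _ _ \<one>]) auto

lemma conjugate_in_iff: "conjugate_in G a b \<longleftrightarrow> b \<in> conj_class a"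
  by (auto simp: conjugate_in_def conj_class_def)

lemma conj_class_eq:
  assumes a: "a \<in> carrier G" and b: "b \<in> conj_class a"
  shows "conj_class b = conj_class a"
proof -
  have sub: "conj_class d \<subseteq> conj_class c" if c: "c \<in> carrier G" and d: "d \<in> conj_class c" for c d
    using c d by (auto simp: conj_class_def conj_conj)
  obtain x where x: "x \<in> carrier G" "b = x \<otimes> a \<otimes> inv x" using b by (auto simp: conj_class_def)
  have "inv x \<otimes> (x \<otimes> a \<otimes> inv x) \<otimes> inv (inv x) = a" using a x by (subst conj_conj) auto
  then have "a \<in> conj_class b"
    using x unfolding conj_class_def by (intro image_eqI[of _ _ "inv x"]) simp_all
  then show ?thesis using sub[OF a b] sub[of b a] conj_class_subset[OF a] b by blast
qed

lemma conj_class_conj_iff: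
  assumes y: "y \<in> carrier G" and z: "z \<in> carrier G" and g: "g \<in> carrier G"
  shows "z \<otimes> g \<otimes> inv z \<in> conj_class y \<longleftrightarrow> g \<in> conj_class y"
proof -
  have c: "z \<otimes> g \<otimes> inv z \<in> conj_class g" using z by (auto simp: conj_class_def)
  have cc: "z \<otimes> g \<otimes> inv z \<in> carrier G" using z g by simp
  show ?thesis
    using conj_class_eq[OF y] conj_class_eq[OF g c] conj_class_self[OF g] conj_class_self[OF cc] by metis
qed

lemma centralizer_subgroup:
  assumes a: "a \<in> carrier G" shows "subgroup (centralizer a) G"
proof
  fix x y assume "x \<in> centralizer a" "y \<in> centralizer a"
  then have c: "x \<in> carrier G" "y \<in> carrier G" "x \<otimes> a = a \<otimes> x" "y \<otimes> a = a \<otimes> y"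
    by (auto simp: centralizer_def)
  then have "x \<otimes> y \<otimes> a = a \<otimes> (x \<otimes> y)" using a by (metis m_assoc)
  then show "x \<otimes> y \<in> centralizer a" using c by (simp add: centralizer_def)
next
  fix x assume "x \<in> centralizer a"
  then have c: "x \<in> carrier G" "x \<otimes> a = a \<otimes> x" by (auto simp: centralizer_def)
  then have "inv x \<otimes> a = a \<otimes> inv x" using a by (metis inv_closed inv_solve_left inv_solve_right m_assoc m_closed)
  then show "inv x \<in> centralizer a" using c by (simp add: centralizer_def)
qed (use a in \<open>auto simp: centralizer_def\<close>)

text \<open>The fibres of the map onto the orbit are cosets of the stabilizer.\<close>

lemma card_conj_orbit:
  assumes H: "subgroup H G" and a: "a \<in> carrier G"
  shows "card ((\<lambda>x. x \<otimes> a \<otimes> inv x) ` H) * card (H \<inter> centralizer a) = card H"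
proof -
  let ?f = "\<lambda>x. x \<otimes> a \<otimes> inv x"
  note Hc = subgroup.mem_carrier[OF H]
  have fin: "finite H" using finite_subset[OF subgroup.subset[OF H]] by simp
  have fibre: "card {x \<in> H. ?f x = b} = card (H \<inter> centralizer a)" if b: "b \<in> ?f ` H" for b
  proof -
    obtain u where u: "u \<in> H" "b = ?f u" using b by blast
    have "bij_betw (\<lambda>c. u \<otimes> c) (H \<inter> centralizer a) {x \<in> H. ?f x = b}"
    proof (rule bij_betw_byWitness[of _ "\<lambda>x. inv u \<otimes> x"])
      show "\<forall>c\<in>H \<inter> centralizer a. inv u \<otimes> (u \<otimes> c) = c" using u Hc by (auto simp: m_assoc[symmetric])
      show "\<forall>x\<in>{x \<in> H. ?f x = b}. u \<otimes> (inv u \<otimes> x) = x" using u Hc by (auto simp: m_assoc[symmetric])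
      show "(\<lambda>c. u \<otimes> c) ` (H \<inter> centralizer a) \<subseteq> {x \<in> H. ?f x = b}"
      proof clarify
        fix c assume c: "c \<in> H" "c \<in> centralizer a"
        have "c \<otimes> a \<otimes> inv c = a" using c a Hc by (subst conj_eq_iff) (auto simp: centralizer_def)
        then have "?f (u \<otimes> c) = b" using u c a Hc conj_conj[of u c a] by simp
        then show "u \<otimes> c \<in> H \<and> ?f (u \<otimes> c) = b" using u c subgroup.m_closed[OF H] by simp
      qed
      show "(\<lambda>x. inv u \<otimes> x) ` {x \<in> H. ?f x = b} \<subseteq> H \<inter> centralizer a"
      proof
        fix y assume "y \<in> (\<lambda>x. inv u \<otimes> x) ` {x \<in> H. ?f x = b}"
        then obtain x where x: "x \<in> H" "?f x = b" "y = inv u \<otimes> x" by blast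
        have yH: "y \<in> H" using x u subgroup.m_closed[OF H] subgroup.m_inv_closed[OF H] by simp
        have "y \<otimes> a \<otimes> inv y = inv u \<otimes> (x \<otimes> a \<otimes> inv x) \<otimes> inv (inv u)"
          unfolding x(3) using u x Hc a by (subst conj_conj) auto
        also have "\<dots> = inv u \<otimes> (u \<otimes> a \<otimes> inv u) \<otimes> inv (inv u)" using x u by simp
        also have "\<dots> = a" using u Hc a by (subst conj_conj) auto
        finally have "y \<otimes> a = a \<otimes> y" using conj_eq_iff[of y a a] yH Hc a by simp
        then show "y \<in> H \<inter> centralizer a" using yH Hc by (simp add: centralizer_def)
      qed
    qed
    then show ?thesis by (rule bij_betw_same_card[symmetric])
  qed
  have "card H = (\<Sum>x\<in>H. 1)" by simp
  also have "\<dots> = (\<Sum>b\<in>?f ` H. \<Sum>x\<in>{x \<in> H. ?f x = b}. 1)" by (rule sum.image_gen[OF fin])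
  also have "\<dots> = (\<Sum>b\<in>?f ` H. card (H \<inter> centralizer a))" using fibre by (intro sum.cong) auto
  finally show ?thesis by simp
qed

lemma card_conj_class: "a \<in> carrier G \<Longrightarrow> card (conj_class a) * card (centralizer a) = card (carrier G)"
proof -
  assume a: "a \<in> carrier G"
  have "carrier G \<inter> centralizer a = centralizer a" by (auto simp: centralizer_def)
  then show ?thesis using card_conj_orbit[OF subgroup_self a] by (simp add: conj_class_def)
qed

lemma card_coset:
  assumes D: "subgroup D G" and g: "g \<in> carrier G"
  shows "card {b \<in> carrier G. inv g \<otimes> b \<in> D} = card D"
proof -
  have "bij_betw (\<lambda>b. inv g \<otimes> b) {b \<in> carrier G. inv g \<otimes> b \<in> D} D"
    using g subgroup.mem_carrier[OF D]
    by (intro bij_betw_byWitness[of _ "\<lambda>d. g \<otimes> d"]) (auto simp: m_assoc[symmetric])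
  then show ?thesis by (rule bij_betw_same_card)
qed

text \<open>The product map is injective, hence surjective by cardinality.\<close>

lemma product_of_subgroups:
  assumes A: "subgroup A G" and B: "subgroup B G" and tr: "A \<inter> B = {\<one>}"
    and card: "card A * card B = card (carrier G)" and g: "g \<in> carrier G"
  obtains a b where "a \<in> A" "b \<in> B" "g = a \<otimes> b"
proof -
  let ?f = "\<lambda>(a,b). a \<otimes> b"
  note Ac = subgroup.mem_carrier[OF A] and Bc = subgroup.mem_carrier[OF B]
  have "inj_on ?f (A \<times> B)"
  proof (rule inj_onI, clarify)
    fix a b a' b' assume ab: "a \<in> A" "b \<in> B" "a' \<in> A" "b' \<in> B" and eq: "a \<otimes> b = a' \<otimes> b'"
    have "inv a' \<otimes> a = b' \<otimes> inv b"
    proof -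
      have "inv a' \<otimes> a = inv a' \<otimes> (a \<otimes> b) \<otimes> inv b" using ab Ac Bc by (simp add: m_assoc)
      also have "\<dots> = b' \<otimes> inv b" unfolding eq using ab Ac Bc by (simp add: m_assoc[symmetric])
      finally show ?thesis .
    qed
    then have "inv a' \<otimes> a \<in> A \<inter> B"
      using ab subgroup.m_closed[OF A] subgroup.m_inv_closed[OF A]
        subgroup.m_closed[OF B] subgroup.m_inv_closed[OF B] by (metis IntI)
    then have "inv a' \<otimes> a = \<one>" using tr by blast
    then have "a = a'" using ab Ac by (metis inv_equality inv_inv inv_closed)
    then show "a = a' \<and> b = b'" using eq ab Ac Bc by simp
  qed
  then have "card (?f ` (A \<times> B)) = card (carrier G)" using card by (simp add: card_image card_cartesian_product)
  moreover have "?f ` (A \<times> B) \<subseteq> carrier G" using Ac Bc by auto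
  ultimately have "?f ` (A \<times> B) = carrier G" by (intro card_subset_eq) auto
  then have "g \<in> ?f ` (A \<times> B)" using g by simp
  then show ?thesis by (elim imageE) (auto intro: that)
qed

end

section \<open>Orthogonality and character sums\<close>

lemma IrrE:
  assumes "\<chi> \<in> Irr G"
  obtains n \<rho> where "irreducible_representation G n \<rho>" "representation G n \<rho>" "n > 0"
    "\<And>g. g \<in> carrier G \<Longrightarrow> \<chi> g = mat_trace (\<rho> g)" "\<chi> = (\<lambda>g\<in>carrier G. mat_trace (\<rho> g))"
  using assms unfolding Irr_def irreducible_representation_def by auto

lemma Irr_eqI:
  "\<chi> \<in> Irr G \<Longrightarrow> \<psi> \<in> Irr G \<Longrightarrow> (\<And>g. g \<in> carrier G \<Longrightarrow> \<chi> g = \<psi> g) \<Longrightarrow> \<chi> = \<psi>"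
  by (erule IrrE, erule IrrE) (auto simp: fun_eq_iff restrict_def)

lemma IrrI:
  "irreducible_representation G n \<rho> \<Longrightarrow> (\<lambda>g\<in>carrier G. mat_trace (\<rho> g)) \<in> Irr G"
  by (auto simp: Irr_def)

context finite_group
begin

definition linear_chars :: "('a \<Rightarrow> complex) set" where
  "linear_chars = {\<chi> \<in> Irr G. \<chi> \<one> = 1}"

lemma card_carrier_pos: "card (carrier G) > 0"
  using one_closed by (auto simp: card_gt_0_iff simp del: one_closed)

lemma Irr_conj:
  assumes \<chi>: "\<chi> \<in> Irr G" and x: "x \<in> carrier G" and g: "g \<in> carrier G"
  shows "\<chi> (x \<otimes> g \<otimes> inv x) = \<chi> g"
proof -
  obtain n \<rho> where \<rho>: "representation G n \<rho>" "\<And>g. g \<in> carrier G \<Longrightarrow> \<chi> g = mat_trace (\<rho> g)"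
    using \<chi> by (rule IrrE) blast
  note R = representation_simps[OF is_group \<rho>(1)]
  have c: "\<rho> x \<in> carrier_mat n n" "\<rho> g \<in> carrier_mat n n" "\<rho> (inv x) \<in> carrier_mat n n"
    using R(1) x g by auto
  have "mat_trace (\<rho> (x \<otimes> g \<otimes> inv x)) = mat_trace ((\<rho> x * \<rho> g) * \<rho> (inv x))"
    using R(2) x g by simp
  also have "\<dots> = mat_trace (\<rho> (inv x) * (\<rho> x * \<rho> g))"
    using c by (intro mat_trace_mult_commute) auto
  also have "\<rho> (inv x) * (\<rho> x * \<rho> g) = \<rho> (inv x \<otimes> x) * \<rho> g"
    using R(2)[of "inv x" x] x by (simp add: assoc_mult_mat[OF c(3,1,2)])
  also have "\<dots> = \<rho> g" using R(3) x c by simp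
  finally show ?thesis using \<rho>(2) x g by simp
qed

lemma mat_trace_extend_rep:
  assumes \<rho>: "representation G n \<rho>"
  shows "mat_trace (extend_rep G n \<rho> f) = (\<Sum>g\<in>carrier G. f g * mat_trace (\<rho> g))"
proof -
  have "mat_trace (extend_rep G n \<rho> f) = (\<Sum>i<n. \<Sum>g\<in>carrier G. f g * \<rho> g $$ (i,i))"
    by (simp add: mat_trace_def extend_rep_def)
  also have "\<dots> = (\<Sum>g\<in>carrier G. \<Sum>i<n. f g * \<rho> g $$ (i,i))" by (rule sum.swap)
  also have "\<dots> = (\<Sum>g\<in>carrier G. f g * mat_trace (\<rho> g))"
    using representation_simps(1)[OF is_group \<rho>]
    by (intro sum.cong) (auto simp: mat_trace_def sum_distrib_left)
  finally show ?thesis .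
qed

text \<open>A class function is central in the group algebra, so Schur's lemma applies; the scalar is read off
  from the trace.\<close>

lemma extend_rep_class_function:
  assumes \<rho>: "irreducible_representation G n \<rho>"
    and f: "\<And>x g. x \<in> carrier G \<Longrightarrow> g \<in> carrier G \<Longrightarrow> f (x \<otimes> g \<otimes> inv x) = f g"
  shows "extend_rep G n \<rho> f = ((\<Sum>g\<in>carrier G. f g * mat_trace (\<rho> g)) / of_nat n) \<cdot>\<^sub>m 1\<^sub>m n"
proof -
  have r: "representation G n \<rho>" and n: "n > 0"
    using \<rho> by (auto simp: irreducible_representation_def)
  have "extend_rep G n \<rho> f * \<rho> x = \<rho> x * extend_rep G n \<rho> f" if x: "x \<in> carrier G" for x
    unfolding extend_rep_translate_left[OF r x] extend_rep_translate_right[OF r x]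
  proof (rule extend_rep_cong)
    fix g assume g: "g \<in> carrier G"
    have "f (inv x \<otimes> g) = f (x \<otimes> (inv x \<otimes> g) \<otimes> inv x)" using f[of x "inv x \<otimes> g"] x g by simp
    then show "f (g \<otimes> inv x) = f (inv x \<otimes> g)" using x g by (simp add: m_assoc[symmetric])
  qed
  from schur_scalar[OF is_group \<rho> extend_rep_carrier this]
  obtain a where a: "extend_rep G n \<rho> f = a \<cdot>\<^sub>m 1\<^sub>m n" by blast
  then have "a * of_nat n = (\<Sum>g\<in>carrier G. f g * mat_trace (\<rho> g))"
    using mat_trace_extend_rep[OF r, of f] by simp
  then have "a = (\<Sum>g\<in>carrier G. f g * mat_trace (\<rho> g)) / of_nat n"
    using n by (simp add: field_simps)
  then show ?thesis using a by simp
qed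

text \<open>This is the average \<open>\<Sum>g. \<sigma> g E \<rho> (inv g)\<close> for the matrix unit \<open>E\<close> at position \<open>(a, b)\<close>; every other
  matrix in place of \<open>E\<close> is a linear combination of these.\<close>

lemma averaged_intertwiner:
  assumes \<rho>: "representation G n \<rho>" and \<sigma>: "representation G m \<sigma>"
    and a: "a < m" and b: "b < n" and x: "x \<in> carrier G"
  defines "T \<equiv> mat m n (\<lambda>(i,j). \<Sum>g\<in>carrier G. \<sigma> g $$ (i,a) * \<rho> (inv g) $$ (b,j))"
  shows "T * \<rho> x = \<sigma> x * T"
proof (rule eq_matI)
  note R = representation_simps[OF is_group \<rho>]
  note S = representation_simps[OF is_group \<sigma>]
  fix i j assume "i < dim_row (\<sigma> x * T)" "j < dim_col (\<sigma> x * T)"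
  then have i: "i < m" and j: "j < n" using S(1)[OF x] by (auto simp: T_def)
  have "(T * \<rho> x) $$ (i,j) = (\<Sum>k<n. \<Sum>g\<in>carrier G. \<sigma> g $$ (i,a) * \<rho> (inv g) $$ (b,k) * \<rho> x $$ (k,j))"
    using R(1)[OF x] i j by (auto simp: scalar_prod_def T_def atLeast0LessThan sum_distrib_right)
  also have "\<dots> = (\<Sum>g\<in>carrier G. \<Sum>k<n. \<sigma> g $$ (i,a) * \<rho> (inv g) $$ (b,k) * \<rho> x $$ (k,j))"
    by (rule sum.swap)
  also have "\<dots> = (\<Sum>g\<in>carrier G. \<sigma> g $$ (i,a) * \<rho> (inv g \<otimes> x) $$ (b,j))"
  proof (rule sum.cong)
    fix g assume g: "g \<in> carrier G"
    show "(\<Sum>k<n. \<sigma> g $$ (i,a) * \<rho> (inv g) $$ (b,k) * \<rho> x $$ (k,j)) = \<sigma> g $$ (i,a) * \<rho> (inv g \<otimes> x) $$ (b,j)"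
      using R(1)[OF x] R(1)[of "inv g"] R(2)[of "inv g" x] g x b j
      by (auto simp: scalar_prod_def atLeast0LessThan sum_distrib_left mult_ac intro!: sum.cong)
  qed simp
  also have "\<dots> = (\<Sum>g\<in>carrier G. \<sigma> (x \<otimes> g) $$ (i,a) * \<rho> (inv (x \<otimes> g) \<otimes> x) $$ (b,j))"
    by (rule sum_translate_left[OF x, symmetric])
  also have "\<dots> = (\<Sum>g\<in>carrier G. \<Sum>k<m. \<sigma> x $$ (i,k) * (\<sigma> g $$ (k,a) * \<rho> (inv g) $$ (b,j)))"
  proof (rule sum.cong)
    fix g assume g: "g \<in> carrier G"
    have "inv (x \<otimes> g) \<otimes> x = inv g" using g x by (simp add: inv_mult_group m_assoc)
    then show "\<sigma> (x \<otimes> g) $$ (i,a) * \<rho> (inv (x \<otimes> g) \<otimes> x) $$ (b,j)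
        = (\<Sum>k<m. \<sigma> x $$ (i,k) * (\<sigma> g $$ (k,a) * \<rho> (inv g) $$ (b,j)))"
      using S(1)[OF x] S(1)[OF g] S(2)[OF x g] i a
      by (auto simp: scalar_prod_def atLeast0LessThan sum_distrib_right sum_distrib_left mult_ac intro!: sum.cong)
  qed simp
  also have "\<dots> = (\<Sum>k<m. \<Sum>g\<in>carrier G. \<sigma> x $$ (i,k) * (\<sigma> g $$ (k,a) * \<rho> (inv g) $$ (b,j)))"
    by (rule sum.swap)
  also have "\<dots> = (\<sigma> x * T) $$ (i,j)"
    using S(1)[OF x] i j by (auto simp: scalar_prod_def T_def atLeast0LessThan sum_distrib_left)
  finally show "(T * \<rho> x) $$ (i,j) = (\<sigma> x * T) $$ (i,j)" .
qed (use representation_simps(1)[OF is_group \<rho> x] representation_simps(1)[OF is_group \<sigma> x] in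
      \<open>auto simp: T_def\<close>)

lemma trace_product_sum:
  assumes \<rho>: "representation G n \<rho>" and \<sigma>: "representation G m \<sigma>"
  shows "(\<Sum>g\<in>carrier G. mat_trace (\<sigma> g) * mat_trace (\<rho> (inv g)))
    = (\<Sum>a<m. \<Sum>b<n. \<Sum>g\<in>carrier G. \<sigma> g $$ (a,a) * \<rho> (inv g) $$ (b,b))"
proof -
  have "(\<Sum>g\<in>carrier G. mat_trace (\<sigma> g) * mat_trace (\<rho> (inv g)))
      = (\<Sum>g\<in>carrier G. \<Sum>a<m. \<Sum>b<n. \<sigma> g $$ (a,a) * \<rho> (inv g) $$ (b,b))"
  proof (rule sum.cong)
    fix g assume g: "g \<in> carrier G"
    have "\<sigma> g \<in> carrier_mat m m" "\<rho> (inv g) \<in> carrier_mat n n"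
      using representation_simps(1)[OF is_group \<sigma> g] representation_simps(1)[OF is_group \<rho>, of "inv g"] g
      by auto
    then have "mat_trace (\<sigma> g) = (\<Sum>a<m. \<sigma> g $$ (a,a))"
        "mat_trace (\<rho> (inv g)) = (\<Sum>b<n. \<rho> (inv g) $$ (b,b))" by (auto simp: mat_trace_def)
    then show "mat_trace (\<sigma> g) * mat_trace (\<rho> (inv g))
        = (\<Sum>a<m. \<Sum>b<n. \<sigma> g $$ (a,a) * \<rho> (inv g) $$ (b,b))"
      by (simp add: sum_product)
  qed simp
  also have "\<dots> = (\<Sum>a<m. \<Sum>g\<in>carrier G. \<Sum>b<n. \<sigma> g $$ (a,a) * \<rho> (inv g) $$ (b,b))"
    by (rule sum.swap)
  also have "\<dots> = (\<Sum>a<m. \<Sum>b<n. \<Sum>g\<in>carrier G. \<sigma> g $$ (a,a) * \<rho> (inv g) $$ (b,b))"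
    by (intro sum.cong refl sum.swap)
  finally show ?thesis .
qed

text \<open>If the averaged matrix units are nonzero for some position, then the two representations are
  equivalent and have the same character.\<close>

lemma orthogonality_neq:
  assumes \<chi>: "\<chi> \<in> Irr G" and \<psi>: "\<psi> \<in> Irr G" and neq: "\<chi> \<noteq> \<psi>"
  shows "(\<Sum>g\<in>carrier G. \<chi> g * \<psi> (inv g)) = 0"
proof -
  obtain m \<sigma> where \<sigma>: "irreducible_representation G m \<sigma>" "representation G m \<sigma>"
    "\<And>g. g \<in> carrier G \<Longrightarrow> \<chi> g = mat_trace (\<sigma> g)" using \<chi> by (rule IrrE) blast
  obtain n \<rho> where \<rho>: "irreducible_representation G n \<rho>" "representation G n \<rho>"
    "\<And>g. g \<in> carrier G \<Longrightarrow> \<psi> g = mat_trace (\<rho> g)" using \<psi> by (rule IrrE) blast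
  note R = representation_simps[OF is_group \<rho>(2)]
  note S = representation_simps[OF is_group \<sigma>(2)]
  have "(\<Sum>g\<in>carrier G. \<sigma> g $$ (a,a) * \<rho> (inv g) $$ (b,b)) = 0" if a: "a < m" and b: "b < n" for a b
  proof -
    define T where "T = mat m n (\<lambda>(i,j). \<Sum>g\<in>carrier G. \<sigma> g $$ (i,a) * \<rho> (inv g) $$ (b,j))"
    have Tc: "T \<in> carrier_mat m n" by (simp add: T_def)
    have int: "T * \<rho> x = \<sigma> x * T" if "x \<in> carrier G" for x
      unfolding T_def by (rule averaged_intertwiner[OF \<rho>(2) \<sigma>(2) a b that])
    have "T = 0\<^sub>m m n"
    proof (rule ccontr)
      assume "T \<noteq> 0\<^sub>m m n"
      from schur_iso[OF is_group \<rho>(1) \<sigma>(1) Tc int this]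
      obtain U where U: "U \<in> carrier_mat n m" "T * U = 1\<^sub>m m" "U * T = 1\<^sub>m n" by blast
      have "\<chi> g = \<psi> g" if g: "g \<in> carrier G" for g
      proof -
        have "\<sigma> g = (\<sigma> g * T) * U"
          using U S(1)[OF g] by (simp add: assoc_mult_mat[OF S(1)[OF g] Tc U(1)])
        also have "\<dots> = T * (\<rho> g * U)"
          unfolding int[OF g, symmetric] by (rule assoc_mult_mat[OF Tc R(1)[OF g] U(1)])
        finally have "mat_trace (\<sigma> g) = mat_trace ((\<rho> g * U) * T)"
          using mat_trace_mult_commute[OF Tc mult_carrier_mat[OF R(1)[OF g] U(1)]] by simp
        also have "(\<rho> g * U) * T = \<rho> g"
          using U R(1)[OF g] by (simp add: assoc_mult_mat[OF R(1)[OF g] U(1) Tc])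
        finally show ?thesis using \<sigma>(3) \<rho>(3) g by simp
      qed
      then show False using neq Irr_eqI[OF \<chi> \<psi>] by blast
    qed
    then have "T $$ (a,b) = 0" using a b by simp
    then show ?thesis using a b by (simp add: T_def)
  qed
  then show ?thesis
    using trace_product_sum[OF \<rho>(2) \<sigma>(2)] \<sigma>(3) \<rho>(3) by simp
qed

text \<open>Here the averaged matrix units are scalars, with trace \<open>\<bar>G\<bar>\<close> on the diagonal and zero off it.\<close>

lemma orthogonality_eq:
  assumes \<chi>: "\<chi> \<in> Irr G"
  shows "(\<Sum>g\<in>carrier G. \<chi> g * \<chi> (inv g)) = of_nat (card (carrier G))"
proof -
  obtain n \<rho> where \<rho>: "irreducible_representation G n \<rho>" "representation G n \<rho>" "n > 0"
    "\<And>g. g \<in> carrier G \<Longrightarrow> \<chi> g = mat_trace (\<rho> g)" using \<chi> by (rule IrrE) blast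
  note R = representation_simps[OF is_group \<rho>(2)]
  have "(\<Sum>g\<in>carrier G. \<rho> g $$ (a,a) * \<rho> (inv g) $$ (b,b))
      = (if a = b then of_nat (card (carrier G)) / of_nat n else 0)" if a: "a < n" and b: "b < n" for a b
  proof -
    define T where "T = mat n n (\<lambda>(i,j). \<Sum>g\<in>carrier G. \<rho> g $$ (i,a) * \<rho> (inv g) $$ (b,j))"
    have Tc: "T \<in> carrier_mat n n" by (simp add: T_def)
    have int: "T * \<rho> x = \<rho> x * T" if "x \<in> carrier G" for x
      unfolding T_def by (rule averaged_intertwiner[OF \<rho>(2) \<rho>(2) a b that])
    from schur_scalar[OF is_group \<rho>(1) Tc int] obtain c where c: "T = c \<cdot>\<^sub>m 1\<^sub>m n" by blast
    have "c * of_nat n = mat_trace T" using c by simp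
    also have "\<dots> = (\<Sum>i<n. \<Sum>g\<in>carrier G. \<rho> (inv g) $$ (b,i) * \<rho> g $$ (i,a))"
      by (simp add: mat_trace_def T_def mult.commute)
    also have "\<dots> = (\<Sum>g\<in>carrier G. \<Sum>i<n. \<rho> (inv g) $$ (b,i) * \<rho> g $$ (i,a))"
      by (rule sum.swap)
    also have "\<dots> = (\<Sum>g\<in>carrier G. 1\<^sub>m n $$ (b,a))"
    proof (rule sum.cong)
      fix g assume g: "g \<in> carrier G"
      have "\<rho> (inv g) * \<rho> g = 1\<^sub>m n" using R(2)[of "inv g" g] R(3) g by simp
      moreover have "(\<rho> (inv g) * \<rho> g) $$ (b,a) = (\<Sum>i<n. \<rho> (inv g) $$ (b,i) * \<rho> g $$ (i,a))"
        using R(1)[OF g] R(1)[of "inv g"] g a b by (simp add: scalar_prod_def atLeast0LessThan)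
      ultimately show "(\<Sum>i<n. \<rho> (inv g) $$ (b,i) * \<rho> g $$ (i,a)) = 1\<^sub>m n $$ (b,a)"
        by simp
    qed simp
    finally have "c = (if a = b then of_nat (card (carrier G)) / of_nat n else 0)"
      using a b \<rho>(3) by (auto simp: field_simps split: if_splits)
    moreover have "T $$ (a,b) = (if a = b then c else 0)" using c a b by simp
    ultimately show ?thesis using a b by (simp add: T_def)
  qed
  then have "(\<Sum>a<n. \<Sum>b<n. \<Sum>g\<in>carrier G. \<rho> g $$ (a,a) * \<rho> (inv g) $$ (b,b))
      = (\<Sum>a<n. \<Sum>b<n. if a = b then of_nat (card (carrier G)) / of_nat n else 0)"
    by (intro sum.cong) auto
  also have "\<dots> = of_nat (card (carrier G))" using \<rho>(3) by (simp add: sum.delta)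
  finally show ?thesis using trace_product_sum[OF \<rho>(2) \<rho>(2)] \<rho>(4) by simp
qed

text \<open>More characters than group elements would be linearly dependent, contrary to their orthogonality.\<close>

lemma finite_Irr [simp]: "finite (Irr G)"
proof (rule ccontr)
  define N where "N = card (carrier G)"
  assume "infinite (Irr G)"
  then obtain X where X: "X \<subseteq> Irr G" "finite X" "card X = Suc N"
    using infinite_arbitrarily_large by blast
  obtain c where c: "bij_betw c {..<Suc N} X"
    using ex_bij_betw_nat_finite[OF X(2)] X(3) by (auto simp: atLeast0LessThan)
  obtain e where e: "bij_betw e {..<N} (carrier G)"
    using ex_bij_betw_nat_finite[OF finite_carrier] by (auto simp: N_def atLeast0LessThan)
  have cX: "c j \<in> Irr G" if "j < Suc N" for j using c that X(1) by (auto simp: bij_betw_def)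
  define A where "A = mat N (Suc N) (\<lambda>(i,j). c j (e i))"
  obtain v where v: "v \<in> carrier_vec (Suc N)" "v \<noteq> 0\<^sub>v (Suc N)" "A *\<^sub>v v = 0\<^sub>v N"
    using kernel_nontrivial[of A N "Suc N"] by (auto simp: A_def)
  have z: "(\<Sum>j<Suc N. c j g * v $ j) = 0" if g: "g \<in> carrier G" for g
  proof -
    obtain i where i: "i < N" "g = e i" using e g by (auto simp: bij_betw_def)
    have "(A *\<^sub>v v) $ i = (\<Sum>j<Suc N. c j g * v $ j)"
      using i v(1) unfolding A_def by (simp add: scalar_prod_def atLeast0LessThan del: sum.lessThan_Suc)
    then show ?thesis using v(3) i by simp
  qed
  have "v $ k = 0" if k: "k < Suc N" for k
  proof -
    have "0 = (\<Sum>g\<in>carrier G. (\<Sum>j<Suc N. c j g * v $ j) * c k (inv g))"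
      using z by simp
    also have "\<dots> = (\<Sum>g\<in>carrier G. \<Sum>j<Suc N. v $ j * (c j g * c k (inv g)))"
      by (intro sum.cong refl) (simp add: sum_distrib_right sum_distrib_left mult_ac del: sum.lessThan_Suc)
    also have "\<dots> = (\<Sum>j<Suc N. v $ j * (\<Sum>g\<in>carrier G. c j g * c k (inv g)))"
      by (subst sum.swap) (simp add: sum_distrib_left del: sum.lessThan_Suc)
    also have "\<dots> = (\<Sum>j<Suc N. if j = k then v $ k * of_nat N else 0)"
    proof (rule sum.cong)
      fix j assume "j \<in> {..<Suc N}"
      then have j: "j < Suc N" by simp
      have "c j \<noteq> c k" if "j \<noteq> k"
        using c j k that by (auto simp: bij_betw_def inj_on_def)
      then show "v $ j * (\<Sum>g\<in>carrier G. c j g * c k (inv g)) = (if j = k then v $ k * of_nat N else 0)"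
        using orthogonality_eq[OF cX[OF k]] orthogonality_neq[OF cX[OF j] cX[OF k]] by (auto simp: N_def)
    qed simp
    also have "\<dots> = v $ k * of_nat N" using k by (simp add: sum.delta del: sum.lessThan_Suc)
    finally show ?thesis using card_carrier_pos by (auto simp: N_def)
  qed
  then have "v = 0\<^sub>v (Suc N)" using v(1) by (intro eq_vecI) auto
  with v(2) show False ..
qed

section \<open>Character sums over normal subgroups and conjugacy classes\<close>

lemma normal_indicator_class:
  assumes N: "N \<lhd> G" and x: "x \<in> carrier G" and g: "g \<in> carrier G"
  shows "x \<otimes> g \<otimes> inv x \<in> N \<longleftrightarrow> g \<in> N"
proof
  assume "x \<otimes> g \<otimes> inv x \<in> N"
  then have "inv x \<otimes> (x \<otimes> g \<otimes> inv x) \<otimes> x \<in> N"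
    using normal.inv_op_closed1[OF N x] by simp
  then show "g \<in> N" using x g by (simp add: m_assoc[symmetric]) (simp add: m_assoc)
qed (use normal.inv_op_closed2[OF N x] in auto)

text \<open>The sum of \<open>\<rho> g\<close> over a normal subgroup is a scalar matrix fixed by the subgroup, so it is
  either zero or the subgroup acts trivially.\<close>

lemma normal_subgroup_dichotomy:
  assumes \<rho>: "irreducible_representation G n \<rho>" and N: "N \<lhd> G"
  shows "extend_rep G n \<rho> (\<lambda>g. if g \<in> N then 1 else 0) = 0\<^sub>m n n \<or> (\<forall>x\<in>N. \<rho> x = 1\<^sub>m n)"
proof -
  let ?f = "\<lambda>g. if g \<in> N then 1 else (0::complex)"
  have r: "representation G n \<rho>" and n: "n > 0"
    using \<rho> by (auto simp: irreducible_representation_def)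
  interpret N: normal N G by (rule N)
  obtain c where c: "extend_rep G n \<rho> ?f = c \<cdot>\<^sub>m 1\<^sub>m n"
    using extend_rep_class_function[OF \<rho>, of ?f] normal_indicator_class[OF N] by auto
  have fix_x: "\<rho> x * extend_rep G n \<rho> ?f = extend_rep G n \<rho> ?f" if x: "x \<in> N" for x
  proof -
    have xc: "x \<in> carrier G" using x N.subset by auto
    have "inv x \<otimes> g \<in> N \<longleftrightarrow> g \<in> N" if g: "g \<in> carrier G" for g
    proof
      assume "inv x \<otimes> g \<in> N"
      then have "x \<otimes> (inv x \<otimes> g) \<in> N" using x by blast
      then show "g \<in> N" using xc g by (simp add: m_assoc[symmetric])
    qed (use x in auto)
    then show ?thesis unfolding extend_rep_translate_left[OF r xc] by (intro extend_rep_cong) auto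
  qed
  show ?thesis
  proof (cases "c = 0")
    case True
    then have "extend_rep G n \<rho> ?f = 0\<^sub>m n n" unfolding c by (intro eq_matI) auto
    then show ?thesis ..
  next
    case False
    have "\<rho> x = 1\<^sub>m n" if x: "x \<in> N" for x
    proof -
      have R: "\<rho> x \<in> carrier_mat n n"
        using representation_simps(1)[OF is_group r] x N.subset by auto
      have "c \<cdot>\<^sub>m \<rho> x = c \<cdot>\<^sub>m 1\<^sub>m n"
        using fix_x[OF x] R unfolding c by (simp add: mult_smult_distrib[OF R, of "1\<^sub>m n" n])
      then have "(c \<cdot>\<^sub>m \<rho> x) $$ (i,j) = (c \<cdot>\<^sub>m 1\<^sub>m n) $$ (i,j)" for i j by simp
      then have "\<rho> x $$ (i,j) = 1\<^sub>m n $$ (i,j)" if "i < n" "j < n" for i j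
        using that R False by (metis carrier_matD index_one_mat(2,3) index_smult_mat(1) mult_left_cancel)
      then show ?thesis using R by (intro eq_matI) auto
    qed
    then show ?thesis by blast
  qed
qed

text \<open>If the character is constant on the subgroup, then the sum of \<open>\<rho> g\<close> over the subgroup has nonzero trace,
  which excludes the first alternative of the dichotomy.\<close>

lemma normal_in_char_kernel_iff:
  assumes \<rho>: "irreducible_representation G n \<rho>" and N: "N \<lhd> G"
    and \<chi>: "\<And>g. g \<in> carrier G \<Longrightarrow> \<chi> g = mat_trace (\<rho> g)"
  shows "N \<subseteq> char_kernel G \<chi> \<longleftrightarrow> (\<forall>x\<in>N. \<rho> x = 1\<^sub>m n)"
proof -
  interpret N: normal N G by (rule N)
  have r: "representation G n \<rho>" and n: "n > 0"
    using \<rho> by (auto simp: irreducible_representation_def)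
  have one: "\<chi> \<one> = of_nat n" using \<chi>[of \<one>] representation_simps(3)[OF is_group r] by simp
  show ?thesis
  proof
    assume ker: "N \<subseteq> char_kernel G \<chi>"
    have "extend_rep G n \<rho> (\<lambda>g. if g \<in> N then 1 else 0) \<noteq> 0\<^sub>m n n"
    proof
      assume "extend_rep G n \<rho> (\<lambda>g. if g \<in> N then 1 else 0) = 0\<^sub>m n n"
      then have "0 = (\<Sum>g\<in>carrier G. (if g \<in> N then 1 else 0) * mat_trace (\<rho> g))"
        using mat_trace_extend_rep[OF r, of "\<lambda>g. if g \<in> N then 1 else 0"] by (simp add: mat_trace_def)
      also have "\<dots> = (\<Sum>g\<in>N. \<chi> g)"
        using N.subset \<chi> by (intro sum.mono_neutral_cong_right) auto
      also have "\<dots> = of_nat (card N) * of_nat n"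
        using ker one by (simp add: char_kernel_def subset_iff)
      finally have "card N = 0" using n by (simp flip: of_nat_mult)
      then have "N = {}" using finite_subset[OF N.subset finite_carrier] by (simp add: card_eq_0_iff)
      then show False using subgroup.one_closed[OF normal_imp_subgroup[OF N]] by blast
    qed
    then show "\<forall>x\<in>N. \<rho> x = 1\<^sub>m n" using normal_subgroup_dichotomy[OF \<rho> N] by blast
  next
    assume "\<forall>x\<in>N. \<rho> x = 1\<^sub>m n"
    then show "N \<subseteq> char_kernel G \<chi>" using one N.subset \<chi> by (auto simp: char_kernel_def)
  qed
qed

lemma Irr_sum_over_coset:
  assumes \<chi>: "\<chi> \<in> Irr G" and N: "N \<lhd> G" and nk: "\<not> N \<subseteq> char_kernel G \<chi>" and h: "h \<in> carrier G"
  shows "(\<Sum>g | g \<in> carrier G \<and> inv h \<otimes> g \<in> N. \<chi> g) = 0"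
proof -
  obtain n \<rho> where \<rho>: "irreducible_representation G n \<rho>" "representation G n \<rho>"
    "\<And>g. g \<in> carrier G \<Longrightarrow> \<chi> g = mat_trace (\<rho> g)" using \<chi> by (rule IrrE) blast
  let ?f = "\<lambda>g. if g \<in> N then 1 else (0::complex)"
  have "extend_rep G n \<rho> ?f = 0\<^sub>m n n"
    using normal_subgroup_dichotomy[OF \<rho>(1) N] normal_in_char_kernel_iff[OF \<rho>(1) N \<rho>(3)] nk by blast
  then have "extend_rep G n \<rho> (\<lambda>g. ?f (inv h \<otimes> g)) = 0\<^sub>m n n"
    using extend_rep_translate_left[OF \<rho>(2) h, of ?f] representation_simps(1)[OF is_group \<rho>(2) h] by simp
  then have "0 = mat_trace (extend_rep G n \<rho> (\<lambda>g. ?f (inv h \<otimes> g)))" by (simp add: mat_trace_def)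
  also have "\<dots> = (\<Sum>g\<in>carrier G. ?f (inv h \<otimes> g) * mat_trace (\<rho> g))"
    by (rule mat_trace_extend_rep[OF \<rho>(2)])
  also have "\<dots> = (\<Sum>g | g \<in> carrier G \<and> inv h \<otimes> g \<in> N. \<chi> g)"
    using \<rho>(3) by (intro sum.mono_neutral_cong_right) auto
  finally show ?thesis by simp
qed

lemma Irr_sum_over_normal:
  assumes "\<chi> \<in> Irr G" and N: "N \<lhd> G" and "\<not> N \<subseteq> char_kernel G \<chi>"
  shows "(\<Sum>g\<in>N. \<chi> g) = 0"
proof -
  have "{g \<in> carrier G. inv \<one> \<otimes> g \<in> N} = N"
    using normal_imp_subgroup[OF N] subgroup.subset by fastforce
  then show ?thesis using Irr_sum_over_coset[OF assms one_closed] by simp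
qed

text \<open>The difference of both sides, as a function of the inverse of the argument, is a class function. By
  orthogonality and the dichotomy above, every irreducible representation sends it to zero.\<close>

lemma sum_Irr_over_normal:
  assumes N: "N \<lhd> G" and x: "x \<in> carrier G"
  shows "(\<Sum>\<chi> | \<chi> \<in> Irr G \<and> N \<subseteq> char_kernel G \<chi>. \<chi> \<one> * \<chi> x)
    = (if x \<in> N then of_nat (card (carrier G)) / of_nat (card N) else 0)"
proof -
  interpret N: normal N G by (rule N)
  have Npos: "card N > 0"
    using subgroup.one_closed[OF normal_imp_subgroup[OF N]] finite_subset[OF N.subset finite_carrier]
    unfolding card_gt_0_iff by blast
  define I where "I = {\<chi> \<in> Irr G. N \<subseteq> char_kernel G \<chi>}"
  have finI: "finite I" by (simp add: I_def)
  define c where "c = (of_nat (card (carrier G)) / of_nat (card N) :: complex)"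
  define f where "f g = (\<Sum>\<chi>\<in>I. \<chi> \<one> * \<chi> (inv g)) - (if g \<in> N then c else 0)" for g
  have "f (inv x) = 0"
  proof (rule irreducibles_separate_functions)
    fix n \<rho> assume \<rho>: "irreducible_representation G n \<rho>"
    then have r: "representation G n \<rho>" and n: "n > 0" by (auto simp: irreducible_representation_def)
    define \<psi> where "\<psi> = (\<lambda>g\<in>carrier G. mat_trace (\<rho> g))"
    have \<psi>: "\<psi> \<in> Irr G" unfolding \<psi>_def by (rule IrrI[OF \<rho>])
    have \<psi>g: "\<psi> g = mat_trace (\<rho> g)" if "g \<in> carrier G" for g using that by (simp add: \<psi>_def)
    have one: "\<psi> \<one> = of_nat n" using \<psi>g[of \<one>] representation_simps(3)[OF is_group r] by simp
    have "(\<Sum>g\<in>carrier G. f g * mat_trace (\<rho> g))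
        = (\<Sum>g\<in>carrier G. (\<Sum>\<chi>\<in>I. \<chi> \<one> * (\<psi> g * \<chi> (inv g))) - (if g \<in> N then c * \<psi> g else 0))"
      by (intro sum.cong) (auto simp: f_def \<psi>g algebra_simps sum_distrib_left sum_distrib_right)
    also have "\<dots> = (\<Sum>g\<in>carrier G. \<Sum>\<chi>\<in>I. \<chi> \<one> * (\<psi> g * \<chi> (inv g))) - (\<Sum>g\<in>carrier G. if g \<in> N then c * \<psi> g else 0)"
      by (simp add: sum_subtractf)
    also have "(\<Sum>g\<in>carrier G. \<Sum>\<chi>\<in>I. \<chi> \<one> * (\<psi> g * \<chi> (inv g))) = (\<Sum>\<chi>\<in>I. \<chi> \<one> * (\<Sum>g\<in>carrier G. \<psi> g * \<chi> (inv g)))"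
      by (subst sum.swap) (simp add: sum_distrib_left)
    also have "\<dots> = (\<Sum>\<chi>\<in>I. if \<chi> = \<psi> then of_nat n * of_nat (card (carrier G)) else 0)"
      using orthogonality_eq[OF \<psi>] orthogonality_neq[OF \<psi>] one by (intro sum.cong) (auto simp: I_def)
    also have "\<dots> = (if \<psi> \<in> I then of_nat n * of_nat (card (carrier G)) else 0)"
      using finI by (simp add: sum.delta)
    also have "(\<Sum>g\<in>carrier G. if g \<in> N then c * \<psi> g else 0) = c * (\<Sum>g\<in>N. \<psi> g)"
      unfolding sum_distrib_left using N.subset by (intro sum.mono_neutral_cong_right) auto
    also have "(\<Sum>g\<in>N. \<psi> g) = (if \<psi> \<in> I then of_nat n * of_nat (card N) else 0)"
    proof (cases "\<psi> \<in> I")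
      case True
      then have "(\<Sum>g\<in>N. \<psi> g) = (\<Sum>g\<in>N. of_nat n)"
        using one by (intro sum.cong) (auto simp: I_def char_kernel_def)
      then show ?thesis using True by simp
    next
      case False
      then show ?thesis using Irr_sum_over_normal[OF \<psi> N] \<psi> by (simp add: I_def)
    qed
    finally have "(\<Sum>g\<in>carrier G. f g * mat_trace (\<rho> g)) = 0"
      using Npos by (simp add: c_def)
    moreover have "f (y \<otimes> g \<otimes> inv y) = f g" if y: "y \<in> carrier G" and g: "g \<in> carrier G" for y g
    proof -
      have "inv (y \<otimes> g \<otimes> inv y) = y \<otimes> inv g \<otimes> inv y" using y g by (simp add: inv_mult_group m_assoc)
      moreover have "\<chi> (y \<otimes> inv g \<otimes> inv y) = \<chi> (inv g)" if "\<chi> \<in> I" for \<chi>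
        using Irr_conj[of \<chi> y "inv g"] that y g by (simp add: I_def)
      then have "(\<Sum>\<chi>\<in>I. \<chi> \<one> * \<chi> (y \<otimes> inv g \<otimes> inv y)) = (\<Sum>\<chi>\<in>I. \<chi> \<one> * \<chi> (inv g))"
        by (intro sum.cong refl) metis
      ultimately show ?thesis using normal_indicator_class[OF N y g] by (simp add: f_def)
    qed
    ultimately show "extend_rep G n \<rho> f = 0\<^sub>m n n"
      using extend_rep_class_function[OF \<rho>, of f] by (auto intro!: eq_matI)
  qed (use x in simp)
  moreover have "inv x \<in> N \<longleftrightarrow> x \<in> N" using x by (metis N.m_inv_closed inv_inv)
  ultimately show ?thesis using x by (simp add: f_def c_def I_def)
qed

lemma sum_Irr:
  assumes x: "x \<in> carrier G"
  shows "(\<Sum>\<chi>\<in>Irr G. \<chi> \<one> * \<chi> x) = (if x = \<one> then of_nat (card (carrier G)) else 0)"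
proof -
  have "{\<chi>. \<chi> \<in> Irr G \<and> {\<one>} \<subseteq> char_kernel G \<chi>} = Irr G" by (auto simp: char_kernel_def)
  then show ?thesis using sum_Irr_over_normal[OF one_is_normal x] by simp
qed

text \<open>The difference of the normalized indicators of the two classes is a class function that is
  orthogonal to all characters, so every irreducible representation sends it to zero.\<close>

lemma Irr_separate_classes:
  assumes a: "a \<in> carrier G" and b: "b \<in> carrier G" and eq: "\<And>\<chi>. \<chi> \<in> Irr G \<Longrightarrow> \<chi> a = \<chi> b"
  shows "conjugate_in G a b"
proof (rule ccontr)
  assume nc: "\<not> conjugate_in G a b"
  define \<delta> where "\<delta> y g = (if g \<in> conj_class y then 1 / of_nat (card (conj_class y)) else 0 :: complex)" for y g
  have clpos: "card (conj_class y) > 0" if "y \<in> carrier G" for y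
    using conj_class_self[OF that] by (auto simp: card_gt_0_iff conj_class_def)
  have sum\<delta>: "(\<Sum>g\<in>carrier G. \<delta> y g * \<chi> g) = \<chi> y" if y: "y \<in> carrier G" and \<chi>: "\<chi> \<in> Irr G" for y \<chi>
  proof -
    have "(\<Sum>g\<in>carrier G. \<delta> y g * \<chi> g) = (\<Sum>g\<in>conj_class y. 1 / of_nat (card (conj_class y)) * \<chi> g)"
      using conj_class_subset[OF y] by (intro sum.mono_neutral_cong_right) (auto simp: \<delta>_def)
    also have "\<dots> = (\<Sum>g\<in>conj_class y. 1 / of_nat (card (conj_class y)) * \<chi> y)"
      using Irr_conj[OF \<chi>] y by (intro sum.cong) (auto simp: conj_class_def)
    also have "\<dots> = \<chi> y" using clpos[OF y] by simp
    finally show ?thesis .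
  qed
  define f where "f g = \<delta> a g - \<delta> b g" for g
  have "f a = 0"
  proof (rule irreducibles_separate_functions[OF _ a])
    fix n \<rho> assume \<rho>: "irreducible_representation G n \<rho>"
    define \<psi> where "\<psi> = (\<lambda>g\<in>carrier G. mat_trace (\<rho> g))"
    have \<psi>: "\<psi> \<in> Irr G" unfolding \<psi>_def by (rule IrrI[OF \<rho>])
    have "(\<Sum>g\<in>carrier G. f g * mat_trace (\<rho> g)) = (\<Sum>g\<in>carrier G. \<delta> a g * \<psi> g - \<delta> b g * \<psi> g)"
      by (intro sum.cong) (auto simp: f_def \<psi>_def left_diff_distrib)
    also have "\<dots> = 0" using sum\<delta>[OF a \<psi>] sum\<delta>[OF b \<psi>] eq[OF \<psi>] by (simp add: sum_subtractf)
    finally show "extend_rep G n \<rho> f = 0\<^sub>m n n"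
      using extend_rep_class_function[OF \<rho>, of f] conj_class_conj_iff a b
      by (auto simp: f_def \<delta>_def intro!: eq_matI)
  qed
  moreover have "a \<notin> conj_class b"
    using nc conj_class_eq[OF b] conj_class_self[OF b] unfolding conjugate_in_iff by blast
  ultimately show False using conj_class_self[OF a] clpos[OF a] by (simp add: f_def \<delta>_def)
qed

lemma Irr_degree:
  assumes "\<chi> \<in> Irr G"
  obtains n where "n > 0" "\<chi> \<one> = of_nat n"
  using assms by (rule IrrE) (metis mat_trace_one one_closed representation_simps(3) is_group)

section \<open>Linear characters\<close>

lemma linear_char_mult:
  assumes \<chi>: "\<chi> \<in> linear_chars" and g: "g \<in> carrier G" and h: "h \<in> carrier G"
  shows "\<chi> (g \<otimes> h) = \<chi> g * \<chi> h"
proof -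
  obtain n \<rho> where \<rho>: "representation G n \<rho>" "\<And>g. g \<in> carrier G \<Longrightarrow> \<chi> g = mat_trace (\<rho> g)"
    using \<chi> unfolding linear_chars_def by (auto elim: IrrE)
  note R = representation_simps[OF is_group \<rho>(1)]
  have "n = 1" using \<rho>(2)[of \<one>] R(3) \<chi> by (simp add: linear_chars_def)
  then have "\<rho> g \<in> carrier_mat 1 1" "\<rho> h \<in> carrier_mat 1 1" using R(1) g h by auto
  then show ?thesis using \<rho>(2) g h R(2)[OF g h] by (simp add: mat_trace_def scalar_prod_def)
qed

lemma linear_char_norm:
  assumes \<chi>: "\<chi> \<in> linear_chars" and g: "g \<in> carrier G"
  shows "cmod (\<chi> g) = 1"
proof -
  have pow: "\<chi> (g [^] k) = \<chi> g ^ k" for k :: nat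
    using linear_char_mult[OF \<chi> _ g] g \<chi> by (induction k) (auto simp: linear_chars_def)
  have "\<chi> g ^ Coset.order G = 1" using pow[of "Coset.order G"] pow_order_eq_1[OF g] \<chi> by (simp add: linear_chars_def)
  then have "cmod (\<chi> g) ^ Coset.order G = 1 ^ Coset.order G" by (metis norm_power norm_one power_one)
  then show ?thesis
    by (rule power_eq_imp_eq_base) (use card_carrier_pos in \<open>auto simp: Coset.order_def\<close>)
qed

abbreviation derived_subgroup :: "'a set" where
  "derived_subgroup \<equiv> derived G (carrier G)"

lemma commutator_in_derived:
  "a \<in> carrier G \<Longrightarrow> b \<in> carrier G \<Longrightarrow> a \<otimes> b \<otimes> inv a \<otimes> inv b \<in> derived_subgroup"
  unfolding derived_def by (rule generate.incl) blast

text \<open>If the commutator subgroup acts trivially, then the matrices of the representation commute, so they are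
  scalars by Schur's lemma; then the line spanned by the first unit vector is invariant.\<close>

lemma linear_iff_derived_in_kernel:
  assumes \<chi>: "\<chi> \<in> Irr G"
  shows "\<chi> \<one> = 1 \<longleftrightarrow> derived_subgroup \<subseteq> char_kernel G \<chi>"
proof
  assume "\<chi> \<one> = 1"
  then have lin: "\<chi> \<in> linear_chars" using \<chi> by (simp add: linear_chars_def)
  note m = linear_char_mult[OF lin]
  have inv1: "\<chi> g * \<chi> (inv g) = 1" if "g \<in> carrier G" for g
    using m[of g "inv g"] that \<open>\<chi> \<one> = 1\<close> by simp
  have "subgroup {g \<in> carrier G. \<chi> g = 1} G"
  proof
    fix g assume g: "g \<in> {g \<in> carrier G. \<chi> g = 1}"
    then show "inv g \<in> {g \<in> carrier G. \<chi> g = 1}" using inv1[of g] by auto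
  qed (auto simp: m \<open>\<chi> \<one> = 1\<close>)
  moreover have "derived_set G (carrier G) \<subseteq> {g \<in> carrier G. \<chi> g = 1}"
  proof
    fix g assume "g \<in> derived_set G (carrier G)"
    then obtain a b where ab: "a \<in> carrier G" "b \<in> carrier G" "g = a \<otimes> b \<otimes> inv a \<otimes> inv b" by blast
    then have "\<chi> g = \<chi> a * \<chi> b * \<chi> (inv a) * \<chi> (inv b)" by (simp add: m)
    also have "\<dots> = (\<chi> a * \<chi> (inv a)) * (\<chi> b * \<chi> (inv b))" by (simp add: mult_ac)
    finally show "g \<in> {g \<in> carrier G. \<chi> g = 1}" using ab inv1 by simp
  qed
  ultimately show "derived_subgroup \<subseteq> char_kernel G \<chi>"
    unfolding derived_def char_kernel_def \<open>\<chi> \<one> = 1\<close> using generate_subgroup_incl by blast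
next
  assume ker: "derived_subgroup \<subseteq> char_kernel G \<chi>"
  obtain n \<rho> where \<rho>: "irreducible_representation G n \<rho>" "representation G n \<rho>" "n > 0"
    "\<And>g. g \<in> carrier G \<Longrightarrow> \<chi> g = mat_trace (\<rho> g)" using \<chi> by (rule IrrE) blast
  note R = representation_simps[OF is_group \<rho>(2)]
  have triv: "\<rho> x = 1\<^sub>m n" if "x \<in> derived_subgroup" for x
    using normal_in_char_kernel_iff[OF \<rho>(1) derived_self_is_normal \<rho>(4)] ker that by blast
  have comm: "\<rho> x * \<rho> y = \<rho> y * \<rho> x" if x: "x \<in> carrier G" and y: "y \<in> carrier G" for x y
  proof -
    have "x \<otimes> y = (x \<otimes> y \<otimes> inv x \<otimes> inv y) \<otimes> (y \<otimes> x)"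
      using x y by (simp add: m_assoc) (simp add: m_assoc[symmetric])
    then have "\<rho> x * \<rho> y = \<rho> (x \<otimes> y \<otimes> inv x \<otimes> inv y) * (\<rho> y * \<rho> x)"
      using x y R(2) by (metis inv_closed m_closed)
    then show ?thesis
      using triv[OF commutator_in_derived[OF x y]] left_mult_one_mat[OF mult_carrier_mat[OF R(1)[OF y] R(1)[OF x]]] by simp
  qed
  have scal: "\<exists>a. \<rho> x = a \<cdot>\<^sub>m 1\<^sub>m n" if x: "x \<in> carrier G" for x
    by (rule schur_scalar[OF is_group \<rho>(1) R(1)[OF x]]) (rule comm[OF x])
  define W where "W = {v \<in> carrier_vec n. \<forall>i. 0 < i \<and> i < n \<longrightarrow> v $ i = (0::complex)}"
  have "complex_subspace n W"
    unfolding subspace_iff W_def by auto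
  moreover have "\<rho> x *\<^sub>v w \<in> W" if x: "x \<in> carrier G" and w: "w \<in> W" for x w
  proof -
    obtain a where "\<rho> x = a \<cdot>\<^sub>m 1\<^sub>m n" using scal[OF x] by blast
    moreover have "(a \<cdot>\<^sub>m 1\<^sub>m n) *\<^sub>v w = a \<cdot>\<^sub>v w"
      using w by (intro eq_vecI) (auto simp: W_def scalar_prod_def if_distrib if_distribR sum.delta cong: if_cong)
    ultimately show ?thesis using w by (auto simp: W_def)
  qed
  ultimately have "W = {0\<^sub>v n} \<or> W = carrier_vec n" by (rule irreducibleD[OF \<rho>(1)])
  moreover have "W \<noteq> {0\<^sub>v n}"
  proof -
    have "unit_vec n 0 \<in> W" by (auto simp: W_def)
    moreover have "unit_vec n 0 \<noteq> (0\<^sub>v n :: complex vec)" using \<rho>(3) by (metis unit_vec_nonzero)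
    ultimately show ?thesis by blast
  qed
  ultimately have W: "W = carrier_vec n" by blast
  have "n = 1"
  proof (rule ccontr)
    assume "n \<noteq> 1"
    then have "1 < n" using \<rho>(3) by simp
    moreover have "unit_vec n 1 \<in> W" using W by simp
    ultimately show False by (auto simp: W_def)
  qed
  then show "\<chi> \<one> = 1" using \<rho>(4)[of \<one>] R(3) by simp
qed

lemma linear_chars_eq: "linear_chars = {\<chi>. \<chi> \<in> Irr G \<and> derived_subgroup \<subseteq> char_kernel G \<chi>}"
  using linear_iff_derived_in_kernel by (auto simp: linear_chars_def)

lemma derived_subgroup: "subgroup derived_subgroup G"
  by (rule derived_is_subgroup) simp

definition derived_index :: nat where
  "derived_index = card (carrier G) div card derived_subgroup"

lemma derived_index: "derived_index * card derived_subgroup = card (carrier G)" "derived_index > 0"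
proof -
  have "card derived_subgroup dvd card (carrier G)"
    using lagrange[OF derived_subgroup] by (metis Coset.order_def dvd_triv_right)
  then show 1: "derived_index * card derived_subgroup = card (carrier G)" by (simp add: derived_index_def)
  then show "derived_index > 0" using card_carrier_pos by (metis gr0I mult_is_0 less_irrefl)
qed

lemma card_derived_pos: "card derived_subgroup > 0"
  using derived_index card_carrier_pos by (metis gr0I mult_is_0 less_irrefl)

lemma sum_linear_chars:
  assumes x: "x \<in> carrier G"
  shows "(\<Sum>\<chi>\<in>linear_chars. \<chi> x) = (if x \<in> derived_subgroup then of_nat derived_index else 0)"
proof -
  have "(\<Sum>\<chi>\<in>linear_chars. \<chi> x) = (\<Sum>\<chi>\<in>linear_chars. \<chi> \<one> * \<chi> x)"
    by (intro sum.cong) (auto simp: linear_chars_def)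
  also have "\<dots> = (if x \<in> derived_subgroup then of_nat (card (carrier G)) / of_nat (card derived_subgroup) else 0)"
    unfolding linear_chars_eq by (rule sum_Irr_over_normal[OF derived_self_is_normal x])
  also have "of_nat (card (carrier G)) / of_nat (card derived_subgroup) = (of_nat derived_index :: complex)"
    using card_derived_pos by (simp flip: derived_index(1))
  finally show ?thesis .
qed

lemma card_linear_chars: "card linear_chars = derived_index"
proof -
  have "(\<Sum>\<chi>\<in>linear_chars. \<chi> \<one>) = (\<Sum>\<chi>\<in>linear_chars. 1)"
    by (intro sum.cong) (auto simp: linear_chars_def)
  then have "(of_nat (card linear_chars) :: complex) = of_nat derived_index"
    using sum_linear_chars[OF one_closed] subgroup.one_closed[OF derived_subgroup] by simp
  then show ?thesis using of_nat_eq_iff by blast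
qed

end

section \<open>Groups with a single nonlinear irreducible character\<close>

context finite_group
begin

definition nonlinear_chars :: "('a \<Rightarrow> complex) set" where
  "nonlinear_chars = Irr G - linear_chars"

text \<open>The condition on classes that is equivalent to having a single nonlinear irreducible character; its first
  clause excludes the abelian groups.\<close>
definition commutator_cosets_are_classes :: bool where
  "commutator_cosets_are_classes \<longleftrightarrow>
     derived_subgroup \<noteq> {\<one>} \<and>
     (\<forall>a\<in>derived_subgroup - {\<one>}. \<forall>b\<in>derived_subgroup - {\<one>}. conjugate_in G a b) \<and>
     (\<forall>a\<in>carrier G - derived_subgroup. \<forall>b\<in>carrier G. inv a \<otimes> b \<in> derived_subgroup \<longrightarrow> conjugate_in G a b)"

lemma linear_subset_Irr: "linear_chars \<subseteq> Irr G" by (auto simp: linear_chars_def)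

lemma Irr_split: "Irr G = linear_chars \<union> nonlinear_chars" "linear_chars \<inter> nonlinear_chars = {}"
  using linear_subset_Irr by (auto simp: nonlinear_chars_def)

lemma finite_linear [simp]: "finite linear_chars" and finite_nonlinear [simp]: "finite nonlinear_chars"
  using finite_subset[OF linear_subset_Irr] by (auto simp: nonlinear_chars_def)

lemma derived_sub_carrier: "x \<in> derived_subgroup \<Longrightarrow> x \<in> carrier G"
  using subgroup.mem_carrier[OF derived_subgroup] .

lemma one_in_derived [simp]: "\<one> \<in> derived_subgroup"
  using subgroup.one_closed[OF derived_subgroup] .

lemma finite_derived [simp]: "finite derived_subgroup"
  using finite_subset[OF subgroup.subset[OF derived_subgroup]] by simp

lemma linear_char_on_derived: "\<chi> \<in> linear_chars \<Longrightarrow> x \<in> derived_subgroup \<Longrightarrow> \<chi> x = 1"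
proof -
  assume "\<chi> \<in> linear_chars" "x \<in> derived_subgroup"
  then have "\<chi> \<one> = 1" "x \<in> char_kernel G \<chi>"
    using linear_iff_derived_in_kernel by (auto simp: linear_chars_def)
  then show "\<chi> x = 1" by (simp add: char_kernel_def)
qed

lemma nonlinear_degree:
  assumes "\<chi> \<in> nonlinear_chars"
  obtains d where "d \<ge> 2" "\<chi> \<one> = of_nat d"
proof -
  have \<chi>: "\<chi> \<in> Irr G" "\<chi> \<one> \<noteq> 1" using assms by (auto simp: nonlinear_chars_def linear_chars_def)
  obtain d where d: "d > 0" "\<chi> \<one> = of_nat d" using Irr_degree[OF \<chi>(1)] .
  then have "d \<noteq> 1" using \<chi>(2) by auto
  then show ?thesis using that[of d] d by simp
qed

lemma nonlinear_imp_derived_nontrivial: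
  assumes "\<chi> \<in> nonlinear_chars" shows "derived_subgroup \<noteq> {\<one>}"
proof
  assume "derived_subgroup = {\<one>}"
  then have "derived_subgroup \<subseteq> char_kernel G \<chi>" by (auto simp: char_kernel_def)
  then show False using assms linear_iff_derived_in_kernel by (auto simp: nonlinear_chars_def linear_chars_def)
qed

lemma sum_nonlinear_chars:
  assumes x: "x \<in> carrier G"
  shows "(\<Sum>\<chi>\<in>nonlinear_chars. \<chi> \<one> * \<chi> x)
    = (if x = \<one> then of_nat (card (carrier G)) else 0) - (if x \<in> derived_subgroup then of_nat derived_index else 0)"
proof -
  have "(\<Sum>\<chi>\<in>Irr G. \<chi> \<one> * \<chi> x) = (\<Sum>\<chi>\<in>linear_chars. \<chi> \<one> * \<chi> x) + (\<Sum>\<chi>\<in>nonlinear_chars. \<chi> \<one> * \<chi> x)"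
    unfolding Irr_split(1) by (rule sum.union_disjoint) (auto simp: Irr_split(2))
  moreover have "(\<Sum>\<chi>\<in>linear_chars. \<chi> \<one> * \<chi> x) = (\<Sum>\<chi>\<in>linear_chars. \<chi> x)"
    by (intro sum.cong) (auto simp: linear_chars_def)
  ultimately show ?thesis using sum_Irr[OF x] sum_linear_chars[OF x] by (simp add: algebra_simps)
qed

lemma ex_nonlinear:
  assumes "derived_subgroup \<noteq> {\<one>}" shows "nonlinear_chars \<noteq> {}"
proof
  assume "nonlinear_chars = {}"
  moreover obtain z where "z \<in> derived_subgroup" "z \<noteq> \<one>" using assms one_in_derived by blast
  ultimately show False
    using sum_nonlinear_chars[of z] derived_sub_carrier[of z] derived_index(2) by simp
qed

text \<open>The nonlinear character is determined by \<open>sum_nonlinear_chars\<close>. No character distinguishes two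
  nontrivial elements of the commutator subgroup, nor two elements of one of its other cosets.\<close>

lemma unique_nonlinear_imp_classes:
  assumes un: "nonlinear_chars = {\<chi>}"
  shows "commutator_cosets_are_classes"
proof -
  have \<chi>: "\<chi> \<in> nonlinear_chars" using un by simp
  obtain d where d: "d \<ge> 2" "\<chi> \<one> = of_nat d" using nonlinear_degree[OF \<chi>] .
  have val: "of_nat d * \<chi> x = (if x = \<one> then of_nat (card (carrier G)) else 0)
      - (if x \<in> derived_subgroup then of_nat derived_index else 0)" if "x \<in> carrier G" for x
    using sum_nonlinear_chars[OF that] un d by simp
  have conj: "conjugate_in G a b"
    if a: "a \<in> carrier G" and b: "b \<in> carrier G"
      and lin: "\<And>\<mu>. \<mu> \<in> linear_chars \<Longrightarrow> \<mu> a = \<mu> b" and eq: "of_nat d * \<chi> a = of_nat d * \<chi> b" for a b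
  proof (rule Irr_separate_classes[OF a b])
    fix \<psi> assume "\<psi> \<in> Irr G"
    then show "\<psi> a = \<psi> b" using lin eq d(1) un unfolding Irr_split(1) by auto
  qed
  show ?thesis unfolding commutator_cosets_are_classes_def
  proof (intro conjI ballI impI)
    show "derived_subgroup \<noteq> {\<one>}" by (rule nonlinear_imp_derived_nontrivial[OF \<chi>])
  next
    fix a b assume "a \<in> derived_subgroup - {\<one>}" "b \<in> derived_subgroup - {\<one>}"
    then show "conjugate_in G a b"
      by (intro conj) (auto simp: derived_sub_carrier val linear_char_on_derived)
  next
    fix a b assume a: "a \<in> carrier G - derived_subgroup" and b: "b \<in> carrier G"
      and ab: "inv a \<otimes> b \<in> derived_subgroup"
    have beq: "b = a \<otimes> (inv a \<otimes> b)" using a b by (simp add: m_assoc[symmetric])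
    have "b \<notin> derived_subgroup"
    proof
      assume bd: "b \<in> derived_subgroup"
      have "a = b \<otimes> inv (inv a \<otimes> b)" using a b by (simp add: inv_mult_group m_assoc[symmetric])
      then show False
        using subgroup.m_closed[OF derived_subgroup bd subgroup.m_inv_closed[OF derived_subgroup ab]] a by auto
    qed
    moreover have "\<mu> a = \<mu> b" if \<mu>: "\<mu> \<in> linear_chars" for \<mu>
      using linear_char_mult[OF \<mu>, of a "inv a \<otimes> b"] linear_char_on_derived[OF \<mu> ab] a b beq by simp
    moreover have "a \<noteq> \<one>" "b \<noteq> \<one>" using a \<open>b \<notin> _\<close> by auto
    ultimately show "conjugate_in G a b" using a b by (intro conj) (auto simp: val)
  qed
qed

lemma conjugate_in_Irr_eq:
  "conjugate_in G a b \<Longrightarrow> a \<in> carrier G \<Longrightarrow> \<chi> \<in> Irr G \<Longrightarrow> \<chi> a = \<chi> b"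
  by (auto simp: conjugate_in_def Irr_conj)

text \<open>A nonlinear character is constant on the classes that make up the cosets of the commutator subgroup
  and has sum zero over each coset. So it is the multiple by its degree of the function \<open>\<phi>\<close> of the proof, and two such
  multiples are not orthogonal.\<close>

lemma classes_imp_unique_nonlinear:
  assumes cl: "commutator_cosets_are_classes"
  shows "\<exists>\<chi>. nonlinear_chars = {\<chi>}"
proof -
  let ?D = derived_subgroup
  define q where "q = card ?D"
  obtain z where z: "z \<in> ?D" "z \<noteq> \<one>"
    using cl one_in_derived unfolding commutator_cosets_are_classes_def by blast
  have q: "q \<ge> 2"
  proof -
    have "card {\<one>, z} \<le> q" unfolding q_def using z by (intro card_mono) auto
    then show ?thesis using z by simp
  qed
  define \<phi> :: "'a \<Rightarrow> complex" where
    "\<phi> g = (if g = \<one> then 1 else if g \<in> ?D then - 1 / of_nat (q - 1) else 0)" for g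
  have shape: "\<chi> g = \<chi> \<one> * \<phi> g" if \<chi>n: "\<chi> \<in> nonlinear_chars" and g: "g \<in> carrier G" for \<chi> g
  proof -
    have \<chi>: "\<chi> \<in> Irr G" and nk: "\<not> ?D \<subseteq> char_kernel G \<chi>"
      using \<chi>n linear_iff_derived_in_kernel by (auto simp: nonlinear_chars_def linear_chars_def)
    consider "g = \<one>" | "g \<in> ?D" "g \<noteq> \<one>" | "g \<notin> ?D" by blast
    then show ?thesis
    proof cases
      case 2
      have "0 = (\<Sum>x\<in>?D. \<chi> x)" using Irr_sum_over_normal[OF \<chi> derived_self_is_normal nk] by simp
      also have "\<dots> = \<chi> \<one> + (\<Sum>x\<in>?D - {\<one>}. \<chi> x)" by (simp add: sum.remove[of _ \<one>])
      also have "(\<Sum>x\<in>?D - {\<one>}. \<chi> x) = (\<Sum>x\<in>?D - {\<one>}. \<chi> g)"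
        using cl 2 \<chi> derived_sub_carrier unfolding commutator_cosets_are_classes_def
        by (intro sum.cong refl conjugate_in_Irr_eq) auto
      also have "\<dots> = of_nat (q - 1) * \<chi> g" by (simp add: q_def)
      finally have "of_nat (q - 1) * \<chi> g = - \<chi> \<one>" by (simp add: eq_neg_iff_add_eq_0 add.commute)
      moreover have "(of_nat (q - 1) :: complex) \<noteq> 0" using q by simp
      ultimately show ?thesis using 2 by (simp add: \<phi>_def field_simps)
    next
      case 3
      let ?C = "{x. x \<in> carrier G \<and> inv g \<otimes> x \<in> ?D}"
      have "0 = (\<Sum>x\<in>?C. \<chi> x)" using Irr_sum_over_coset[OF \<chi> derived_self_is_normal nk g] by simp
      also have "\<dots> = (\<Sum>x\<in>?C. \<chi> g)"
        using cl 3 g \<chi> unfolding commutator_cosets_are_classes_def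
        by (intro sum.cong refl conjugate_in_Irr_eq[symmetric]) auto
      also have "\<dots> = of_nat (card ?C) * \<chi> g" by simp
      finally have "of_nat (card ?C) * \<chi> g = 0" by simp
      moreover have "g \<in> ?C" using g by simp
      then have "card ?C \<noteq> 0" by (auto simp: card_eq_0_iff)
      ultimately have "\<chi> g = 0" by simp
      then show ?thesis using 3 by (auto simp: \<phi>_def)
    qed (simp add: \<phi>_def)
  qed
  define S where "S = (\<Sum>g\<in>carrier G. \<phi> g * \<phi> (inv g))"
  have pair: "(\<Sum>g\<in>carrier G. \<chi> g * \<psi> (inv g)) = \<chi> \<one> * \<psi> \<one> * S"
    if "\<chi> \<in> nonlinear_chars" "\<psi> \<in> nonlinear_chars" for \<chi> \<psi>
    unfolding S_def sum_distrib_left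
    using shape[OF that(1)] shape[OF that(2)] by (intro sum.cong refl) (metis inv_closed mult.assoc mult.left_commute)
  obtain \<chi> where \<chi>: "\<chi> \<in> nonlinear_chars"
    using ex_nonlinear cl unfolding commutator_cosets_are_classes_def by blast
  have "S \<noteq> 0"
    using pair[OF \<chi> \<chi>] orthogonality_eq[of \<chi>] \<chi> card_carrier_pos by (auto simp: nonlinear_chars_def)
  have "\<psi> = \<chi>" if \<psi>: "\<psi> \<in> nonlinear_chars" for \<psi>
  proof (rule ccontr)
    assume neq: "\<psi> \<noteq> \<chi>"
    have "\<psi> \<one> * \<chi> \<one> * S = 0"
      using pair[OF \<psi> \<chi>] orthogonality_neq[OF _ _ neq] \<psi> \<chi> by (auto simp: nonlinear_chars_def)
    moreover have "\<psi> \<one> \<noteq> 0" "\<chi> \<one> \<noteq> 0"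
      using nonlinear_degree[OF \<psi>] nonlinear_degree[OF \<chi>] by (metis of_nat_eq_0_iff not_numeral_le_zero)+
    ultimately show False using \<open>S \<noteq> 0\<close> by simp
  qed
  then show ?thesis using \<chi> by blast
qed

lemma degree_pattern_unique_nonlinear:
  assumes un: "nonlinear_chars = {\<chi>}"
  obtains d where "d \<ge> 2" "\<chi> \<one> = of_nat d" "d * d + derived_index = card (carrier G)"
    "degree_pattern G = replicate_mset derived_index 1 + {#of_nat d#}"
proof -
  have \<chi>: "\<chi> \<in> nonlinear_chars" using un by simp
  obtain d where d: "d \<ge> 2" "\<chi> \<one> = of_nat d" using nonlinear_degree[OF \<chi>] .
  have "of_nat (d * d + derived_index) = (of_nat (card (carrier G)) :: complex)"
    using sum_nonlinear_chars[OF one_closed] un d by simp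
  then have sq: "d * d + derived_index = card (carrier G)" by (simp only: of_nat_eq_iff)
  have "mset_set (Irr G) = mset_set linear_chars + {#\<chi>#}"
    using Irr_split un by (simp add: mset_set_Union)
  moreover have "image_mset (\<lambda>\<chi>. \<chi> \<one>) (mset_set linear_chars) = image_mset (\<lambda>\<chi>. 1) (mset_set linear_chars)"
    by (intro image_mset_cong) (auto simp: linear_chars_def)
  ultimately have "degree_pattern G = replicate_mset derived_index 1 + {#of_nat d#}"
    using d by (simp add: degree_pattern_def image_mset_const_eq card_linear_chars)
  then show ?thesis using that d sq by blast
qed

lemma last_character_max:
  assumes "Irr G \<noteq> {}"
  shows "last_character G \<in> Irr G" "\<chi> \<in> Irr G \<Longrightarrow> Re (\<chi> \<one>) \<le> Re (last_character G \<one>)"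
proof -
  let ?f = "\<lambda>\<chi>. Re (\<chi> \<one>)"
  have "Max (?f ` Irr G) \<in> ?f ` Irr G" using assms by (intro Max_in) auto
  then obtain \<psi> where \<psi>: "\<psi> \<in> Irr G" "Max (?f ` Irr G) = ?f \<psi>" by auto
  have "is_arg_max ?f (\<lambda>\<chi>. \<chi> \<in> Irr G) \<psi>"
    unfolding is_arg_max_linorder using \<psi> by (metis Max_ge finite_Irr finite_imageI imageI)
  then have "is_arg_max ?f (\<lambda>\<chi>. \<chi> \<in> Irr G) (last_character G)"
    unfolding last_character_def arg_max_def
    by (rule someI[of "is_arg_max ?f (\<lambda>\<chi>. \<chi> \<in> Irr G)"])
  then show "last_character G \<in> Irr G" "\<chi> \<in> Irr G \<Longrightarrow> Re (\<chi> \<one>) \<le> Re (last_character G \<one>)"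
    unfolding is_arg_max_linorder by auto
qed

text \<open>Otherwise all characters are linear, and all but one of them have the value 1 at
  \<open>x = a b\<^sup>-\<^sup>1 \<noteq> 1\<close>. Their sum at \<open>x\<close> is zero, so the remaining value is \<open>1 - \<bar>G\<bar>\<close>; but it has absolute
  value 1.\<close>

lemma CD1_group_nonabelian:
  assumes cd: "CD1_group G"
  shows "derived_subgroup \<noteq> {\<one>}"
proof
  assume triv: "derived_subgroup = {\<one>}"
  have allin: "Irr G = linear_chars"
    using nonlinear_imp_derived_nontrivial triv unfolding Irr_split(1) by blast
  obtain a b \<chi> where ab: "a \<in> carrier G" "b \<in> carrier G" and \<chi>: "\<chi> \<in> Irr G" "\<chi> a \<noteq> \<chi> b"
    and others: "\<And>\<psi>. \<psi> \<in> Irr G \<Longrightarrow> \<psi> \<noteq> \<chi> \<Longrightarrow> \<psi> a = \<psi> b" and big: "card (carrier G) > 2"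
    using cd unfolding CD1_group_def Coset.order_def by blast
  define x where "x = a \<otimes> inv b"
  have x: "x \<in> carrier G" using ab by (simp add: x_def)
  have "x \<noteq> \<one>" using ab \<chi> by (auto simp: x_def) (metis inv_closed inv_equality inv_inv)
  then have "(\<Sum>\<psi>\<in>linear_chars. \<psi> x) = 0" using sum_linear_chars[OF x] triv by simp
  moreover have "(\<Sum>\<psi>\<in>linear_chars. \<psi> x) = \<chi> x + (\<Sum>\<psi>\<in>linear_chars - {\<chi>}. \<psi> x)"
    using \<chi> allin by (simp add: sum.remove)
  moreover have "\<psi> x = 1" if "\<psi> \<in> linear_chars - {\<chi>}" for \<psi>
  proof -
    have \<psi>: "\<psi> \<in> linear_chars" "\<psi> a = \<psi> b" using that others allin by auto
    have "\<psi> x * \<psi> b = \<psi> a"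
      using linear_char_mult[OF \<psi>(1) x ab(2)] ab by (simp add: x_def m_assoc)
    moreover have "\<psi> b \<noteq> 0" using linear_char_norm[OF \<psi>(1) ab(2)] by auto
    ultimately show ?thesis using \<psi>(2) by simp
  qed
  then have "(\<Sum>\<psi>\<in>linear_chars - {\<chi>}. \<psi> x) = (\<Sum>\<psi>\<in>linear_chars - {\<chi>}. 1)"
    by (intro sum.cong refl) metis
  ultimately have "\<chi> x = - of_nat (card (linear_chars - {\<chi>}))"
    by (simp add: add_eq_0_iff2)
  moreover have "card (linear_chars - {\<chi>}) = card (carrier G) - 1"
    using \<chi>(1) allin card_linear_chars derived_index(1) triv by (simp add: card_Diff_singleton)
  ultimately have "cmod (\<chi> x) = real (card (carrier G) - 1)" by (simp add: norm_of_nat del: of_nat_diff)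
  then have "card (carrier G) - 1 = 1" using linear_char_norm[OF _ x, of \<chi>] \<chi>(1) allin by (metis of_nat_1 of_nat_eq_iff)
  then show False using big by simp
qed

text \<open>The last character of a nonabelian group is nonlinear, and \<open>N = G'\<close> puts \<open>G'\<close> into the kernel of all the
  others. Conversely, the columns of \<open>1\<close> and of any nontrivial \<open>z \<in> G'\<close> agree on the linear characters.\<close>

theorem CD1_kernel_eq_derived_iff:
  "CD1_group G \<and> CD1_kernel G = derived_subgroup \<longleftrightarrow> (\<exists>\<chi>. nonlinear_chars = {\<chi>})"
proof
  assume cd: "CD1_group G \<and> CD1_kernel G = derived_subgroup"
  then obtain \<psi> where \<psi>: "\<psi> \<in> nonlinear_chars"
    using ex_nonlinear[OF CD1_group_nonabelian] by blast
  let ?L = "last_character G"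
  have ne: "Irr G \<noteq> {}" using \<psi> by (auto simp: nonlinear_chars_def)
  obtain d where d: "d \<ge> 2" "\<psi> \<one> = of_nat d" using nonlinear_degree[OF \<psi>] .
  have "Re (?L \<one>) \<ge> 2" using last_character_max(2)[OF ne, of \<psi>] \<psi> d by (simp add: nonlinear_chars_def)
  then have L: "?L \<in> nonlinear_chars"
    using last_character_max(1)[OF ne] by (auto simp: nonlinear_chars_def linear_chars_def)
  have "\<chi> = ?L" if \<chi>: "\<chi> \<in> nonlinear_chars" for \<chi>
  proof (rule ccontr)
    assume "\<chi> \<noteq> ?L"
    then have "CD1_kernel G \<subseteq> char_kernel G \<chi>"
      using \<chi> by (auto simp: CD1_kernel_def nonlinear_chars_def)
    then show False
      using cd \<chi> linear_iff_derived_in_kernel by (auto simp: nonlinear_chars_def linear_chars_def)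
  qed
  then show "\<exists>\<chi>. nonlinear_chars = {\<chi>}" using L by blast
next
  assume "\<exists>\<chi>. nonlinear_chars = {\<chi>}"
  then obtain \<chi> where un: "nonlinear_chars = {\<chi>}" by blast
  obtain d where d: "d \<ge> 2" "\<chi> \<one> = of_nat d" "d * d + derived_index = card (carrier G)"
    using degree_pattern_unique_nonlinear[OF un] by metis
  have \<chi>: "\<chi> \<in> Irr G" using un by (auto simp: nonlinear_chars_def)
  have lin: "\<psi> \<in> linear_chars" if "\<psi> \<in> Irr G" "\<psi> \<noteq> \<chi>" for \<psi>
    using that un unfolding nonlinear_chars_def by blast
  have ne: "Irr G \<noteq> {}" using \<chi> by blast
  obtain z where z: "z \<in> derived_subgroup" "z \<noteq> \<one>"
    using nonlinear_imp_derived_nontrivial[of \<chi>] un one_in_derived by blast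
  have zc: "z \<in> carrier G" using derived_sub_carrier[OF z(1)] .
  have "\<not> conjugate_in G \<one> z" using z by (auto simp: conjugate_in_def)
  moreover have "\<chi> \<one> \<noteq> \<chi> z"
  proof
    have e: "of_nat d * \<chi> z = - of_nat derived_index"
      using sum_nonlinear_chars[OF zc] un d(2) z by simp
    assume "\<chi> \<one> = \<chi> z"
    then have "\<chi> z = of_nat d" unfolding d(2) by (rule sym)
    from e[unfolded this] have "of_nat d * of_nat d = - (of_nat derived_index :: complex)" .
    then have "of_nat (d * d + derived_index) = (0 :: complex)"
      unfolding of_nat_add of_nat_mult by (metis add.left_inverse)
    then have "d * d + derived_index = 0" by (simp only: of_nat_eq_0_iff)
    then show False using d(1) by simp
  qed
  moreover have "\<psi> \<one> = \<psi> z" if "\<psi> \<in> Irr G - {\<chi>}" for \<psi>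
  proof -
    have "\<psi> \<in> linear_chars" using lin that by blast
    from linear_char_on_derived[OF this one_in_derived] linear_char_on_derived[OF this z(1)]
    show ?thesis by simp
  qed
  moreover have "card (carrier G) > 2"
  proof -
    have "2 * 2 \<le> d * d" using d(1) by (rule mult_le_mono[OF _ d(1)])
    then show ?thesis using d(3) by linarith
  qed
  ultimately have "CD1_group G"
    unfolding CD1_group_def Coset.order_def using \<chi> zc one_closed by blast
  moreover have "CD1_kernel G = derived_subgroup"
  proof -
    have "last_character G = \<chi>"
    proof (rule ccontr)
      assume "last_character G \<noteq> \<chi>"
      then have "last_character G \<one> = 1"
        using lin[OF last_character_max(1)[OF ne]] by (simp add: linear_chars_def)
      then show False using last_character_max(2)[OF ne \<chi>] d by simp
    qed
    then have L: "Irr G - {last_character G} = linear_chars"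
      using un linear_subset_Irr unfolding nonlinear_chars_def by blast
    show ?thesis unfolding CD1_kernel_def L
    proof (intro equalityI subsetI)
      fix x assume "x \<in> derived_subgroup"
      then show "x \<in> carrier G \<inter> (\<Inter>\<chi>\<in>linear_chars. char_kernel G \<chi>)"
        using derived_sub_carrier unfolding linear_chars_eq by blast
    next
      fix x assume x: "x \<in> carrier G \<inter> (\<Inter>\<chi>\<in>linear_chars. char_kernel G \<chi>)"
      then have "(\<Sum>\<psi>\<in>linear_chars. \<psi> x) = (\<Sum>\<psi>\<in>linear_chars. 1)"
        by (intro sum.cong) (auto simp: char_kernel_def linear_chars_def)
      also have "\<dots> \<noteq> 0" using card_linear_chars derived_index(2) by simp
      finally show "x \<in> derived_subgroup" using sum_linear_chars[of x] x by (auto split: if_splits)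
    qed
  qed
  ultimately show "CD1_group G \<and> CD1_kernel G = derived_subgroup" by blast
qed

lemma classes_iff_unique_nonlinear:
  "commutator_cosets_are_classes \<longleftrightarrow> (\<exists>\<chi>. nonlinear_chars = {\<chi>})"
  using unique_nonlinear_imp_classes classes_imp_unique_nonlinear by blast

end

section \<open>Extraspecial 2-groups and doubly transitive Frobenius groups\<close>

context finite_group
begin

lemma conj_class_subset_derived_coset:
  assumes g: "g \<in> carrier G"
  shows "conj_class g \<subseteq> {b \<in> carrier G. inv g \<otimes> b \<in> derived_subgroup}"
proof
  fix b assume "b \<in> conj_class g"
  then obtain x where x: "x \<in> carrier G" "b = x \<otimes> g \<otimes> inv x" by (auto simp: conj_class_def)
  have "inv g \<otimes> b = inv g \<otimes> x \<otimes> inv (inv g) \<otimes> inv x" using x g by (simp add: m_assoc)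
  then show "b \<in> {b \<in> carrier G. inv g \<otimes> b \<in> derived_subgroup}"
    using commutator_in_derived[of "inv g" x] x g by simp
qed

lemma center_normal: "center G \<lhd> G"
proof -
  have sub: "subgroup (center G) G"
  proof -
    have "center G = (\<Inter>a\<in>carrier G. centralizer a)"
      using one_closed unfolding center_def centralizer_def by blast
    moreover have "subgroup (\<Inter>(centralizer ` carrier G)) G"
      using one_closed by (intro subgroups_Inter) (auto intro: centralizer_subgroup)
    ultimately show ?thesis by simp
  qed
  moreover have "x \<otimes> h \<otimes> inv x \<in> center G" if "x \<in> carrier G" "h \<in> center G" for x h
  proof -
    have "x \<otimes> h \<otimes> inv x = h" using that by (subst conj_eq_iff) (auto simp: center_def)
    then show ?thesis using that by simp
  qed
  ultimately show ?thesis unfolding normal_inv_iff by blast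
qed

lemma card_two_elements:
  assumes "card A = 2" "x \<in> A" "z \<in> A" "x \<noteq> z" shows "A = {x, z}"
proof -
  have "finite A" using assms(1) card.infinite by fastforce
  then show ?thesis using assms card_subset_eq[of A "{x,z}"] by auto
qed

lemma extraspecial_2_derived:
  assumes ex: "extraspecial 2 G"
  shows "derived_subgroup = center G" "card derived_subgroup = 2"
proof -
  have Z: "card (center G) = 2" and com: "comm_group (G Mod center G)" and big: "Coset.order (G Mod center G) > 1"
    using ex by (auto simp: extraspecial_def elementary_abelian_def)
  have sub: "derived_subgroup \<subseteq> center G"
    by (rule derived_minimal[OF center_normal com])
  have ne: "derived_subgroup \<noteq> {\<one>}"
  proof
    assume D1: "derived_subgroup = {\<one>}"
    have "a \<otimes> b = b \<otimes> a" if a: "a \<in> carrier G" and b: "b \<in> carrier G" for a b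
    proof -
      have "a \<otimes> b \<otimes> inv a \<otimes> inv b = \<one>" using commutator_in_derived[OF a b] D1 by simp
      then show ?thesis by (rule commutator_eq_one[OF a b])
    qed
    then have "center G = carrier G" by (auto simp: center_def)
    then have "center G #> x = carrier G" if "x \<in> carrier G" for x
      using coset_join2[OF that subgroup_self] that by simp
    then have "carrier (G Mod center G) \<subseteq> {carrier G}" unfolding carrier_FactGroup by auto
    then have "card (carrier (G Mod center G)) \<le> card {carrier G}" by (intro card_mono) auto
    then show False using big by (simp add: Coset.order_def)
  qed
  then obtain z where "z \<in> derived_subgroup" "z \<noteq> \<one>" using one_in_derived by blast
  then have "center G = {\<one>, z}" using card_two_elements[OF Z] sub one_in_derived by blast
  then show "derived_subgroup = center G" using sub \<open>z \<in> _\<close> one_in_derived by auto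
  then show "card derived_subgroup = 2" using Z by simp
qed

text \<open>A coset of the center has two elements, and a noncentral element has a conjugate other than itself in
  its coset.\<close>

lemma extraspecial_2_classes:
  assumes ex: "extraspecial 2 G"
  shows "commutator_cosets_are_classes"
proof -
  note D = extraspecial_2_derived[OF ex]
  have "derived_subgroup \<noteq> {\<one>}" using D(2) by auto
  then obtain z where z1: "z \<in> derived_subgroup" "z \<noteq> \<one>" using one_in_derived by blast
  then have z: "derived_subgroup = {\<one>, z}" "z \<noteq> \<one>"
    using card_two_elements[OF D(2) one_in_derived z1(1)] by auto
  show ?thesis unfolding commutator_cosets_are_classes_def conjugate_in_iff
  proof (intro conjI ballI impI)
    show "derived_subgroup \<noteq> {\<one>}" using z by auto
    fix a b assume "a \<in> derived_subgroup - {\<one>}" "b \<in> derived_subgroup - {\<one>}"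
    then show "b \<in> conj_class a" using z derived_sub_carrier[of z] conj_class_self[of z] by auto
  next
    fix a b assume a: "a \<in> carrier G - derived_subgroup" and b: "b \<in> carrier G"
      and ab: "inv a \<otimes> b \<in> derived_subgroup"
    obtain x where x: "x \<in> carrier G" "x \<otimes> a \<noteq> a \<otimes> x" using a D(1) by (auto simp: center_def)
    define a' where "a' = x \<otimes> a \<otimes> inv x"
    have a': "a' \<in> conj_class a" "a' \<noteq> a"
      using x a conj_eq_iff[of x a a] by (auto simp: a'_def conj_class_def)
    let ?C = "{b \<in> carrier G. inv a \<otimes> b \<in> derived_subgroup}"
    have sub: "conj_class a \<subseteq> ?C" using conj_class_subset_derived_coset a by blast
    have C2: "card ?C = 2" using card_coset[OF derived_subgroup, of a] a D(2) by simp
    have aC: "a \<in> ?C" using a by simp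
    have a'C: "a' \<in> ?C" using sub a'(1) by (rule subsetD)
    have "?C = {a, a'}" by (rule card_two_elements[OF C2 aC a'C a'(2)[symmetric]])
    moreover have "b \<in> ?C" using b ab by simp
    ultimately have "b = a \<or> b = a'" by blast
    then show "b \<in> conj_class a" using a' conj_class_self[of a] a by blast
  qed
qed

lemma frobenius_complement_centralizer:
  assumes fc: "frobenius_complement G H" and h: "h \<in> H" "h \<noteq> \<one>"
  shows "centralizer h \<subseteq> H"
proof
  fix x assume x: "x \<in> centralizer h"
  have "subgroup H G" using fc by (simp add: frobenius_complement_def)
  then have hc: "h \<in> carrier G" using h(1) by (rule subgroup.mem_carrier)
  show "x \<in> H"
  proof (rule ccontr)
    assume nx: "x \<notin> H"
    have "x \<otimes> h \<otimes> inv x = h" using x hc by (subst conj_eq_iff) (auto simp: centralizer_def)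
    then have "h \<in> conjugate_subgroup G x H" using h(1) unfolding conjugate_subgroup_def by (metis imageI)
    then have "h \<in> H \<inter> conjugate_subgroup G x H" using h by simp
    also have "\<dots> = {\<one>}" using fc nx x by (auto simp: frobenius_complement_def centralizer_def)
    finally show False using h by simp
  qed
qed

text \<open>The centralizer of a nontrivial element of the complement \<open>H\<close> is \<open>H\<close>, and distinct elements of \<open>H\<close> are not
  conjugate. Counting the conjugates of these elements shows that the kernel \<open>F\<close> has \<open>k = \<bar>G : H\<bar>\<close>
  elements. For a nontrivial \<open>f \<in> F\<close>, the class lies in \<open>F - 1\<close> and the centralizer in \<open>F\<close>; as the product of their
  orders is \<open>\<bar>G\<bar> = (k - 1) k\<close>, both inclusions are equalities. So \<open>F\<close> is a normal subgroup with \<open>F - 1\<close> a class.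
  Since \<open>G/F\<close> is abelian and \<open>G\<close> is not, \<open>F\<close> is the commutator subgroup. Finally, an element
  outside \<open>F\<close> has \<open>k\<close> conjugates, which is the order of its coset.\<close>

lemma doubly_transitive_frobenius_structure:
  assumes dt: "doubly_transitive_frobenius G H" and ab: "\<And>x y. x \<in> H \<Longrightarrow> y \<in> H \<Longrightarrow> x \<otimes> y = y \<otimes> x"
  shows "card derived_subgroup = card H + 1" "card (carrier G) = card H * (card H + 1)"
    and "commutator_cosets_are_classes"
proof -
  have fc: "frobenius_complement G H" using dt by (simp add: doubly_transitive_frobenius_def)
  then have H: "subgroup H G" and H1: "H \<noteq> {\<one>}"
    and tri: "\<And>x. x \<in> carrier G - H \<Longrightarrow> H \<inter> conjugate_subgroup G x H = {\<one>}"
    by (auto simp: frobenius_complement_def)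
  note Hc = subgroup.mem_carrier[OF H]
  have finH: "finite H" using finite_subset[OF subgroup.subset[OF H]] by simp
  have oneH: "\<one> \<in> H" by (rule subgroup.one_closed[OF H])
  obtain h0 where h0: "h0 \<in> H" "h0 \<noteq> \<one>" using H1 oneH by blast
  define F where "F = frobenius_kernel G H"
  have F: "F \<subseteq> carrier G" by (auto simp: F_def frobenius_kernel_def)
  have finF: "finite F" using finite_subset[OF F] by simp
  have F1: "\<one> \<in> F" by (simp add: F_def frobenius_kernel_def)
  have Fmem: "g \<in> F \<longleftrightarrow> (g = \<one> \<or> (\<forall>h\<in>H. g \<notin> conj_class h))" if "g \<in> carrier G" for g
    using that by (auto simp: F_def frobenius_kernel_def conjugate_subgroup_def conj_class_def)
  have cent: "centralizer h = H" if "h \<in> H" "h \<noteq> \<one>" for h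
    using frobenius_complement_centralizer[OF fc that] ab that(1) Hc by (auto simp: centralizer_def)
  define k where "k = card (conj_class h0)"
  have Gk: "card (carrier G) = k * card H"
    using card_conj_class[of h0] cent h0 Hc by (simp add: k_def)
  have Hpos: "card H > 0" using finH oneH by (auto simp: card_gt_0_iff)
  have clk: "card (conj_class h) = k" if "h \<in> H" "h \<noteq> \<one>" for h
    using card_conj_class[of h] cent[OF that] that Hc Gk Hpos by simp
  have disj: "h = h'" if hh: "h \<in> H - {\<one>}" "h' \<in> H - {\<one>}" and meet: "conj_class h \<inter> conj_class h' \<noteq> {}" for h h'
  proof -
    have "conj_class h = conj_class h'" using meet conj_class_eq[of h] conj_class_eq[of h'] hh Hc by blast
    then have "h' \<in> conj_class h" using conj_class_self[of h'] hh Hc by simp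
    then obtain x where x: "x \<in> carrier G" "h' = x \<otimes> h \<otimes> inv x" by (auto simp: conj_class_def)
    have "x \<in> H"
    proof (rule ccontr)
      assume "x \<notin> H"
      then have "H \<inter> conjugate_subgroup G x H = {\<one>}" using tri x by blast
      moreover have "h' \<in> H \<inter> conjugate_subgroup G x H" using hh x by (auto simp: conjugate_subgroup_def)
      ultimately show False using hh by blast
    qed
    then have "x \<otimes> h = h \<otimes> x" using ab hh by blast
    then have "x \<otimes> h \<otimes> inv x = h" using x hh Hc by (subst conj_eq_iff) auto
    then show ?thesis using x by simp
  qed
  let ?U = "\<Union>h\<in>H - {\<one>}. conj_class h"
  have Ucard: "card ?U = (card H - 1) * k"
  proof -
    have "card ?U = (\<Sum>h\<in>H - {\<one>}. card (conj_class h))"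
    proof (rule card_UN_disjoint)
      show "\<forall>i\<in>H - {\<one>}. finite (conj_class i)"
        using conj_class_subset Hc finite_subset[OF _ finite_carrier] by (metis DiffD1)
      show "\<forall>i\<in>H - {\<one>}. \<forall>j\<in>H - {\<one>}. i \<noteq> j \<longrightarrow> conj_class i \<inter> conj_class j = {}"
        using disj by blast
    qed (use finH in simp)
    also have "\<dots> = (\<Sum>h\<in>H - {\<one>}. k)" using clk by (intro sum.cong) auto
    finally show ?thesis using finH oneH by simp
  qed
  have FU: "F = carrier G - ?U"
  proof
    show "F \<subseteq> carrier G - ?U"
    proof
      fix g assume g: "g \<in> F"
      then have gc: "g \<in> carrier G" using F by auto
      have "g \<notin> conj_class h" if "h \<in> H - {\<one>}" for h
      proof (cases "g = \<one>")
        case True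
        then show ?thesis using conj_eq_one_iff[of _ h] that Hc by (force simp: conj_class_def)
      next
        case False
        then show ?thesis using g Fmem[OF gc] that by blast
      qed
      then show "g \<in> carrier G - ?U" using gc by blast
    qed
    have "conj_class \<one> = {\<one>}" by (auto simp: conj_class_def)
    then show "carrier G - ?U \<subseteq> F" using Fmem by blast
  qed
  have U_sub: "?U \<subseteq> carrier G" using conj_class_subset Hc by blast
  have "card F = k * card H - (card H - 1) * k"
    unfolding FU using card_Diff_subset[OF finite_subset[OF U_sub finite_carrier] U_sub] Ucard Gk by simp
  also have "\<dots> = k"
    using Hpos by (cases "card H") auto
  finally have Fk: "card F = k" .
  have HF: "card H = k - 1" using dt Fk by (simp add: doubly_transitive_frobenius_def F_def)
  then have k2: "k = card H + 1" using Hpos by simp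
  \<comment> \<open>An element of a conjugate of \<open>H\<close> that commutes with \<open>f\<close> would put \<open>f\<close> into the same conjugate.\<close>
  have single: "centralizer f = F \<and> conj_class f = F - {\<one>}" if f: "f \<in> F" "f \<noteq> \<one>" for f
  proof -
    have fc': "f \<in> carrier G" using f F by auto
    have nU: "f \<notin> ?U" using f FU by blast
    have c1: "centralizer f \<subseteq> F"
    proof
      fix g assume g: "g \<in> centralizer f"
      then have gc: "g \<in> carrier G" by (simp add: centralizer_def)
      show "g \<in> F"
      proof (rule ccontr)
        assume "g \<notin> F"
        then obtain h where h: "h \<in> H - {\<one>}" "g \<in> conj_class h" using gc FU by blast
        then obtain x where x: "x \<in> carrier G" "g = x \<otimes> h \<otimes> inv x" by (auto simp: conj_class_def)
        have hc: "h \<in> carrier G" using h Hc by blast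
        define f' where "f' = inv x \<otimes> f \<otimes> x"
        have f'c: "f' \<in> carrier G" using x fc' by (simp add: f'_def)
        have ff': "f = x \<otimes> f' \<otimes> inv x" unfolding f'_def using x fc' by (simp add: m_assoc[symmetric]) (simp add: m_assoc)
        have "x \<otimes> (f' \<otimes> h) \<otimes> inv x = x \<otimes> (h \<otimes> f') \<otimes> inv x"
          using g x ff' hc f'c by (simp add: conj_mult centralizer_def)
        then have "f' \<otimes> h = h \<otimes> f'" using x hc f'c by simp
        then have "f' \<in> H" using cent[of h] h f'c by (auto simp: centralizer_def)
        moreover have "f' \<noteq> \<one>" using ff' x f by auto
        ultimately have "f \<in> ?U" using ff' x by (auto simp: conj_class_def)
        then show False using nU by blast
      qed
    qed
    have c2: "conj_class f \<subseteq> F - {\<one>}"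
    proof
      fix g assume g: "g \<in> conj_class f"
      then have gc: "g \<in> carrier G" using conj_class_subset[OF fc'] by blast
      have eq: "conj_class g = conj_class f" by (rule conj_class_eq[OF fc' g])
      have "g \<notin> ?U"
      proof
        assume "g \<in> ?U"
        then obtain h where h: "h \<in> H - {\<one>}" "g \<in> conj_class h" by blast
        then have "conj_class g = conj_class h" using Hc by (intro conj_class_eq) auto
        then have "f \<in> conj_class h" using eq conj_class_self[OF fc'] by simp
        then show False using nU h by blast
      qed
      moreover have "g \<noteq> \<one>" using g f fc' conj_eq_one_iff by (auto simp: conj_class_def)
      ultimately show "g \<in> F - {\<one>}" using gc FU by blast
    qed
    have le1: "card (centralizer f) \<le> k" using card_mono[OF finF c1] Fk by simp
    have finF1: "finite (F - {\<one>})" using finF by simp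
    have cF1: "card (F - {\<one>}) = k - 1" using finF F1 Fk by simp
    have le2: "card (conj_class f) \<le> k - 1" using card_mono[OF finF1 c2] cF1 by simp
    have prod: "card (conj_class f) * card (centralizer f) = (k - 1) * k"
      using card_conj_class[OF fc'] Gk HF by simp
    have kpos: "k > 0" "k - 1 > 0" using k2 Hpos by auto
    have "card (centralizer f) = k"
    proof (rule ccontr)
      assume "card (centralizer f) \<noteq> k"
      then have "card (centralizer f) < k" using le1 by simp
      then have "card (conj_class f) * card (centralizer f) \<le> (k - 1) * card (centralizer f)" using le2 by simp
      also have "\<dots> < (k - 1) * k" using \<open>card (centralizer f) < k\<close> kpos by simp
      finally show False using prod by simp
    qed
    moreover then have "card (conj_class f) = k - 1" using prod kpos by simp
    ultimately show ?thesis
      using card_subset_eq[OF finF c1] card_subset_eq[OF finF1 c2] Fk cF1 by simp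
  qed
  have k3: "k \<ge> 3"
  proof -
    have "card {\<one>, h0} \<le> card H" using finH h0 oneH by (intro card_mono) auto
    then show ?thesis using k2 h0 by simp
  qed
  have "F \<noteq> {\<one>}" using Fk k3 by auto
  then obtain f0 where f0: "f0 \<in> F" "f0 \<noteq> \<one>" using F1 by blast
  have f0c: "f0 \<in> carrier G" using f0 F by auto
  have Fsub: "subgroup F G" using centralizer_subgroup[OF f0c] single[OF f0] by simp
  have Fnorm: "F \<lhd> G" unfolding normal_inv_iff
  proof (intro conjI ballI)
    fix x h assume x: "x \<in> carrier G" and h: "h \<in> F"
    show "x \<otimes> h \<otimes> inv x \<in> F"
    proof (cases "h = \<one>")
      case False
      then show ?thesis using single[OF h False] x unfolding conj_class_def by blast
    qed (use x F1 in simp)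
  qed (rule Fsub)
  have FH: "F \<inter> H = {\<one>}"
    using FU F1 oneH conj_class_self Hc by (auto simp: subset_iff)
  have "derived_subgroup \<subseteq> F"
  proof (rule derived_minimal[OF Fnorm])
    have rep: "\<exists>h\<in>H. F #> a = F #> h" if a: "a \<in> carrier G" for a
    proof -
      obtain f h where fh: "f \<in> F" "h \<in> H" "a = f \<otimes> h"
        using product_of_subgroups[OF Fsub H FH _ a] Fk Gk by auto
      then have "F #> a = F #> h"
        using coset_mult_assoc[OF F, of f h] coset_join2[OF _ Fsub, of f] F Hc by (auto simp: subset_iff)
      then show ?thesis using fh by blast
    qed
    show "comm_group (G Mod F)"
    proof (rule group.group_comm_groupI[OF normal.factorgroup_is_group[OF Fnorm]])
      fix X Y assume "X \<in> carrier (G Mod F)" "Y \<in> carrier (G Mod F)"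
      then obtain a0 b0 where ab0: "a0 \<in> carrier G" "b0 \<in> carrier G" "X = F #> a0" "Y = F #> b0"
        unfolding carrier_FactGroup by blast
      obtain a where "a \<in> H" "F #> a0 = F #> a" using rep[OF ab0(1)] by blast
      moreover obtain b where "b \<in> H" "F #> b0 = F #> b" using rep[OF ab0(2)] by blast
      ultimately show "X \<otimes>\<^bsub>G Mod F\<^esub> Y = Y \<otimes>\<^bsub>G Mod F\<^esub> X"
        using ab0 normal.rcos_sum[OF Fnorm] Hc ab by simp
    qed
  qed
  moreover have "F \<subseteq> derived_subgroup"
  proof -
    define c where "c = f0 \<otimes> h0 \<otimes> inv f0 \<otimes> inv h0"
    have h0c: "h0 \<in> carrier G" using h0 Hc by blast
    have c: "c \<in> derived_subgroup" unfolding c_def by (rule commutator_in_derived[OF f0c h0c])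
    have "c \<noteq> \<one>"
    proof
      assume "c = \<one>"
      then have "f0 \<otimes> h0 = h0 \<otimes> f0" unfolding c_def by (rule commutator_eq_one[OF f0c h0c])
      then have "f0 \<in> H" using cent[OF h0] f0c by (auto simp: centralizer_def)
      then show False using f0 FH by blast
    qed
    moreover have "c \<in> F" using \<open>derived_subgroup \<subseteq> F\<close> c by blast
    ultimately have "conj_class c = F - {\<one>}" using single by blast
    moreover have "conj_class c \<subseteq> derived_subgroup"
      using normal.inv_op_closed2[OF derived_self_is_normal _ c] by (auto simp: conj_class_def)
    ultimately show ?thesis using one_in_derived by blast
  qed
  ultimately have DF: "derived_subgroup = F" by blast
  show "card derived_subgroup = card H + 1" "card (carrier G) = card H * (card H + 1)"
    using DF Fk k2 Gk by simp_all
  show "commutator_cosets_are_classes"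
    unfolding commutator_cosets_are_classes_def conjugate_in_iff DF
  proof (intro conjI ballI impI)
    show "F \<noteq> {\<one>}" by fact
    fix a b assume "a \<in> F - {\<one>}" "b \<in> F - {\<one>}"
    then show "b \<in> conj_class a" using single[of a] by simp
  next
    fix a b assume a: "a \<in> carrier G - F" and b: "b \<in> carrier G" and ab': "inv a \<otimes> b \<in> F"
    obtain h where h: "h \<in> H - {\<one>}" "a \<in> conj_class h" using a FU by blast
    then have "conj_class a = conj_class h" using Hc by (intro conj_class_eq) auto
    then have "card (conj_class a) = k" using clk h by simp
    moreover have "card {b \<in> carrier G. inv a \<otimes> b \<in> F} = k" using card_coset[OF Fsub, of a] a Fk by simp
    moreover have "conj_class a \<subseteq> {b \<in> carrier G. inv a \<otimes> b \<in> F}"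
      using conj_class_subset_derived_coset[of a] a DF by simp
    ultimately have "conj_class a = {b \<in> carrier G. inv a \<otimes> b \<in> F}" by (intro card_subset_eq) auto
    then show "b \<in> conj_class a" using b ab' by blast
  qed
qed

end

section \<open>Classification by the classes in cosets of the commutator subgroup\<close>

context finite_group
begin

text \<open>For a prime \<open>r \<noteq> p\<close> dividing the order, there would be a subgroup of order \<open>r\<close>, in which no nontrivial
  element has \<open>p\<close>-power order.\<close>

lemma prime_power_card:
  assumes K: "subgroup K G" and p: "Factorial_Ring.prime p"
    and pow: "\<And>x. x \<in> K \<Longrightarrow> \<exists>k. x [^] (p ^ k :: nat) = \<one>"
  shows "\<exists>a. card K = p ^ a"
proof -
  have fin: "finite K" using finite_subset[OF subgroup.subset[OF K]] by simp
  have pos: "card K > 0" using fin subgroup.one_closed[OF K] by (auto simp: card_gt_0_iff)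
  have "r = p" if r: "Factorial_Ring.prime r" "r dvd card K" for r
  proof (rule ccontr)
    assume rp: "r \<noteq> p"
    interpret K: group "G\<lparr>carrier := K\<rparr>" by (rule subgroup_imp_group[OF K])
    obtain m where "card K = r ^ 1 * m" using r(2) by auto
    then obtain R where R: "subgroup R (G\<lparr>carrier := K\<rparr>)" "card R = r"
      using sylow_thm[OF r(1) K.is_group, of 1 m] fin by (auto simp: Coset.order_def)
    have RG: "subgroup R G" using incl_subgroup[OF K R(1)] .
    have RK: "R \<subseteq> K" using subgroup.subset[OF R(1)] by simp
    have "R \<noteq> {\<one>}" using R(2) r(1) by (auto simp: prime_nat_iff)
    then obtain x where x: "x \<in> R" "x \<noteq> \<one>" using subgroup.one_closed[OF RG] by blast
    have xc: "x \<in> carrier G" using subgroup.mem_carrier[OF RG x(1)] .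
    interpret R: group "G\<lparr>carrier := R\<rparr>" by (rule subgroup_imp_group[OF RG])
    have "x [^] r = \<one>"
      using R.pow_order_eq_1[of x] x(1) R(2) by (simp add: Coset.order_def flip: nat_pow_consistent)
    then have 1: "ord x dvd r" using pow_eq_id[OF xc] by simp
    obtain k where "x [^] (p ^ k) = \<one>" using pow x RK by blast
    then have 2: "ord x dvd p ^ k" using pow_eq_id[OF xc] by simp
    have "coprime r (p ^ k)" using r(1) p rp by (simp add: primes_coprime)
    then have "ord x = 1" using 1 2 by (metis coprime_common_divisor_nat)
    then show False using x ord_eq_1[OF xc] by simp
  qed
  then have "\<exists>k. normalize (card K) = p ^ k"
    using Ex_other_prime_factor[OF _ _ p, of "card K"] pos by (auto simp: prime_factors_dvd)
  then show ?thesis by simp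
qed

text \<open>The classes of noncentral elements have order divisible by \<open>p\<close>, so \<open>p\<close> divides the order of the
  center.\<close>

lemma p_group_center_nontrivial:
  assumes p: "Factorial_Ring.prime p" and card: "card (carrier G) = p ^ n" and n: "n > 0"
  shows "\<exists>w\<in>carrier G. w \<noteq> \<one> \<and> centralizer w = carrier G"
proof -
  define Z where "Z = {w \<in> carrier G. centralizer w = carrier G}"
  have Zcl: "conj_class w = {w}" if "w \<in> Z" for w
  proof -
    have "x \<otimes> w \<otimes> inv x = w" if "x \<in> carrier G" for x
      using \<open>w \<in> Z\<close> that by (subst conj_eq_iff) (auto simp: Z_def centralizer_def)
    then show ?thesis using conj_class_self[of w] that by (auto simp: conj_class_def Z_def)
  qed
  have U: "\<Union>(conj_class ` (carrier G - Z)) = carrier G - Z"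
  proof
    show "\<Union>(conj_class ` (carrier G - Z)) \<subseteq> carrier G - Z"
    proof
      fix b assume "b \<in> \<Union>(conj_class ` (carrier G - Z))"
      then obtain a where a: "a \<in> carrier G" "a \<notin> Z" and b: "b \<in> conj_class a" by blast
      have "b \<notin> Z"
      proof
        assume "b \<in> Z"
        then have "a \<in> {b}" using Zcl conj_class_eq[OF a(1) b] conj_class_self[OF a(1)] by metis
        then show False using a \<open>b \<in> Z\<close> by simp
      qed
      then show "b \<in> carrier G - Z" using b conj_class_subset[OF a(1)] by blast
    qed
    show "carrier G - Z \<subseteq> \<Union>(conj_class ` (carrier G - Z))" using conj_class_self by blast
  qed
  have "p dvd card (\<Union>(conj_class ` (carrier G - Z)))"
  proof (rule dvd_partition)
    show "finite (\<Union>(conj_class ` (carrier G - Z)))" unfolding U by simp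
    show "\<forall>c\<in>conj_class ` (carrier G - Z). p dvd card c"
    proof clarify
      fix a assume a: "a \<in> carrier G" "a \<notin> Z"
      have prod: "card (conj_class a) * card (centralizer a) = p ^ n" using card_conj_class[OF a(1)] card by simp
      then have "card (conj_class a) dvd p ^ n" by (metis dvd_triv_left)
      then obtain i where i: "card (conj_class a) = p ^ i" using divides_primepow_nat[OF p] by blast
      have "i \<noteq> 0"
      proof
        assume "i = 0"
        then have "card (centralizer a) = card (carrier G)" using prod i card by simp
        moreover have "centralizer a \<subseteq> carrier G" by (auto simp: centralizer_def)
        ultimately have "centralizer a = carrier G" by (intro card_subset_eq) auto
        then show False using a by (simp add: Z_def)
      qed
      then show "p dvd card (conj_class a)" using i by simp
    qed
    show "\<forall>c1\<in>conj_class ` (carrier G - Z). \<forall>c2\<in>conj_class ` (carrier G - Z). c1 \<noteq> c2 \<longrightarrow> c1 \<inter> c2 = {}"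
      using conj_class_eq by blast
  qed
  then have "p dvd card (carrier G - Z)" unfolding U .
  moreover have "p dvd card (carrier G)" using card n by simp
  moreover have "card (carrier G) = card (carrier G - Z) + card Z"
  proof -
    have "Z \<subseteq> carrier G" by (auto simp: Z_def)
    then show ?thesis
      using card_Diff_subset[of Z "carrier G"] card_mono[of "carrier G" Z] finite_subset[of Z "carrier G"] by simp
  qed
  ultimately have "p dvd card Z" by (metis dvd_add_right_iff)
  then have "card Z \<noteq> 1" using p by auto
  then have "Z \<noteq> {\<one>}" by auto
  moreover have "\<one> \<in> Z" by (auto simp: Z_def centralizer_def)
  ultimately show ?thesis unfolding Z_def by blast
qed

text \<open>An abelian group acting regularly by conjugation on the nontrivial elements of an abelian group
  turns the latter into a field, and the multiplicative group of a finite field is cyclic.\<close>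

lemma regular_conjugation_cyclic:
  assumes D: "subgroup D G" and Dab: "\<And>x y. x \<in> D \<Longrightarrow> y \<in> D \<Longrightarrow> x \<otimes> y = y \<otimes> x"
    and H: "subgroup H G" and Hab: "\<And>x y. x \<in> H \<Longrightarrow> y \<in> H \<Longrightarrow> x \<otimes> y = y \<otimes> x"
    and act: "\<And>h u. h \<in> H \<Longrightarrow> u \<in> D \<Longrightarrow> h \<otimes> u \<otimes> inv h \<in> D"
    and v: "v \<in> D" "v \<noteq> \<one>" and reg: "bij_betw (\<lambda>h. h \<otimes> v \<otimes> inv h) H (D - {\<one>})"
  shows "cyclic_group (G\<lparr>carrier := H\<rparr>)"
proof -
  note Dc = subgroup.mem_carrier[OF D] and Hc = subgroup.mem_carrier[OF H]
  have finD: "finite D" using finite_subset[OF subgroup.subset[OF D]] by simp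
  define \<tau> where "\<tau> h = h \<otimes> v \<otimes> inv h" for h
  define \<eta> where "\<eta> = inv_into H \<tau>"
  have bij: "bij_betw \<tau> H (D - {\<one>})" using reg by (simp add: \<tau>_def[abs_def])
  have \<tau>D: "\<tau> h \<in> D" "\<tau> h \<noteq> \<one>" if "h \<in> H" for h using bij that by (auto simp: bij_betw_def)
  have \<eta>\<tau>: "\<eta> (\<tau> h) = h" if "h \<in> H" for h
    using bij that by (simp add: \<eta>_def bij_betw_def)
  have ex\<tau>: "\<exists>h\<in>H. u = \<tau> h" if "u \<in> D" "u \<noteq> \<one>" for u
    using bij that by (auto simp: bij_betw_def)
  define M where "M u w = (if u = \<one> then \<one> else \<eta> u \<otimes> w \<otimes> inv (\<eta> u))" for u w
  have M1: "M \<one> w = \<one>" for w by (simp add: M_def)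
  have M\<tau>: "M (\<tau> h) w = h \<otimes> w \<otimes> inv h" if "h \<in> H" for h w
    using \<tau>D[OF that] \<eta>\<tau>[OF that] by (simp add: M_def)
  have M2: "M u \<one> = \<one>" if uD: "u \<in> D" for u
  proof (cases "u = \<one>")
    case False
    then obtain h where "h \<in> H" "u = \<tau> h" using ex\<tau>[OF uD] by blast
    then show ?thesis using M\<tau> Hc by simp
  qed (simp add: M1)
  have M\<tau>\<tau>: "M (\<tau> h) (\<tau> k) = \<tau> (h \<otimes> k)" if "h \<in> H" "k \<in> H" for h k
    using that Hc Dc[OF v(1)] by (simp add: M\<tau> \<tau>_def[of k] \<tau>_def[of "h \<otimes> k"] conj_conj)
  have HH: "h \<otimes> k \<in> H" if "h \<in> H" "k \<in> H" for h k using subgroup.m_closed[OF H that] .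
  have Mcl: "M u w \<in> D" if uw: "u \<in> D" "w \<in> D" for u w
  proof (cases "u = \<one>")
    case True
    then show ?thesis using subgroup.one_closed[OF D] by (simp add: M1)
  next
    case False
    then obtain h where "h \<in> H" "u = \<tau> h" using ex\<tau>[OF uw(1)] by blast
    then show ?thesis using M\<tau> act uw by simp
  qed
  have Mcomm: "M u w = M w u" if u: "u \<in> D" and w: "w \<in> D" for u w
  proof (cases "u = \<one> \<or> w = \<one>")
    case True
    then show ?thesis using M1 M2 u w by auto
  next
    case False
    then obtain h k where "h \<in> H" "u = \<tau> h" "k \<in> H" "w = \<tau> k" using ex\<tau> u w by metis
    then show ?thesis using M\<tau>\<tau> Hab by simp
  qed
  have Massoc: "M (M u w) z = M u (M w z)" if u: "u \<in> D" and w: "w \<in> D" and z: "z \<in> D" for u w z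
  proof (cases "u = \<one> \<or> w = \<one> \<or> z = \<one>")
    case True
    then show ?thesis using M1 M2 u w z Mcl by auto
  next
    case False
    then obtain h k l where "h \<in> H" "u = \<tau> h" "k \<in> H" "w = \<tau> k" "l \<in> H" "z = \<tau> l" using ex\<tau> u w z by metis
    then show ?thesis using M\<tau>\<tau> HH Hc by (simp add: m_assoc)
  qed
  have Mdist: "M z (u \<otimes> w) = M z u \<otimes> M z w" if u: "u \<in> D" and w: "w \<in> D" and z: "z \<in> D" for u w z
  proof (cases "z = \<one>")
    case False
    then obtain h where "h \<in> H" "z = \<tau> h" using ex\<tau>[OF z] by blast
    then show ?thesis using M\<tau> Hc Dc u w by (simp add: conj_mult)
  qed (simp add: M1)
  have \<tau>1: "\<tau> \<one> = v" using Dc[OF v(1)] by (simp add: \<tau>_def)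
  have H1: "\<one> \<in> H" by (rule subgroup.one_closed[OF H])
  have Mv: "M v u = u" if "u \<in> D" for u
    using M\<tau>[OF H1, of u] Dc[OF that] by (simp add: \<tau>1)
  \<comment> \<open>The field has \<open>D\<close> as additive group. The bijection \<open>\<tau>\<close> identifies \<open>H\<close> with its nonzero elements, and
    the base point \<open>v\<close> becomes the unit.\<close>
  define R where "R = \<lparr>carrier = D, monoid.mult = M, one = v, zero = \<one>, add = (\<otimes>)\<rparr>"
  have Rs: "carrier R = D" "monoid.mult R = M" "one R = v" "zero R = \<one>" "add R = (\<otimes>)" by (simp_all add: R_def)
  have "abelian_group R"
  proof (rule abelian_groupI, unfold Rs)
    show "\<exists>y\<in>D. y \<otimes> x = \<one>" if "x \<in> D" for x
      using that Dc subgroup.m_inv_closed[OF D that] by (intro bexI[of _ "inv x"]) auto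
  qed (use Dc subgroup.m_closed[OF D] subgroup.one_closed[OF D] in \<open>auto simp: m_assoc intro: Dab\<close>)
  moreover have "Group.comm_monoid R"
    by (rule comm_monoidI, unfold Rs) (use Mcl Mcomm Massoc Mv v in auto)
  ultimately have "cring R"
  proof (rule cringI, unfold Rs)
    fix x y z assume "x \<in> D" "y \<in> D" "z \<in> D"
    then show "M (x \<otimes> y) z = M x z \<otimes> M y z"
      using Mdist[of x y z] Mcomm subgroup.m_closed[OF D] by simp
  qed
  then interpret R: cring R .
  have "field R"
  proof (rule R.cring_fieldI2, unfold Rs)
    show "\<one> \<noteq> v" using v by simp
    fix a assume "a \<in> D" "a \<noteq> \<one>"
    then obtain h where h: "h \<in> H" "a = \<tau> h" using ex\<tau> by blast
    have i: "inv h \<in> H" using subgroup.m_inv_closed[OF H h(1)] .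
    have "M a (\<tau> (inv h)) = v" using M\<tau>\<tau>[OF h(1) i] h Hc \<tau>1 by simp
    then show "\<exists>b\<in>D. M a b = v" using \<tau>D(1)[OF i] by blast
  qed
  then interpret F: field R .
  obtain a where a: "a \<in> D" "a \<noteq> \<one>" and gen: "D - {\<one>} = {a [^]\<^bsub>R\<^esub> i | i::nat. i \<in> UNIV}"
    using F.finite_field_mult_group_has_gen finD by (auto simp: Rs)
  obtain h where h: "h \<in> H" "a = \<tau> h" using ex\<tau>[OF a] by blast
  have powH: "h [^] i \<in> H" for i :: nat
    using H1 HH h(1) by (induction i) auto
  have pow: "a [^]\<^bsub>R\<^esub> i = \<tau> (h [^] i)" for i :: nat
    by (induction i) (use \<tau>1 M\<tau>\<tau> powH h in \<open>auto simp: Rs nat_pow_def\<close>)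
  interpret H: group "G\<lparr>carrier := H\<rparr>" by (rule subgroup_imp_group[OF H])
  have "k \<in> range (\<lambda>n::int. h [^]\<^bsub>G\<lparr>carrier := H\<rparr>\<^esub> n)" if k: "k \<in> H" for k
  proof -
    have "\<tau> k \<in> D - {\<one>}" using \<tau>D[OF k] by simp
    then obtain i :: nat where "\<tau> k = a [^]\<^bsub>R\<^esub> i" using gen by auto
    then have "\<tau> k = \<tau> (h [^] i)" using pow by simp
    then have "k = h [^] i" using \<eta>\<tau>[OF k] \<eta>\<tau>[OF powH] by metis
    also have "\<dots> = h [^]\<^bsub>G\<lparr>carrier := H\<rparr>\<^esub> int i"
      by (simp add: int_pow_int flip: nat_pow_consistent)
    finally show ?thesis by blast
  qed
  moreover have "h [^]\<^bsub>G\<lparr>carrier := H\<rparr>\<^esub> n \<in> H" for n :: int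
    using H.int_pow_closed[of h n] h by simp
  ultimately have "carrier (G\<lparr>carrier := H\<rparr>) = range (\<lambda>n::int. h [^]\<^bsub>G\<lparr>carrier := H\<rparr>\<^esub> n)" by auto
  then show ?thesis unfolding H.cyclic_group using h by auto
qed

lemma commutator_cosets_are_classesD:
  assumes cl: "commutator_cosets_are_classes"
  shows "z \<in> derived_subgroup \<Longrightarrow> z \<noteq> \<one> \<Longrightarrow> conj_class z = derived_subgroup - {\<one>}"
    and "g \<in> carrier G \<Longrightarrow> g \<notin> derived_subgroup \<Longrightarrow>
       conj_class g = {b \<in> carrier G. inv g \<otimes> b \<in> derived_subgroup}"
    and "g \<in> carrier G \<Longrightarrow> g \<notin> derived_subgroup \<Longrightarrow> card (conj_class g) = card derived_subgroup"
    and "g \<in> carrier G \<Longrightarrow> g \<notin> derived_subgroup \<Longrightarrow> card (centralizer g) = derived_index"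
proof -
  show "conj_class z = derived_subgroup - {\<one>}" if z: "z \<in> derived_subgroup" "z \<noteq> \<one>" for z
  proof
    show "conj_class z \<subseteq> derived_subgroup - {\<one>}"
      using normal.inv_op_closed2[OF derived_self_is_normal _ z(1)] conj_eq_one_iff[OF _ derived_sub_carrier[OF z(1)]] z(2)
      by (auto simp: conj_class_def)
    show "derived_subgroup - {\<one>} \<subseteq> conj_class z"
      using cl z unfolding commutator_cosets_are_classes_def conjugate_in_iff by blast
  qed
  show eq: "conj_class g = {b \<in> carrier G. inv g \<otimes> b \<in> derived_subgroup}"
    if g: "g \<in> carrier G" "g \<notin> derived_subgroup" for g
    using conj_class_subset_derived_coset[OF g(1)] cl g
    unfolding commutator_cosets_are_classes_def conjugate_in_iff by blast
  show card: "card (conj_class g) = card derived_subgroup"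
    if g: "g \<in> carrier G" "g \<notin> derived_subgroup" for g
    using eq[OF g] card_coset[OF derived_subgroup g(1)] by simp
  show "card (centralizer g) = derived_index" if g: "g \<in> carrier G" "g \<notin> derived_subgroup" for g
    using card_conj_class[OF g(1)] card[OF g] derived_index(1) card_derived_pos
    by (metis mult.commute mult_left_cancel less_irrefl)
qed

text \<open>Conjugate elements have the same order, which is a prime \<open>p\<close> because a power of one of them has prime
  order. The center of the \<open>p\<close>-group contains a nontrivial element, hence all of its conjugates.\<close>

lemma classes_derived_p_group:
  assumes cl: "commutator_cosets_are_classes"
  shows "\<exists>p n. Factorial_Ring.prime p \<and> n > 0 \<and> card derived_subgroup = p ^ n"
    and "\<And>x y. x \<in> derived_subgroup \<Longrightarrow> y \<in> derived_subgroup \<Longrightarrow> x \<otimes> y = y \<otimes> x"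
proof -
  let ?D = derived_subgroup
  note D = derived_subgroup
  obtain z where z: "z \<in> ?D" "z \<noteq> \<one>"
    using cl one_in_derived unfolding commutator_cosets_are_classes_def by blast
  have zc: "z \<in> carrier G" using derived_sub_carrier[OF z(1)] .
  have "ord z \<noteq> 1" using ord_eq_1[OF zc] z by simp
  then obtain p where p: "Factorial_Ring.prime p" "p dvd ord z" using prime_factor_nat by blast
  define y where "y = z [^] (ord z div p)"
  have yc: "y \<in> carrier G" using zc by (simp add: y_def)
  have yD: "y \<in> ?D"
  proof -
    have "z [^] i \<in> ?D" for i :: nat
      using z(1) one_in_derived subgroup.m_closed[OF D] by (induction i) auto
    then show ?thesis by (simp add: y_def)
  qed
  have ordz: "ord z > 0" using ord_ge_1[OF finite_carrier zc] by simp
  have y1: "y \<noteq> \<one>"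
  proof
    assume "y = \<one>"
    then have "ord z dvd ord z div p" using pow_eq_id[OF zc] by (simp add: y_def)
    moreover have "ord z div p > 0" using p ordz by (auto simp: div_greater_zero_iff prime_gt_0_nat dvd_imp_le)
    moreover have "ord z div p < ord z" using prime_gt_1_nat[OF p(1)] ordz by simp
    ultimately show False using dvd_imp_le by fastforce
  qed
  have yp: "y [^] p = \<one>" using zc p(2) by (simp add: y_def nat_pow_pow)
  have pow: "x [^] p = \<one>" if "x \<in> ?D" for x
  proof (cases "x = \<one>")
    case False
    then have "x \<in> conj_class y" using commutator_cosets_are_classesD(1)[OF cl yD y1] that by simp
    then show ?thesis using yc yp by (auto simp: conj_class_def conj_pow)
  qed simp
  have "\<exists>k. x [^] (p ^ k) = \<one>" if "x \<in> ?D" for x using pow[OF that] by (intro exI[of _ 1]) simp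
  from prime_power_card[OF D p(1) this] obtain n where n: "card ?D = p ^ n" by blast
  have n0: "n > 0"
  proof (rule ccontr)
    assume "\<not> n > 0"
    then have "card ?D = 1" using n by simp
    then obtain w where "?D = {w}" by (auto simp: card_1_singleton_iff)
    then show False using z one_in_derived by auto
  qed
  show "\<exists>p n. Factorial_Ring.prime p \<and> n > 0 \<and> card ?D = p ^ n" using p(1) n n0 by blast
  interpret D: finite_group "G\<lparr>carrier := ?D\<rparr>"
    using subgroup_imp_group[OF D] by (simp add: finite_group_def finite_group_axioms_def)
  obtain w where w: "w \<in> ?D" "w \<noteq> \<one>" "D.centralizer w = ?D"
    using D.p_group_center_nontrivial[OF p(1), of n] n n0 by auto
  have wc: "w \<in> carrier G" using derived_sub_carrier[OF w(1)] .
  have wcen: "u \<otimes> w = w \<otimes> u" if "u \<in> ?D" for u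
  proof -
    have "u \<in> D.centralizer w" using that w(3) by simp
    then show ?thesis by (simp add: D.centralizer_def)
  qed
  show "x \<otimes> y = y \<otimes> x" if x: "x \<in> ?D" and y: "y \<in> ?D" for x y
  proof (cases "x = \<one>")
    case True
    then show ?thesis using derived_sub_carrier[OF y] by simp
  next
    case False
    then have "x \<in> conj_class w" using commutator_cosets_are_classesD(1)[OF cl w(1,2)] x by simp
    then obtain g where g: "g \<in> carrier G" "x = g \<otimes> w \<otimes> inv g" by (auto simp: conj_class_def)
    define u where "u = inv g \<otimes> y \<otimes> g"
    have uD: "u \<in> ?D" unfolding u_def by (rule normal.inv_op_closed1[OF derived_self_is_normal g(1) y])
    have yc: "y \<in> carrier G" using derived_sub_carrier[OF y] .
    have yu: "y = g \<otimes> u \<otimes> inv g" unfolding u_def using g yc by (simp add: m_assoc[symmetric]) (simp add: m_assoc)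
    show ?thesis unfolding g(2) yu
      using wcen[OF uD] g(1) wc derived_sub_carrier[OF uD] by (simp flip: conj_mult)
  qed
qed

text \<open>With \<open>G' = {1, z}\<close>, conjugates of \<open>x\<close> are \<open>x\<close> and \<open>x z\<close>, whose squares agree. So squares are central,
  and \<open>G\<close> is a 2-group in which \<open>G/G'\<close> is elementary abelian.\<close>

lemma classes_derived_2_imp_extraspecial:
  assumes cl: "commutator_cosets_are_classes" and q: "card derived_subgroup = 2"
    and sq: "d \<ge> 2" "derived_index = d * d"
  shows "\<exists>m. extraspecial 2 G \<and> Coset.order G = 2 ^ (2 * m + 1) \<and> derived_index = 2 ^ (2 * m) \<and> d = 2 ^ m"
proof -
  let ?D = derived_subgroup
  obtain z where z: "z \<in> ?D" "z \<noteq> \<one>"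
    using cl one_in_derived unfolding commutator_cosets_are_classes_def by blast
  have zc: "z \<in> carrier G" using derived_sub_carrier[OF z(1)] .
  have Dz: "?D = {\<one>, z}" by (rule card_two_elements[OF q one_in_derived z(1)]) (use z in auto)
  have zcen: "x \<otimes> z = z \<otimes> x" if x: "x \<in> carrier G" for x
  proof -
    have "x \<otimes> z \<otimes> inv x \<in> conj_class z" using x by (auto simp: conj_class_def)
    then have "x \<otimes> z \<otimes> inv x = z" using commutator_cosets_are_classesD(1)[OF cl z] Dz by auto
    then show ?thesis using conj_eq_iff[OF x zc zc] by simp
  qed
  have center: "center G = ?D"
  proof
    show "?D \<subseteq> center G" unfolding Dz using zc zcen by (auto simp: center_def)
    show "center G \<subseteq> ?D"
    proof
      fix g assume g: "g \<in> center G"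
      then have gc: "g \<in> carrier G" by (simp add: center_def)
      have "x \<otimes> g \<otimes> inv x = g" if "x \<in> carrier G" for x
        using that g gc by (subst conj_eq_iff) (auto simp: center_def)
      then have "conj_class g \<subseteq> {g}" by (auto simp: conj_class_def)
      then have "card (conj_class g) \<le> 1" using card_mono[of "{g}" "conj_class g"] by simp
      then show "g \<in> ?D" using commutator_cosets_are_classesD(3)[OF cl gc] q by linarith
    qed
  qed
  have zz: "z \<otimes> z = \<one>"
  proof -
    have "z \<otimes> z \<in> {\<one>, z}" using subgroup.m_closed[OF derived_subgroup z(1) z(1)] Dz by simp
    then show ?thesis using zc z by auto
  qed
  have square: "x \<otimes> x \<in> center G" if x: "x \<in> carrier G" for x
  proof -
    have "y \<otimes> (x \<otimes> x) \<otimes> inv y = x \<otimes> x" if y: "y \<in> carrier G" for y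
    proof -
      have "y \<otimes> x \<otimes> inv y \<in> conj_class x" using y by (auto simp: conj_class_def)
      then have "inv x \<otimes> (y \<otimes> x \<otimes> inv y) \<in> {\<one>, z}" using conj_class_subset_derived_coset[OF x] Dz by blast
      moreover have "y \<otimes> x \<otimes> inv y = x \<otimes> (inv x \<otimes> (y \<otimes> x \<otimes> inv y))" using x y by (simp add: m_assoc[symmetric])
      ultimately have "y \<otimes> x \<otimes> inv y = x \<or> y \<otimes> x \<otimes> inv y = x \<otimes> z" using x by auto
      moreover have "(x \<otimes> z) \<otimes> (x \<otimes> z) = x \<otimes> x"
      proof -
        have "(x \<otimes> z) \<otimes> (x \<otimes> z) = (x \<otimes> z) \<otimes> (z \<otimes> x)" using zcen[OF x] by simp
        also have "\<dots> = x \<otimes> (z \<otimes> z) \<otimes> x" using x zc by (simp add: m_assoc)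
        also have "\<dots> = x \<otimes> x" using x zz by simp
        finally show ?thesis .
      qed
      ultimately show ?thesis using x y by (auto simp: conj_mult)
    qed
    then show ?thesis using x conj_eq_iff[of _ "x \<otimes> x" "x \<otimes> x"] by (simp add: center_def)
  qed
  have "\<exists>k. x [^] (2 ^ k :: nat) = \<one>" if x: "x \<in> carrier G" for x
  proof (intro exI[of _ 2])
    have "x \<otimes> x \<in> {\<one>, z}" using square[OF x] center Dz by simp
    then have "(x \<otimes> x) \<otimes> (x \<otimes> x) = \<one>" using zz by auto
    then show "x [^] (2 ^ 2 :: nat) = \<one>" using x by (simp add: numeral_eq_Suc m_assoc)
  qed
  from prime_power_card[OF subgroup_self two_is_prime_nat this]
  obtain k where k: "card (carrier G) = 2 ^ k" by blast
  have c2: "derived_index * 2 = 2 ^ k" using derived_index(1) q k by simp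
  have "d dvd 2 ^ k" using c2 sq(2) by (metis dvd_triv_left mult.assoc)
  then obtain m where m: "d = 2 ^ m" using divides_primepow_nat[OF two_is_prime_nat] by blast
  have c: "derived_index = 2 ^ (2 * m)" using sq(2) m by (simp add: mult_2 power_add)
  have order: "Coset.order G = 2 ^ (2 * m + 1)" using c derived_index(1) q by (simp add: Coset.order_def)
  have "elementary_abelian 2 (G Mod center G)"
    unfolding elementary_abelian_def
  proof (intro conjI ballI)
    show "comm_group (G Mod center G)" unfolding center by (rule derived_quot_is_comm_group)
    fix X assume "X \<in> carrier (G Mod center G)"
    then obtain x where x: "x \<in> carrier G" "X = center G #> x" unfolding carrier_FactGroup by blast
    have "X [^]\<^bsub>G Mod center G\<^esub> (2::nat) = center G #> (x [^] (2::nat))"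
      using normal.FactGroup_pow[OF center_normal x(1)] x(2) by simp
    also have "x [^] (2::nat) = x \<otimes> x" using x by (simp add: numeral_eq_Suc)
    also have "center G #> (x \<otimes> x) = center G"
      using coset_join2[OF _ normal_imp_subgroup[OF center_normal] square[OF x(1)]] x by simp
    finally show "X [^]\<^bsub>G Mod center G\<^esub> (2::nat) = \<one>\<^bsub>G Mod center G\<^esub>" by simp
  qed
  moreover have "Coset.order (G Mod center G) > 1"
  proof -
    have "card (rcosets (center G)) * card (center G) = card (carrier G)"
      using lagrange[OF normal_imp_subgroup[OF center_normal]] by (simp add: Coset.order_def)
    then have "card (rcosets (center G)) = derived_index"
      using center q derived_index(1) by (metis mult_right_cancel zero_neq_numeral)
    moreover have "derived_index > 1"
      using sq mult_le_mono[OF sq(1) sq(1)] by simp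
    ultimately show ?thesis by (simp add: Coset.order_def FactGroup_def)
  qed
  moreover have "group G" by (rule is_group)
  moreover have "\<exists>k. Coset.order G = 2 ^ k" using order by blast
  ultimately have "extraspecial 2 G"
    unfolding extraspecial_def using center q two_is_prime_nat by simp
  then show ?thesis using order c m by blast
qed

text \<open>An element that commutes with one nontrivial element of \<open>G'\<close> centralizes \<open>G'\<close>. As the center is
  trivial, some \<open>x\<close> outside \<open>G'\<close> does not centralize \<open>G'\<close>, and its centralizer \<open>H\<close> is the complement. The
  nontrivial elements of \<open>H\<close> have centralizers of order \<open>\<bar>H\<bar>\<close>, so equal to \<open>H\<close>. None of them centralizes \<open>G'\<close>,
  as it would be central; so a nontrivial \<open>v \<in> G'\<close> has centralizer \<open>G'\<close>, hence as many conjugates as \<open>H\<close>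
  has elements.\<close>

lemma classes_imp_doubly_transitive_frobenius:
  assumes cl: "commutator_cosets_are_classes" and q: "card derived_subgroup \<noteq> 2"
  shows "\<exists>H. doubly_transitive_frobenius G H \<and> cyclic_group (G\<lparr>carrier := H\<rparr>)"
    and "derived_index = card derived_subgroup - 1"
proof -
  let ?D = derived_subgroup
  note D = derived_subgroup and Dc = derived_sub_carrier
  note Dnorm = derived_self_is_normal
  note Dab = classes_derived_p_group(2)[OF cl]
  obtain v where v: "v \<in> ?D" "v \<noteq> \<one>"
    using cl one_in_derived unfolding commutator_cosets_are_classes_def by blast
  have vc: "v \<in> carrier G" using Dc[OF v(1)] .
  have q3: "card ?D \<ge> 3"
  proof -
    have "card {\<one>, v} \<le> card ?D" using v by (intro card_mono) auto
    then show ?thesis using v q by simp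
  qed
  have center: "z = \<one>" if z: "z \<in> carrier G" and c: "centralizer z = carrier G" for z
  proof (rule ccontr)
    assume z1: "z \<noteq> \<one>"
    have "x \<otimes> z \<otimes> inv x = z" if "x \<in> carrier G" for x
      using that z c by (subst conj_eq_iff) (auto simp: centralizer_def)
    then have "conj_class z \<subseteq> {z}" by (auto simp: conj_class_def)
    then have le: "card (conj_class z) \<le> 1" using card_mono[of "{z}" "conj_class z"] by simp
    show False
    proof (cases "z \<in> ?D")
      case True
      then have "card (conj_class z) = card ?D - 1" using commutator_cosets_are_classesD(1)[OF cl True z1] by simp
      then show False using le q3 by simp
    next
      case False
      then show False using commutator_cosets_are_classesD(3)[OF cl z] le q3 by simp
    qed
  qed
  \<comment> \<open>Conjugation by \<open>x\<close> changes \<open>g\<close> only by a factor \<open>f \<in> G'\<close>, and \<open>f\<close> commutes with \<open>w\<close> because \<open>G'\<close> is abelian;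
    so \<open>g\<close> commutes with the conjugates of \<open>w\<close> as well.\<close>
  have fixed: "?D \<subseteq> centralizer g" if g: "g \<in> carrier G" and w: "w \<in> ?D" "w \<noteq> \<one>" "g \<otimes> w = w \<otimes> g" for g w
  proof
    fix u assume u: "u \<in> ?D"
    have uc: "u \<in> carrier G" and wc: "w \<in> carrier G" using Dc u w by auto
    show "u \<in> centralizer g"
    proof (cases "u = \<one>")
      case True
      then show ?thesis using g by (simp add: centralizer_def)
    next
      case False
      then have "u \<in> conj_class w" using commutator_cosets_are_classesD(1)[OF cl w(1,2)] u by simp
      then obtain x where x: "x \<in> carrier G" "u = x \<otimes> w \<otimes> inv x" by (auto simp: conj_class_def)
      define f where "f = inv g \<otimes> (inv x \<otimes> g \<otimes> x)"
      have fD: "f \<in> ?D"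
      proof -
        have "f = inv g \<otimes> inv x \<otimes> inv (inv g) \<otimes> inv (inv x)" unfolding f_def using g x by (simp add: m_assoc)
        then show ?thesis using commutator_in_derived[of "inv g" "inv x"] g x by simp
      qed
      have fc: "f \<in> carrier G" using Dc[OF fD] .
      have gx: "inv x \<otimes> g \<otimes> x = g \<otimes> f" unfolding f_def using g x by (simp add: m_assoc[symmetric])
      have gx': "g = x \<otimes> (g \<otimes> f) \<otimes> inv x" unfolding gx[symmetric] using g x by (simp add: m_assoc[symmetric]) (simp add: m_assoc)
      have comm: "(g \<otimes> f) \<otimes> w = w \<otimes> (g \<otimes> f)"
        using Dab[OF fD w(1)] w(3) g fc wc by (metis m_assoc)
      have "g \<otimes> u = x \<otimes> ((g \<otimes> f) \<otimes> w) \<otimes> inv x"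
        unfolding x(2) using g fc wc x(1) by (subst (1) gx') (simp add: conj_mult)
      also have "\<dots> = u \<otimes> g"
        unfolding comm x(2) using g fc wc x(1) by (subst (2) gx') (simp add: conj_mult)
      finally show ?thesis using uc by (simp add: centralizer_def)
    qed
  qed
  have "\<exists>x\<in>carrier G. x \<notin> ?D \<and> \<not> ?D \<subseteq> centralizer x"
  proof (rule ccontr)
    assume "\<not> ?thesis"
    then have all: "?D \<subseteq> centralizer g" if "g \<in> carrier G" "g \<notin> ?D" for g using that by blast
    have "centralizer v = carrier G"
    proof (intro equalityI subsetI)
      fix g assume g: "g \<in> carrier G"
      show "g \<in> centralizer v"
      proof (cases "g \<in> ?D")
        case True
        then show ?thesis using Dab[OF True v(1)] g by (simp add: centralizer_def)
      next
        case False
        then show ?thesis using all[OF g False] v(1) g by (auto simp: centralizer_def)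
      qed
    qed (simp add: centralizer_def)
    then show False using center[OF vc] v by simp
  qed
  then obtain x where x: "x \<in> carrier G" "x \<notin> ?D" "\<not> ?D \<subseteq> centralizer x" by blast
  define H where "H = centralizer x"
  have H: "subgroup H G" unfolding H_def by (rule centralizer_subgroup[OF x(1)])
  note Hc = subgroup.mem_carrier[OF H]
  have finH: "finite H" using finite_subset[OF subgroup.subset[OF H]] by simp
  have oneH: "\<one> \<in> H" by (rule subgroup.one_closed[OF H])
  have cardH: "card H = derived_index" unfolding H_def by (rule commutator_cosets_are_classesD(4)[OF cl x(1,2)])
  have HD: "h = \<one>" if h: "h \<in> H" "h \<in> ?D" for h
  proof (rule ccontr)
    assume "h \<noteq> \<one>"
    moreover have "x \<otimes> h = h \<otimes> x" using h(1) by (simp add: H_def centralizer_def)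
    ultimately have "?D \<subseteq> centralizer x" using fixed[OF x(1) h(2)] by blast
    with x(3) show False ..
  qed
  have HDi: "H \<inter> ?D = {\<one>}" using HD oneH one_in_derived by blast
  have prod: "\<exists>h\<in>H. \<exists>d\<in>?D. g = h \<otimes> d" if g: "g \<in> carrier G" for g
    using product_of_subgroups[OF H D HDi _ g] cardH derived_index(1) by metis
  have Hab: "h \<otimes> k = k \<otimes> h" if h: "h \<in> H" and k: "k \<in> H" for h k
  proof -
    have "h \<otimes> k \<otimes> inv h \<otimes> inv k \<in> H"
      using h k subgroup.m_closed[OF H] subgroup.m_inv_closed[OF H] by simp
    then have "h \<otimes> k \<otimes> inv h \<otimes> inv k = \<one>" using HD commutator_in_derived Hc h k by simp
    then show ?thesis by (rule commutator_eq_one[OF Hc[OF h] Hc[OF k]])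
  qed
  have nofix: "h = \<one>" if h: "h \<in> H" and all: "?D \<subseteq> centralizer h" for h
  proof (rule center[OF Hc[OF h]], intro equalityI subsetI)
    fix g assume "g \<in> carrier G"
    then obtain k d where kd: "k \<in> H" "d \<in> ?D" "g = k \<otimes> d" using prod by blast
    have dh: "d \<in> centralizer h" using all kd by blast
    have kh: "k \<in> centralizer h" using Hab[OF kd(1) h] Hc[OF kd(1)] by (simp add: centralizer_def)
    show "g \<in> centralizer h" unfolding kd(3)
      by (rule subgroup.m_closed[OF centralizer_subgroup[OF Hc[OF h]] kh dh])
  qed (simp add: centralizer_def)
  have centH: "centralizer h = H" if h: "h \<in> H" "h \<noteq> \<one>" for h
  proof -
    have "h \<notin> ?D" using HD h by blast
    then have "card (centralizer h) = card H" using commutator_cosets_are_classesD(4)[OF cl Hc[OF h(1)]] cardH by simp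
    moreover have "H \<subseteq> centralizer h" using Hab h Hc by (auto simp: centralizer_def)
    moreover have "finite (centralizer h)" by (simp add: centralizer_def)
    ultimately show ?thesis by (metis card_subset_eq)
  qed
  have centv: "centralizer v = ?D"
  proof
    show "?D \<subseteq> centralizer v" using Dab v Dc by (auto simp: centralizer_def)
    show "centralizer v \<subseteq> ?D"
    proof
      fix g assume g: "g \<in> centralizer v"
      then have gc: "g \<in> carrier G" "g \<otimes> v = v \<otimes> g" by (auto simp: centralizer_def)
      obtain h d where hd: "h \<in> H" "d \<in> ?D" "g = h \<otimes> d" using prod[OF gc(1)] by blast
      have hc: "h \<in> carrier G" and dc: "d \<in> carrier G" using Hc Dc hd by auto
      have "h = g \<otimes> inv d" unfolding hd(3) using hc dc by (simp add: m_assoc)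
      moreover have "inv d \<in> centralizer v" using \<open>?D \<subseteq> centralizer v\<close> subgroup.m_inv_closed[OF D hd(2)] by blast
      ultimately have "h \<in> centralizer v" using g subgroup.m_closed[OF centralizer_subgroup[OF vc]] by simp
      then have "?D \<subseteq> centralizer h" by (intro fixed[OF hc v]) (simp add: centralizer_def)
      then have "h = \<one>" by (rule nofix[OF hd(1)])
      then show "g \<in> ?D" using hd dc by simp
    qed
  qed
  have "card (conj_class v) = card ?D - 1" using commutator_cosets_are_classesD(1)[OF cl v] by simp
  then have "(card ?D - 1) * card ?D = card (carrier G)" using card_conj_class[OF vc] centv by simp
  then show index: "derived_index = card ?D - 1" using derived_index(1) card_derived_pos
    by (metis mult_right_cancel less_irrefl)
  have Hgt: "card H \<ge> 2" using cardH index q3 by simp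
  have fc: "frobenius_complement G H" unfolding frobenius_complement_def
  proof (intro conjI ballI)
    show "subgroup H G" by (rule H)
    show "H \<noteq> {\<one>}" using Hgt by auto
    show "H \<noteq> carrier G" using HD v vc by blast
    fix y assume y: "y \<in> carrier G - H"
    have "h = \<one>" if h: "h \<in> H" "h \<in> conjugate_subgroup G y H" for h
    proof (rule ccontr)
      assume h1: "h \<noteq> \<one>"
      obtain k where k: "k \<in> H" "h = y \<otimes> k \<otimes> inv y" using h by (auto simp: conjugate_subgroup_def)
      have "inv k \<otimes> h \<in> ?D" using conj_class_subset_derived_coset[OF Hc[OF k(1)]] k y by (auto simp: conj_class_def)
      moreover have "inv k \<otimes> h \<in> H" using h k subgroup.m_closed[OF H] subgroup.m_inv_closed[OF H] by simp
      ultimately have "inv k \<otimes> h = \<one>" using HD by blast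
      then have hk: "h = k" using Hc[OF h(1)] Hc[OF k(1)] by (metis inv_equality inv_inv inv_closed inv_comm)
      have "y \<otimes> k = k \<otimes> y" using k hk y Hc conj_eq_iff[of y k k] by simp
      then have "y \<in> centralizer k" using y by (simp add: centralizer_def)
      then have "y \<in> H" using centH[of k] k h1 hk by simp
      then show False using y by simp
    qed
    moreover have "\<one> \<in> conjugate_subgroup G y H"
      using oneH y unfolding conjugate_subgroup_def by (intro image_eqI[of _ _ \<one>]) auto
    ultimately show "H \<inter> conjugate_subgroup G y H = {\<one>}" using oneH by blast
  qed
  have "frobenius_kernel G H = ?D"
  proof (intro equalityI subsetI)
    fix g assume g: "g \<in> frobenius_kernel G H"
    show "g \<in> ?D"
    proof (rule ccontr)
      assume nD: "g \<notin> ?D"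
      then have g1: "g \<noteq> \<one>" by auto
      then have gc: "g \<in> carrier G" and no: "\<And>y. y \<in> carrier G \<Longrightarrow> g \<notin> conjugate_subgroup G y H"
        using g by (auto simp: frobenius_kernel_def)
      obtain h d where hd: "h \<in> H" "d \<in> ?D" "g = h \<otimes> d" using prod[OF gc] by blast
      have hc: "h \<in> carrier G" and dc: "d \<in> carrier G" using Hc Dc hd by auto
      have "h \<notin> ?D" using nD hd subgroup.m_closed[OF D] by blast
      moreover have "inv h \<otimes> g \<in> ?D" unfolding hd(3) using hd(2) hc dc by (simp add: m_assoc[symmetric])
      ultimately have "g \<in> conj_class h" using commutator_cosets_are_classesD(2)[OF cl hc] gc by simp
      then show False using no hd(1) by (auto simp: conj_class_def conjugate_subgroup_def)
    qed
  next
    fix g assume g: "g \<in> ?D"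
    show "g \<in> frobenius_kernel G H"
    proof (cases "g = \<one>")
      case False
      have "g \<notin> conjugate_subgroup G y H" if y: "y \<in> carrier G" for y
      proof
        assume "g \<in> conjugate_subgroup G y H"
        then obtain h where h: "h \<in> H" "g = y \<otimes> h \<otimes> inv y" by (auto simp: conjugate_subgroup_def)
        have "h \<in> ?D" using normal_indicator_class[OF Dnorm y Hc[OF h(1)]] g h by simp
        then have "h = \<one>" using HD h by blast
        then show False using h y False by simp
      qed
      then show ?thesis using Dc[OF g] by (auto simp: frobenius_kernel_def)
    qed (simp add: frobenius_kernel_def)
  qed
  then have dt: "doubly_transitive_frobenius G H"
    unfolding doubly_transitive_frobenius_def using fc cardH index by simp
  have "bij_betw (\<lambda>h. h \<otimes> v \<otimes> inv h) H (?D - {\<one>})"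
  proof -
    let ?f = "\<lambda>h. h \<otimes> v \<otimes> inv h"
    have "H \<inter> centralizer v = {\<one>}" using centv HDi by simp
    then have cimg: "card (?f ` H) = card H" using card_conj_orbit[OF H vc] by simp
    then have inj: "inj_on ?f H" using finH by (simp add: eq_card_imp_inj_on)
    have "?f ` H \<subseteq> conj_class v" using Hc by (auto simp: conj_class_def)
    then have sub: "?f ` H \<subseteq> ?D - {\<one>}" using commutator_cosets_are_classesD(1)[OF cl v] by simp
    have "?f ` H = ?D - {\<one>}" by (rule card_subset_eq[OF _ sub]) (use cimg cardH index in simp_all)
    then show ?thesis using inj by (simp add: bij_betw_def)
  qed
  moreover have "h \<otimes> u \<otimes> inv h \<in> ?D" if "h \<in> H" "u \<in> ?D" for h u
    using normal.inv_op_closed2[OF Dnorm Hc[OF that(1)] that(2)] .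
  ultimately have "cyclic_group (G\<lparr>carrier := H\<rparr>)"
    by (intro regular_conjugation_cyclic[OF D _ H _ _ v]) (use Dab Hab in auto)
  then show "\<exists>H. doubly_transitive_frobenius G H \<and> cyclic_group (G\<lparr>carrier := H\<rparr>)" using dt by blast
qed

end

lemma mult_pred_inj:
  fixes a b :: nat
  assumes "a * (a + 1) = (b - 1) * b" "a > 0"
  shows "b = a + 1"
proof -
  have b: "b > 1"
  proof (rule ccontr)
    assume "\<not> b > 1"
    then have "b - 1 = 0" by simp
    then show False using assms by simp
  qed
  have "\<not> b < a + 1"
  proof
    assume "b < a + 1"
    then have "(b - 1) * b < a * (a + 1)" using b by (intro mult_strict_mono) auto
    then show False using assms by simp
  qed
  moreover have "\<not> b > a + 1"
  proof
    assume "b > a + 1"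
    then have "a * (a + 1) < (b - 1) * b" by (intro mult_strict_mono) auto
    then show False using assms by simp
  qed
  ultimately show ?thesis by simp
qed

theorem proposition2p7:
  fixes G :: "('a, 'b) monoid_scheme"
  assumes "group G" and "finite (carrier G)"
  shows
    "(CD1_group G \<and> CD1_kernel G = derived G (carrier G) \<longleftrightarrow>
        (\<exists>m::nat. extraspecial 2 G \<and> Coset.order G = 2 ^ (2 * m + 1) \<and>
           degree_pattern G = replicate_mset (2 ^ (2 * m)) 1 + {#of_nat (2 ^ m)#}) \<or>
        (\<exists>(p::nat) (n::nat) H. Factorial_Ring.prime p \<and> n > 0 \<and>
           doubly_transitive_frobenius G H \<and> cyclic_group (G\<lparr>carrier := H\<rparr>) \<and>
           Coset.order G = (p ^ n - 1) * p ^ n \<and>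
           degree_pattern G = replicate_mset (p ^ n - 1) 1 + {#of_nat (p ^ n - 1)#})) \<and>
     (\<forall>m::nat. extraspecial 2 G \<and> Coset.order G = 2 ^ (2 * m + 1) \<longrightarrow>
        degree_pattern G = replicate_mset (2 ^ (2 * m)) 1 + {#of_nat (2 ^ m)#}) \<and>
     (\<forall>(p::nat) (n::nat) H. Factorial_Ring.prime p \<and> n > 0 \<and>
        doubly_transitive_frobenius G H \<and> cyclic_group (G\<lparr>carrier := H\<rparr>) \<and>
        Coset.order G = (p ^ n - 1) * p ^ n \<longrightarrow>
        degree_pattern G = replicate_mset (p ^ n - 1) 1 + {#of_nat (p ^ n - 1)#})"
proof -
  interpret finite_group G using assms by (simp add: finite_group_def finite_group_axioms_def)
  let ?C = "CD1_group G \<and> CD1_kernel G = derived G (carrier G)"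
  let ?cl = commutator_cosets_are_classes
  let ?A = "\<lambda>m. extraspecial 2 G \<and> Coset.order G = 2 ^ (2 * m + 1)"
  let ?B = "\<lambda>(p::nat) (n::nat) H. Factorial_Ring.prime p \<and> n > 0 \<and>
        doubly_transitive_frobenius G H \<and> cyclic_group (G\<lparr>carrier := H\<rparr>) \<and>
        Coset.order G = (p ^ n - 1) * p ^ n"
  let ?PA = "\<lambda>m. degree_pattern G = replicate_mset (2 ^ (2 * m)) 1 + {#of_nat (2 ^ m)#}"
  let ?PB = "\<lambda>(p::nat) (n::nat). degree_pattern G = replicate_mset (p ^ n - 1) 1 + {#of_nat (p ^ n - 1)#}"
  have C_iff: "?C \<longleftrightarrow> ?cl" using CD1_kernel_eq_derived_iff classes_iff_unique_nonlinear by simp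
  have pattern: "\<exists>d. d \<ge> 2 \<and> d * d = derived_index * (card derived_subgroup - 1) \<and>
      degree_pattern G = replicate_mset derived_index 1 + {#of_nat d#}" if cl: ?cl
  proof -
    obtain \<chi> where "nonlinear_chars = {\<chi>}" using classes_imp_unique_nonlinear[OF cl] by blast
    then obtain d where d: "d \<ge> 2" "d * d + derived_index = card (carrier G)"
      "degree_pattern G = replicate_mset derived_index 1 + {#of_nat d#}"
      using degree_pattern_unique_nonlinear by metis
    have "d * d = derived_index * (card derived_subgroup - 1)"
      using d(2) derived_index(1) by (simp add: diff_mult_distrib2)
    then show ?thesis using d by blast
  qed
  have sq: "a = b" if "a * a = b * b" for a b :: nat
    using that by (metis power2_eq_square power2_eq_imp_eq zero_le)
  have A: "?cl \<and> ?PA m" if a: "?A m" for m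
  proof -
    have cl: ?cl using extraspecial_2_classes a by blast
    have D: "card derived_subgroup = 2" using extraspecial_2_derived a by blast
    have c: "derived_index = 2 ^ (2 * m)" using derived_index(1) a D by (simp add: Coset.order_def)
    obtain d where d: "d * d = derived_index * (card derived_subgroup - 1)"
      "degree_pattern G = replicate_mset derived_index 1 + {#of_nat d#}" using pattern[OF cl] by blast
    have "d * d = 2 ^ m * 2 ^ m" using d(1) D c by (simp add: mult_2 power_add)
    then have "d = 2 ^ m" by (rule sq)
    then show ?thesis using cl d(2) c by simp
  qed
  have B: "?cl \<and> ?PB p n" if b: "?B p n H" for p n H
  proof -
    have dt: "doubly_transitive_frobenius G H" and cyc: "cyclic_group (G\<lparr>carrier := H\<rparr>)" using b by auto
    then have H: "subgroup H G" by (simp add: doubly_transitive_frobenius_def frobenius_complement_def)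
    interpret H: group "G\<lparr>carrier := H\<rparr>" by (rule subgroup_imp_group[OF H])
    interpret H: comm_group "G\<lparr>carrier := H\<rparr>" by (rule H.cyclic_imp_abelian_group[OF cyc])
    have ab: "x \<otimes>\<^bsub>G\<^esub> y = y \<otimes>\<^bsub>G\<^esub> x" if "x \<in> H" "y \<in> H" for x y using H.m_comm[of x y] that by simp
    note S = doubly_transitive_frobenius_structure[OF dt ab]
    have Hpos: "card H > 0" using S(2) card_carrier_pos by (metis gr0I mult_0 less_irrefl)
    have "card H * (card H + 1) = (p ^ n - 1) * p ^ n" using S(2) b by (simp add: Coset.order_def)
    then have pn: "p ^ n = card H + 1" using Hpos by (rule mult_pred_inj)
    have c: "derived_index = card H"
      using derived_index(1) S(1,2) by (metis mult_right_cancel add_is_0 one_neq_zero)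
    obtain d where d: "d * d = derived_index * (card derived_subgroup - 1)"
      "degree_pattern G = replicate_mset derived_index 1 + {#of_nat d#}" using pattern[OF S(3)] by blast
    have "d * d = card H * card H" using d(1) S(1) c by simp
    then have "d = card H" by (rule sq)
    then show ?thesis using S(3) d(2) c pn by simp
  qed
  have main: "(\<exists>m. ?A m \<and> ?PA m) \<or> (\<exists>p n H. ?B p n H \<and> ?PB p n)" if cl: ?cl
  proof -
    obtain d where d: "d \<ge> 2" "d * d = derived_index * (card derived_subgroup - 1)" using pattern[OF cl] by blast
    show ?thesis
    proof (cases "card derived_subgroup = 2")
      case True
      then obtain m where "?A m"
        using classes_derived_2_imp_extraspecial[OF cl True d(1)] d(2) by auto
      then show ?thesis using A by blast
    next
      case False
      obtain H where H: "doubly_transitive_frobenius G H" "cyclic_group (G\<lparr>carrier := H\<rparr>)"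
        using classes_imp_doubly_transitive_frobenius(1)[OF cl False] by blast
      obtain p n where pn: "Factorial_Ring.prime p" "n > 0" "card derived_subgroup = p ^ n"
        using classes_derived_p_group(1)[OF cl] by blast
      have "Coset.order G = (p ^ n - 1) * p ^ n"
        using derived_index(1) classes_imp_doubly_transitive_frobenius(2)[OF cl False] pn(3)
        by (simp add: Coset.order_def)
      then have "?B p n H" using pn H by blast
      then show ?thesis using B by blast
    qed
  qed
  have "?C \<longleftrightarrow> (\<exists>m. ?A m \<and> ?PA m) \<or> (\<exists>p n H. ?B p n H \<and> ?PB p n)"
    unfolding C_iff using main A B by blast
  moreover have "\<forall>m. ?A m \<longrightarrow> ?PA m" using A by blast
  moreover have "\<forall>p n H. ?B p n H \<longrightarrow> ?PB p n" using B by blast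
  ultimately show ?thesis by (simp only: conj_assoc)
qed

end
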